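(* Let $1<p\le\infty$ and let $\Omega\subset\mathbb{R}^N$, $N\ge2$, be a (not necessarily bounded) domain of class $C^2$, with boundary $\Gamma$, satisfying the uniform interior and exterior ball conditions. Let $x\in\Omega$ and $R>0$ be such that $B_R(x)\subset\Omega$ and $\overline{B_R(x)}\cap(\mathbb{R}^N\setminus\Omega)=\{y_x\}$ for a point $y_x\in\Gamma$, and suppose that $\kappa_j(y_x)<\frac1R$ for every $j=1,\dots,N-1$. For $\varepsilon>0$ let $u^\varepsilon$ be the bounded viscosity solution of $$u-\varepsilon^2\Delta_p^G u=0 \ \text{ in } \Omega,\qquad u=1 \ \text{ on } \Gamma,$$ and, for $1<q\le\infty$, let $\mu_{q,\varepsilon}(x)$ be the $q$-mean of $u^\varepsilon$ on $B_R(x)$. Then, if $1<q<\infty$, $$\lim_{\varepsilon\to0^+}\left(\frac{\varepsilon}{R}\right)^{-\frac{N+1}{2(q-1)}}\mu_{q,\varepsilon}(x)=\frac{c_{N,q}}{\left\{(p')^{\frac{N+1}{2}}\,\Pi_\Gamma(y_x)\right\}^{\frac1{2(q-1)}}},$$ where $$c_{N,q}=\left\{\frac{2^{-\frac{N+1}{2}}\,N!}{(q-1)^{\frac{N+1}{2}}\,\Gamma\!\left(\frac{N+1}{2}\right)}\right\}^{\frac1{q-1}}$$ and $\Gamma\left(\frac{N+1}{2}\right)$ denotes the value of Euler's gamma function. If $q=\infty$, then $\mu_{\infty,\varepsilon}(x)\to\frac12$ as $\varepsilon\to0^+$.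
   Context: $p'$ is the conjugate exponent of $p$, i.e. $1/p+1/p'=1$ ($p'=1$ if $p=\infty$). $B_R(x)$ is the open ball of radius $R$ centered at $x$. The game-theoretic (normalized) $p$-laplacian is formally $\Delta_p^G u=\frac1p|\nabla u|^{2-p}\,\mathrm{div}\{|\nabla u|^{p-2}\nabla u\}$ for $1<p<\infty$, that is $\frac1p\Delta u+\left(1-\frac2p\right)\frac{\langle\nabla^2u\,\nabla u,\nabla u\rangle}{|\nabla u|^2}$, and $\Delta_\infty^G u=\frac{\langle\nabla^2u\,\nabla u,\nabla u\rangle}{|\nabla u|^2}$ for $p=\infty$ (formally the same formula with $1/p=0$). Solutions are viscosity solutions, continuous on $\overline\Omega$, where the singularity at critical points is handled by semicontinuous envelopes: if $\varphi\in C^2$ and $u-\varphi$ has a local maximum (resp. minimum) at a point $z\in\Omega$, then $u(z)\le\varepsilon^2\Delta_p^G\varphi(z)$ (resp. $\ge$) if $\nabla\varphi(z)\ne0$, while if $\nabla\varphi(z)=0$ then $u(z)\le\varepsilon^2\max_{|e|=1}\left[\frac1p\Delta\varphi(z)+\left(1-\frac2p\right)\langle\nabla^2\varphi(z)e,e\rangle\right]$ (resp. $u(z)\ge\varepsilon^2\min_{|e|=1}[\cdots]$). Uniform interior and exterior ball conditions: there exist $r_i,r_e>0$ such that for every $y\in\Gamma$ there exist $z_i\in\Omega$ and $z_e\in\mathbb{R}^N\setminus\overline\Omega$ with $B_{r_i}(z_i)\subset\Omega\subset\mathbb{R}^N\setminus\overline{B}_{r_e}(z_e)$ and $\overline{B}_{r_i}(z_i)\cap\overline{B}_{r_e}(z_e)=\{y\}$.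 $\kappa_1,\dots,\kappa_{N-1}$ are the principal curvatures of $\Gamma$ with respect to the inward normal (so that they are positive for the boundary of a ball), and $\Pi_\Gamma(y_x)=\prod_{j=1}^{N-1}[1-R\,\kappa_j(y_x)]$. The $q$-mean of a function $u$ on $B_R(x)$ is the unique $\mu\in\mathbb{R}$ such that $\|u-\mu\|_{L^q(B_R(x))}\le\|u-\lambda\|_{L^q(B_R(x))}$ for all $\lambda\in\mathbb{R}$. *)

theory Defs
  imports "HOL-Analysis.Analysis" "HOL-Probability.Essential_Supremum"
begin

definition grad :: "(real^'n \<Rightarrow> real) \<Rightarrow> real^'n \<Rightarrow> real^'n" where
  "grad f x = (THE D. GDERIV f x :> D)"

definition hessian :: "(real^'n \<Rightarrow> real) \<Rightarrow> real^'n \<Rightarrow> real^'n^'n" where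
  "hessian f x = matrix (frechet_derivative (grad f) (at x))"

text \<open>Twice continuously differentiable on an open set \<open>S\<close>.\<close>
definition C2_on :: "(real^'n) set \<Rightarrow> (real^'n \<Rightarrow> real) \<Rightarrow> bool" where
  "C2_on S f \<longleftrightarrow> (\<forall>x\<in>S. f differentiable (at x)) \<and> (\<forall>x\<in>S. grad f differentiable (at x)) \<and>
     continuous_on S (hessian f)"

text \<open>Near \<open>y\<close>, the set \<open>\<Omega>\<close> is the part lying strictly above the graph of a \<open>C\<^sup>2\<close> function of the
  \<open>N - 1\<close> coordinates orthogonal to the unit vector \<open>\<nu>\<close>, where \<open>\<nu>\<close> plays the role of the last
  coordinate direction. A function of those coordinates is represented by a function \<open>\<gamma>\<close> on the
  whole space that is constant in the direction \<open>\<nu>\<close>.\<close>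
definition C2_graph_at :: "(real^'n) set \<Rightarrow> real^'n \<Rightarrow> real^'n \<Rightarrow> (real^'n \<Rightarrow> real) \<Rightarrow> bool" where
  "C2_graph_at \<Omega> y \<nu> \<gamma> \<longleftrightarrow> norm \<nu> = 1 \<and> C2_on UNIV \<gamma> \<and> (\<forall>z t. \<gamma> (z + t *\<^sub>R \<nu>) = \<gamma> z) \<and>
     (\<exists>r>0. \<Omega> \<inter> ball y r = {z \<in> ball y r. \<gamma> z < z \<bullet> \<nu>})"

definition C2_domain :: "(real^'n) set \<Rightarrow> bool" where
  "C2_domain \<Omega> \<longleftrightarrow> open \<Omega> \<and> connected \<Omega> \<and> \<Omega> \<noteq> {} \<and>
     (\<forall>y\<in>frontier \<Omega>. \<exists>\<nu> \<gamma>. C2_graph_at \<Omega> y \<nu> \<gamma>)"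

definition uniform_ball_conditions :: "(real^'n) set \<Rightarrow> bool" where
  "uniform_ball_conditions \<Omega> \<longleftrightarrow>
     (\<exists>ri>0. \<exists>re>0. \<forall>y\<in>frontier \<Omega>. \<exists>zi\<in>\<Omega>. \<exists>ze\<in>- closure \<Omega>.
        ball zi ri \<subseteq> \<Omega> \<and> \<Omega> \<subseteq> - cball ze re \<and> cball zi ri \<inter> cball ze re = {y})"

text \<open>The numbers \<open>\<kappa> 1, \<dots>, \<kappa> (N - 1)\<close> are the principal curvatures, with multiplicity, of
  \<open>frontier \<Omega>\<close> at \<open>y\<close> with respect to the inward normal: the boundary is written as a graph over
  its tangent hyperplane at \<open>y\<close> (so \<open>grad \<gamma> y = 0\<close>, which makes \<open>\<nu>\<close> the inward unit normal),
  and they are the eigenvalues of the Hessian of \<open>\<gamma>\<close> on that hyperplane, with an orthonormal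
  basis \<open>e\<close> of principal directions. For a ball of radius \<open>r\<close> they are all equal to \<open>1 / r\<close>.\<close>
definition principal_curvatures :: "(real^'n) set \<Rightarrow> real^'n \<Rightarrow> (nat \<Rightarrow> real) \<Rightarrow> bool" where
  "principal_curvatures \<Omega> y \<kappa> \<longleftrightarrow>
     (\<exists>\<nu> \<gamma> e. C2_graph_at \<Omega> y \<nu> \<gamma> \<and> grad \<gamma> y = 0 \<and>
        (\<forall>i\<in>{1..<CARD('n)}. e i \<bullet> \<nu> = 0 \<and>
           (\<forall>j\<in>{1..<CARD('n)}. e i \<bullet> e j = (if i = j then 1 else 0)) \<and>
           hessian \<gamma> y *v e i = \<kappa> i *\<^sub>R e i))"

text \<open>The exponent \<open>p\<close> ranges over \<open>(1, \<infinity>]\<close>, and \<open>1 / p = 0\<close> if \<open>p = \<infinity>\<close>.\<close>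
definition game_operator_dir ::
  "ereal \<Rightarrow> (real^'n \<Rightarrow> real) \<Rightarrow> real^'n \<Rightarrow> real^'n \<Rightarrow> real" where
  "game_operator_dir p \<phi> z e =
     real_of_ereal (1 / p) * trace (hessian \<phi> z) +
     (1 - 2 * real_of_ereal (1 / p)) * ((hessian \<phi> z *v e) \<bullet> e)"

text \<open>The normalized \<open>p\<close>-laplacian, meaningful where \<open>grad \<phi> z \<noteq> 0\<close>.\<close>
definition game_laplacian :: "ereal \<Rightarrow> (real^'n \<Rightarrow> real) \<Rightarrow> real^'n \<Rightarrow> real" where
  "game_laplacian p \<phi> z =
     real_of_ereal (1 / p) * trace (hessian \<phi> z) +
     (1 - 2 * real_of_ereal (1 / p)) *
       (((hessian \<phi> z *v grad \<phi> z) \<bullet> grad \<phi> z) / (norm (grad \<phi> z))\<^sup>2)"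

text \<open>Supremum and infimum over the unit sphere are attained, that is, a maximum and a minimum.\<close>
definition game_laplacian_upper :: "ereal \<Rightarrow> (real^'n \<Rightarrow> real) \<Rightarrow> real^'n \<Rightarrow> real" where
  "game_laplacian_upper p \<phi> z =
     (if grad \<phi> z \<noteq> 0 then game_laplacian p \<phi> z
      else (SUP e\<in>sphere 0 1. game_operator_dir p \<phi> z e))"

definition game_laplacian_lower :: "ereal \<Rightarrow> (real^'n \<Rightarrow> real) \<Rightarrow> real^'n \<Rightarrow> real" where
  "game_laplacian_lower p \<phi> z =
     (if grad \<phi> z \<noteq> 0 then game_laplacian p \<phi> z
      else (INF e\<in>sphere 0 1. game_operator_dir p \<phi> z e))"

text \<open>Viscosity sub- and supersolutions of \<open>u - \<epsilon>\<^sup>2 \<Delta> u = 0\<close> in the open set \<open>\<Omega>\<close>, where \<open>\<Delta>\<close>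
  denotes the normalized \<open>p\<close>-laplacian.\<close>
definition viscosity_subsolution ::
  "ereal \<Rightarrow> real \<Rightarrow> (real^'n) set \<Rightarrow> (real^'n \<Rightarrow> real) \<Rightarrow> bool" where
  "viscosity_subsolution p \<epsilon> \<Omega> u \<longleftrightarrow>
     (\<forall>\<phi>. \<forall>z\<in>\<Omega>. C2_on \<Omega> \<phi> \<and> (\<forall>\<^sub>F w in nhds z. u w - \<phi> w \<le> u z - \<phi> z) \<longrightarrow>
        u z \<le> \<epsilon>\<^sup>2 * game_laplacian_upper p \<phi> z)"

definition viscosity_supersolution ::
  "ereal \<Rightarrow> real \<Rightarrow> (real^'n) set \<Rightarrow> (real^'n \<Rightarrow> real) \<Rightarrow> bool" where
  "viscosity_supersolution p \<epsilon> \<Omega> u \<longleftrightarrow>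
     (\<forall>\<phi>. \<forall>z\<in>\<Omega>. C2_on \<Omega> \<phi> \<and> (\<forall>\<^sub>F w in nhds z. u w - \<phi> w \<ge> u z - \<phi> z) \<longrightarrow>
        u z \<ge> \<epsilon>\<^sup>2 * game_laplacian_lower p \<phi> z)"

definition bounded_viscosity_solution ::
  "ereal \<Rightarrow> real \<Rightarrow> (real^'n) set \<Rightarrow> (real^'n \<Rightarrow> real) \<Rightarrow> bool" where
  "bounded_viscosity_solution p \<epsilon> \<Omega> u \<longleftrightarrow>
     continuous_on (closure \<Omega>) u \<and> bounded (u ` closure \<Omega>) \<and>
     viscosity_subsolution p \<epsilon> \<Omega> u \<and> viscosity_supersolution p \<epsilon> \<Omega> u \<and>
     (\<forall>y\<in>frontier \<Omega>. u y = 1)"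

text \<open>The explicit value \<open>\<infinity>\<close> is needed because the Bochner integral of a non-integrable function
  is \<open>0\<close>; \<^const>\<open>esssup\<close> takes care of this by itself.\<close>
definition Lq_norm :: "ereal \<Rightarrow> 'a measure \<Rightarrow> ('a \<Rightarrow> real) \<Rightarrow> ereal" where
  "Lq_norm q M f =
     (if q = \<infinity> then esssup M (\<lambda>x. ereal \<bar>f x\<bar>)
      else if f \<in> borel_measurable M \<and> integrable M (\<lambda>x. \<bar>f x\<bar> powr real_of_ereal q)
      then ereal ((LINT x|M. \<bar>f x\<bar> powr real_of_ereal q) powr (1 / real_of_ereal q))
      else \<infinity>)"

definition q_mean :: "ereal \<Rightarrow> (real^'n) set \<Rightarrow> (real^'n \<Rightarrow> real) \<Rightarrow> real" where
  "q_mean q B u =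
     (THE \<mu>. \<forall>\<xi>::real. Lq_norm q (lebesgue_on B) (\<lambda>z. u z - \<mu>)
                \<le> Lq_norm q (lebesgue_on B) (\<lambda>z. u z - \<xi>))"

definition c_const :: "nat \<Rightarrow> real \<Rightarrow> real" where
  "c_const N q =
     (2 powr (- (real N + 1) / 2) * fact N /
       ((q - 1) powr ((real N + 1) / 2) * Gamma ((real N + 1) / 2))) powr (1 / (q - 1))"

end

theory Submission
  imports Defs "HOL-Probability.Distributions" "HOL-Real_Asymp.Real_Asymp"
begin

text \<open>
  A radial function \<open>exp (\<beta> (sqrt (\<delta>\<^sup>2 + |z - c|\<^sup>2) - g))\<close> is smooth, and for small \<open>\<epsilon>\<close> it is a
  supersolution for \<open>\<beta>\<close> slightly below \<open>sqrt p' / \<epsilon>\<close>, and a subsolution away from \<open>c\<close> for \<open>\<beta>\<close>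
  slightly below \<open>- sqrt p' / \<epsilon>\<close>. Used as a test function in the interior and exterior balls at
  the foot point of \<open>z\<close>, which are aligned with \<open>z\<close>, it traps \<open>u \<epsilon> z\<close> between
  \<open>exp (- (1 \<plusminus> \<eta>) sqrt p' dist(z, \<Gamma>) / \<epsilon>)\<close>.

  In coordinates at \<open>y\<close> scaled by \<open>\<epsilon>\<close> in the normal and by \<open>sqrt \<epsilon>\<close> in the tangential directions,
  the ball becomes a paraboloid and \<open>u \<epsilon>\<close> converges to
  \<open>exp (- sqrt p' (s - \<Sum>\<kappa>\<^sub>j t\<^sub>j\<^sup>2 / 2))\<close>; since \<open>\<kappa>\<^sub>j < 1 / R\<close>, dominated convergence applies and
  the limit integral is Gaussian.

  The \<open>q\<close>-mean is the zero of the decreasing function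
  \<open>l \<mapsto> \<integral> (u - l)\<^sub>+ powr (q - 1) - \<integral> (l - u)\<^sub>+ powr (q - 1)\<close>. At \<open>l = \<tau> (\<epsilon> / R) powr ((N + 1) / (2 (q - 1)))\<close>
  the first integral follows the Gaussian asymptotics, while the second is asymptotic to
  \<open>l powr (q - 1)\<close> times the volume of the ball, because \<open>u \<epsilon> / l \<longlonglongrightarrow> 0\<close> pointwise.
  The sign of the difference thus locates the \<open>q\<close>-mean.
\<close>

section \<open>Radial test functions\<close>

text \<open>The unknown itself occurs in the equation with coefficient 1, so where a smooth barrier
  touches \<open>u\<close> the viscosity inequality compares the two values directly; every
  comparison below is of this kind. Since \<Omega> may be unbounded, touching points have to be
  produced by a quadratic penalty or by the decay of the barrier.

  On a radial exponential with rate \<beta> the operator has leading coefficient (1 - 1/p)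
  \<beta>^2, with corrections linear in \<beta>. Balancing it with \<epsilon>^(-2) forces |\<beta>|
  \<epsilon> to be sqrt p'.

  The decay rate is obtained only up to a factor 1 \<plusminus> \<eta>. This is enough because at
  the zoomed scale the distance divided by \<epsilon> stays bounded, so a small relative error in
  the exponent disappears in the limit. For the same reason the loss caused by smoothing the norm
  must be relative to the distance; an additive loss \<delta> would be fatal at distances of order
  \<epsilon>.

  The exponent (N + 1) / 2 is that of the Jacobian \<epsilon> (sqrt \<epsilon>)^(N - 1). For q =
  \<infinity> the mean is the midpoint between infimum and supremum; the supremum is 1 because of
  the contact point, and the infimum tends to 0.\<close>

lemma grad_eqI: "GDERIV f x :> D \<Longrightarrow> grad f x = D"
  unfolding grad_def
proof (rule the_equality)
  fix D' assume "GDERIV f x :> D" "GDERIV f x :> D'"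
  hence "(\<lambda>h. inner h D) = (\<lambda>h. inner h D')"
    unfolding gderiv_def by (rule has_derivative_unique)
  hence "(D' - D) \<bullet> D = (D' - D) \<bullet> D'" by meson
  hence "(D' - D) \<bullet> (D' - D) = 0" by (simp add: inner_diff_right)
  thus "D' = D" by simp
qed

lemma GDERIV_grad:
  assumes "f differentiable (at x)"
  shows "GDERIV f x :> grad f x"
proof -
  obtain f' where f': "(f has_derivative f') (at x)"
    using assms by (auto simp: differentiable_def)
  have lin: "linear f'" using f' has_derivative_linear by blast
  define D where "D = (\<chi> i. f' (axis i 1))"
  have "f' h = h \<bullet> D" for h
  proof -
    have "f' h = f' (\<Sum>i\<in>UNIV. h $ i *\<^sub>R axis i 1)"
      by (metis basis_expansion scalar_mult_eq_scaleR)
    also have "\<dots> = (\<Sum>i\<in>UNIV. h $ i * f' (axis i 1))"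
      by (simp add: linear_sum[OF lin] linear_cmul[OF lin])
    finally show ?thesis by (simp add: D_def inner_vec_def)
  qed
  hence "f' = (\<lambda>h. h \<bullet> D)" by auto
  hence "GDERIV f x :> D" using f' by (simp add: gderiv_def)
  thus ?thesis using grad_eqI by metis
qed

abbreviation sqdist :: "'a::real_normed_vector \<Rightarrow> 'a \<Rightarrow> real" where
  "sqdist w c \<equiv> (norm (w - c))\<^sup>2"

text \<open>With a, b the first two derivatives of a profile h at s = |w - c|^2, the Hessian of h(|w
  - c|^2) is 2a I plus 4b times the tensor square of w - c. Its trace is 2Na + 4bs and its radial
  eigenvalue is 2a + 4bs.\<close>

definition radial_operator :: "nat \<Rightarrow> ereal \<Rightarrow> real \<Rightarrow> real \<Rightarrow> real \<Rightarrow> real" where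
  "radial_operator N p a b s = real_of_ereal (1 / p) * (2 * real N * a + 4 * b * s) +
     (1 - 2 * real_of_ereal (1 / p)) * (2 * a + 4 * b * s)"

text \<open>The profile depends on the squared distance because this is smooth at \<open>c\<close>
  too, and test functions have to be C2 on all of \<Omega>. The derivatives at s = 0 are two-sided
  so that the chain rule applies at the centre.\<close>

locale radial_profile =
  fixes h h1 h2 :: "real \<Rightarrow> real" and c :: "real^'n"
  assumes deriv1: "s \<ge> 0 \<Longrightarrow> (h has_real_derivative h1 s) (at s)"
    and deriv2: "s \<ge> 0 \<Longrightarrow> (h1 has_real_derivative h2 s) (at s)"
    and cont2: "continuous_on {0..} h2"
begin

definition \<phi> :: "real^'n \<Rightarrow> real" where
  "\<phi> w = h (sqdist w c)"

lemma has_derivative_norm_sq: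
  "((\<lambda>w. sqdist w c) has_derivative (\<lambda>v. 2 * (v \<bullet> (w - c)))) (at w)"
  unfolding power2_norm_eq_inner
  by (auto intro!: derivative_eq_intros simp: inner_commute)

lemma GDERIV_\<phi>: "GDERIV \<phi> w :> (2 * h1 (sqdist w c)) *\<^sub>R (w - c)"
  unfolding gderiv_def \<phi>_def
  by (rule has_derivative_eq_rhs, rule has_derivative_compose[OF has_derivative_norm_sq],
      rule deriv1[unfolded has_field_derivative_def]) auto

lemma continuous_on_\<phi>: "continuous_on S \<phi>"
  using GDERIV_\<phi> by (intro continuous_at_imp_continuous_on)
    (auto simp: gderiv_def intro: has_derivative_continuous)

lemma grad_\<phi>: "grad \<phi> w = (2 * h1 (sqdist w c)) *\<^sub>R (w - c)"
  by (rule grad_eqI[OF GDERIV_\<phi>])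

lemma has_derivative_grad_\<phi>:
  "(grad \<phi> has_derivative (\<lambda>v. (2 * h1 (sqdist w c)) *\<^sub>R v +
      (4 * h2 (sqdist w c) * (v \<bullet> (w - c))) *\<^sub>R (w - c))) (at w)"
proof -
  have *: "((\<lambda>w. h1 (sqdist w c)) has_derivative
     (\<lambda>v. h2 (sqdist w c) * (2 * (v \<bullet> (w - c))))) (at w)"
    by (rule has_derivative_compose[OF has_derivative_norm_sq],
      rule deriv2[unfolded has_field_derivative_def]) auto
  show ?thesis unfolding grad_\<phi>[abs_def]
    by (rule has_derivative_eq_rhs[OF has_derivative_scaleR[OF has_derivative_mult_right[OF *]
          has_derivative_diff[OF has_derivative_ident has_derivative_const]]])
      (simp add: fun_eq_iff mult.assoc)
qed

lemma hessian_\<phi>_mult: "hessian \<phi> w *v v = (2 * h1 (sqdist w c)) *\<^sub>R v +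
      (4 * h2 (sqdist w c) * (v \<bullet> (w - c))) *\<^sub>R (w - c)"
proof -
  note D = has_derivative_grad_\<phi>[of w]
  show ?thesis
    unfolding hessian_def frechet_derivative_at[OF D, symmetric]
    by (rule matrix_works[OF has_derivative_linear[OF D, folded linear_matrix_vector_mul_eq]])
qed

lemma hessian_\<phi>_nth: "hessian \<phi> w $ i $ j =
   (if i = j then 2 * h1 (sqdist w c) else 0) +
      4 * h2 (sqdist w c) * ((w - c) $ j) * ((w - c) $ i)"
proof -
  have "hessian \<phi> w $ i $ j = (hessian \<phi> w *v axis j 1) $ i"
    by (simp add: matrix_vector_mult_basis column_def)
  also have "\<dots> = (if i = j then 2 * h1 (sqdist w c) else 0) +
      4 * h2 (sqdist w c) * ((w - c) $ j) * ((w - c) $ i)"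
    unfolding hessian_\<phi>_mult by (simp add: inner_axis') (simp add: axis_def)
  finally show ?thesis .
qed

lemma trace_hessian_\<phi>: "trace (hessian \<phi> w) =
   2 * real CARD('n) * h1 (sqdist w c) + 4 * h2 (sqdist w c) * sqdist w c"
proof -
  have "(\<Sum>i\<in>UNIV. 4 * a * ((w - c) $ i) * ((w - c) $ i)) = 4 * a * sqdist w c" for a :: real
    unfolding power2_norm_eq_inner inner_vec_def by (simp add: sum_distrib_left mult.assoc mult.left_commute[of _ 4] del: vector_minus_component)
  thus ?thesis unfolding trace_def hessian_\<phi>_nth by (simp add: sum.distrib)
qed

lemma C2_on_\<phi>: "C2_on S \<phi>"
proof -
  have c1: "continuous_on {0..} h1"
    using deriv2 by (auto intro!: continuous_at_imp_continuous_on DERIV_isCont)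
  have "continuous_on S (\<lambda>w. hessian \<phi> w $ i $ j)" for i j
  proof -
    have "continuous_on S (\<lambda>w. h1 (sqdist w c))" "continuous_on S (\<lambda>w. h2 (sqdist w c))"
      by (rule continuous_on_compose2[OF c1] continuous_on_compose2[OF cont2];
          auto intro!: continuous_intros)+
    thus ?thesis unfolding hessian_\<phi>_nth
      by (cases "i = j") (simp_all, (intro continuous_intros; assumption)+)
  qed
  hence "continuous_on S (\<lambda>w. \<chi> i j. hessian \<phi> w $ i $ j)"
    by (intro continuous_on_vec_lambda)
  moreover have "\<phi> differentiable (at w)" for w
    using GDERIV_\<phi>[of w] unfolding gderiv_def differentiable_def by blast
  moreover have "grad \<phi> differentiable (at w)" for w
    using has_derivative_grad_\<phi>[of w] unfolding differentiable_def by blast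
  ultimately show ?thesis unfolding C2_on_def by simp
qed

text \<open>Away from \<open>c\<close> the gradient is radial, hence an eigenvector of the Hessian.
  At \<open>c\<close>, the only critical point when \<open>h1\<close> does not vanish, the Hessian
  is a multiple of the identity, so the bracket does not depend on the direction and both envelopes
  agree.\<close>

lemma game_laplacian_\<phi>:
  assumes "h1 (sqdist w c) \<noteq> 0"
  shows "game_laplacian_upper p \<phi> w = radial_operator CARD('n) p (h1 (sqdist w c)) (h2 (sqdist w c)) (sqdist w c)"
    and "game_laplacian_lower p \<phi> w = radial_operator CARD('n) p (h1 (sqdist w c)) (h2 (sqdist w c)) (sqdist w c)"
proof -
  let ?s = "sqdist w c"
  have "game_laplacian p \<phi> w = radial_operator CARD('n) p (h1 ?s) (h2 ?s) ?s" if "w \<noteq> c"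
  proof -
    have s: "(w - c) \<bullet> (w - c) = ?s" "?s \<noteq> 0" "norm (w - c) \<noteq> 0"
      using that by (auto simp: power2_norm_eq_inner)
    have "((a *\<^sub>R k *\<^sub>R v + (b * (k *\<^sub>R v \<bullet> v)) *\<^sub>R v) \<bullet> k *\<^sub>R v)
        = (a + b * s) * (norm (k *\<^sub>R v))\<^sup>2" if "v \<bullet> v = s" for a b k s :: real and v :: "real^'n"
      using that unfolding power2_norm_eq_inner by (simp add: inner_add_left power2_eq_square algebra_simps)
    from this[OF s(1)]
    have "((hessian \<phi> w *v grad \<phi> w) \<bullet> grad \<phi> w) = (2 * h1 ?s + 4 * h2 ?s * ?s) * (norm (grad \<phi> w))\<^sup>2"
      unfolding hessian_\<phi>_mult grad_\<phi> .
    moreover have "grad \<phi> w \<noteq> 0" unfolding grad_\<phi> using that assms by simp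
    ultimately show ?thesis unfolding game_laplacian_def radial_operator_def trace_hessian_\<phi> by simp
  qed
  moreover have dir: "game_operator_dir p \<phi> w e = radial_operator CARD('n) p (h1 ?s) (h2 ?s) ?s" if "w = c" "norm e = 1" for e
  proof -
    have "e \<bullet> e = 1" using that by (simp add: dot_square_norm)
    thus ?thesis
      unfolding game_operator_dir_def radial_operator_def trace_hessian_\<phi> hessian_\<phi>_mult using that by simp
  qed
  moreover have "grad \<phi> w = 0 \<longleftrightarrow> w = c" unfolding grad_\<phi> using assms by simp
  \<comment> \<open>A unit vector is exhibited so that supremum and infimum are taken over a
    singleton and not over the empty set.\<close>
  moreover obtain e0 :: "real^'n" where "e0 \<in> sphere 0 1"
    by (metis (no_types) mem_sphere_0 vector_choose_size zero_le_one)
  hence "sphere (0::real^'n) 1 \<noteq> {}" by blast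
  hence "game_operator_dir p \<phi> c ` sphere 0 1 = {radial_operator CARD('n) p (h1 0) (h2 0) 0}" if "w = c"
    using dir that by (simp add: image_constant_conv cong: image_cong_simp)
  ultimately have "game_laplacian_upper p \<phi> w = radial_operator CARD('n) p (h1 ?s) (h2 ?s) ?s \<and>
     game_laplacian_lower p \<phi> w = radial_operator CARD('n) p (h1 ?s) (h2 ?s) ?s"
    unfolding game_laplacian_upper_def game_laplacian_lower_def
    by (cases "w = c") simp_all
  thus "game_laplacian_upper p \<phi> w = radial_operator CARD('n) p (h1 ?s) (h2 ?s) ?s"
     "game_laplacian_lower p \<phi> w = radial_operator CARD('n) p (h1 ?s) (h2 ?s) ?s"
    by auto
qed

end

section \<open>Comparison with radial barriers\<close>

text \<open>A substitute for compactness of \<open>S\<close>: only points where \<open>f\<close> is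
  at least \<open>f a\<close> compete for the maximum, and they form a compact set.\<close>

lemma attains_max_superlevel:
  fixes f :: "'a::heine_borel \<Rightarrow> real"
  assumes "closed S" "continuous_on S f" "a \<in> S" "bounded {w \<in> S. f w \<ge> f a}"
  obtains m where "m \<in> S" "\<And>w. w \<in> S \<Longrightarrow> f w \<le> f m"
proof -
  have "{w \<in> S. f w \<ge> f a} = S \<inter> f -` {f a..}" by auto
  hence "closed {w \<in> S. f w \<ge> f a}"
    using continuous_closed_preimage[OF assms(2,1) closed_atLeast[of "f a"]] by metis
  hence "compact {w \<in> S. f w \<ge> f a}" using assms(4) compact_eq_bounded_closed by blast
  moreover have "continuous_on {w \<in> S. f w \<ge> f a} f" by (rule continuous_on_subset[OF assms(2)]) auto
  ultimately obtain m where m: "m \<in> S" "f m \<ge> f a" "\<And>w. w \<in> {w \<in> S. f w \<ge> f a} \<Longrightarrow> f w \<le> f m"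
    using continuous_attains_sup[of "{w \<in> S. f w \<ge> f a}" f] assms(3) by blast
  have "f w \<le> f m" if "w \<in> S" for w
    using m(2) m(3)[of w] that by (cases "f w \<ge> f a") auto
  thus ?thesis using that m(1) by blast
qed

context
  fixes p :: ereal and \<epsilon> :: real and \<Omega> :: "(real^'n) set" and u :: "real^'n \<Rightarrow> real"
  assumes open_dom: "open \<Omega>" and sol: "bounded_viscosity_solution p \<epsilon> \<Omega> u"
begin

lemma solution_continuous: "continuous_on (closure \<Omega>) u"
  and solution_bounded: "bounded (u ` closure \<Omega>)"
  and solution_boundary: "z \<in> frontier \<Omega> \<Longrightarrow> u z = 1"
  using sol unfolding bounded_viscosity_solution_def by auto

lemma solution_outside: "z \<in> closure \<Omega> \<Longrightarrow> z \<notin> \<Omega> \<Longrightarrow> u z = 1"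
  using solution_boundary open_dom by (simp add: frontier_def interior_open)

text \<open>The test function must be C2 on all of \<Omega> but has to touch only locally: the
  global profile provides the former, and the open set \<open>U\<close>, a ball or \<Omega> itself,
  the latter.\<close>

lemma subsolution_test:
  assumes "radial_profile h h1 h2" "open U" "z \<in> U" "U \<subseteq> \<Omega>" "h1 (sqdist z c) \<noteq> 0"
    and "\<And>w. w \<in> U \<Longrightarrow> u w - h (sqdist w c) \<le> u z - h (sqdist z c)"
  shows "u z \<le> \<epsilon>\<^sup>2 * radial_operator CARD('n) p (h1 (sqdist z c)) (h2 (sqdist z c)) (sqdist z c)"
proof -
  interpret radial_profile h h1 h2 c by fact
  have "\<forall>\<^sub>F w in nhds z. u w - \<phi> w \<le> u z - \<phi> z"
    unfolding eventually_nhds \<phi>_def using assms by blast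
  moreover have "viscosity_subsolution p \<epsilon> \<Omega> u" using sol unfolding bounded_viscosity_solution_def by simp
  moreover have "z \<in> \<Omega>" using assms by blast
  ultimately show ?thesis
    using C2_on_\<phi> unfolding viscosity_subsolution_def game_laplacian_\<phi>(1)[OF assms(5), symmetric] by blast
qed

lemma supersolution_test:
  assumes "radial_profile h h1 h2" "open U" "z \<in> U" "U \<subseteq> \<Omega>" "h1 (sqdist z c) \<noteq> 0"
    and "\<And>w. w \<in> U \<Longrightarrow> u w - h (sqdist w c) \<ge> u z - h (sqdist z c)"
  shows "u z \<ge> \<epsilon>\<^sup>2 * radial_operator CARD('n) p (h1 (sqdist z c)) (h2 (sqdist z c)) (sqdist z c)"
proof -
  interpret radial_profile h h1 h2 c by fact
  have "\<forall>\<^sub>F w in nhds z. u w - \<phi> w \<ge> u z - \<phi> z"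
    unfolding eventually_nhds \<phi>_def using assms by blast
  moreover have "viscosity_supersolution p \<epsilon> \<Omega> u" using sol unfolding bounded_viscosity_solution_def by simp
  moreover have "z \<in> \<Omega>" using assms by blast
  ultimately show ?thesis
    using C2_on_\<phi> unfolding viscosity_supersolution_def game_laplacian_\<phi>(2)[OF assms(5), symmetric] by blast
qed

section \<open>Maximum principle: solutions take values between 0 and 1\<close>

lemma radial_profile_linear: "radial_profile (\<lambda>s. a * s) (\<lambda>s. a) (\<lambda>s. 0)"
  by unfold_locales (auto intro!: derivative_eq_intros)

text \<open>The penalty outgrows any bounded function. It is written with \<open>w - 0\<close> so
  that it is literally a radial profile centred at 0.\<close>

lemma bounded_quadratic_superlevel:
  assumes "bounded (g ` S)" "\<delta> > 0"
  shows "bounded {w \<in> S. (g w :: real) - \<delta> * (norm (w - 0))\<^sup>2 \<ge> k}"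
proof -
  obtain M where M: "\<And>w. w \<in> S \<Longrightarrow> \<bar>g w\<bar> \<le> M"
    using assms(1) unfolding bounded_iff by auto
  have "norm w \<le> sqrt ((M - k) / \<delta>)" if "w \<in> S" "g w - \<delta> * (norm (w - 0))\<^sup>2 \<ge> k" for w
  proof -
    have "\<delta> * (norm w)\<^sup>2 \<le> M - k" using M[OF that(1)] that(2) by simp
    thus ?thesis using assms(2) by (intro real_le_rsqrt) (simp add: field_simps)
  qed
  thus ?thesis by (intro boundedI[where B="sqrt ((M - k) / \<delta>)"]) auto
qed

text \<open>The supremum of \<open>u\<close> need not be attained, so \<delta> |w|^2 is subtracted
  first. The operator maps this quadratic to a constant of order \<delta>, which bounds
  \<open>u\<close> at an interior maximum point of the difference; then \<delta> tends to 0.\<close>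

lemma solution_le_1:
  assumes z: "z \<in> closure \<Omega>"
  shows "u z \<le> 1"
proof -
  define K where "K = \<epsilon>\<^sup>2 * \<bar>radial_operator CARD('n) p 1 0 0\<bar>"
  have "u z \<le> 1 + \<delta> * (K + (norm z)\<^sup>2)" if \<delta>: "\<delta> > 0" "\<delta> * K \<le> 1" for \<delta>
  proof -
    let ?f = "\<lambda>w. u w - \<delta> * (norm (w - 0))\<^sup>2"
    have "continuous_on (closure \<Omega>) ?f" by (intro continuous_intros solution_continuous)
    from attains_max_superlevel[OF closed_closure this z bounded_quadratic_superlevel[OF solution_bounded \<delta>(1)]]
    obtain m where m: "m \<in> closure \<Omega>" "\<And>w. w \<in> closure \<Omega> \<Longrightarrow> ?f w \<le> ?f m" by blast
    have "u m \<le> 1 + \<delta> * K"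
    proof (cases "m \<in> \<Omega>")
      case True
      have "u m \<le> \<epsilon>\<^sup>2 * radial_operator CARD('n) p \<delta> 0 ((norm (m - 0))\<^sup>2)"
        by (rule subsolution_test[OF radial_profile_linear open_dom True subset_refl])
          (use \<delta> m(2) closure_subset in auto)
      also have "\<dots> = \<delta> * (\<epsilon>\<^sup>2 * radial_operator CARD('n) p 1 0 0)"
        unfolding radial_operator_def by (simp add: algebra_simps)
      also have "\<dots> \<le> \<delta> * K" using \<delta> unfolding K_def by (intro mult_left_mono) auto
      finally show ?thesis by simp
    next
      case False
      hence "u m = 1" using m(1) solution_outside by blast
      thus ?thesis using \<delta> by (simp add: K_def)
    qed
    moreover have "0 \<le> \<delta> * (norm m)\<^sup>2" using \<delta> by simp
    ultimately show ?thesis using m(2)[OF z] by (simp add: algebra_simps)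
  qed note * = this
  have "((\<lambda>\<delta>. 1 + \<delta> * (K + (norm z)\<^sup>2)) \<longlongrightarrow> 1 + 0 * (K + (norm z)\<^sup>2)) (at_right 0)"
    by (intro tendsto_intros)
  moreover have "\<forall>\<^sub>F \<delta> in at_right 0. \<delta> * K \<le> 1"
  proof -
    have "((\<lambda>\<delta>. \<delta> * K) \<longlongrightarrow> 0 * K) (at_right 0)" by (intro tendsto_intros)
    hence "\<forall>\<^sub>F \<delta> in at_right 0. \<delta> * K < 1" by (rule order_tendstoD) simp
    thus ?thesis by (rule eventually_mono) simp
  qed
  hence "\<forall>\<^sub>F \<delta> in at_right 0. u z \<le> 1 + \<delta> * (K + (norm z)\<^sup>2)"
    using eventually_at_right_less[of 0] by eventually_elim (use * in auto)
  ultimately show ?thesis by (auto intro: tendsto_lowerbound)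
qed

text \<open>The mirror image with \<open>- u\<close> in place of \<open>u\<close>; at a maximum
  point on the boundary the value 1 is already large enough.\<close>

lemma solution_nonneg:
  assumes z: "z \<in> closure \<Omega>"
  shows "u z \<ge> 0"
proof -
  define K where "K = \<epsilon>\<^sup>2 * \<bar>radial_operator CARD('n) p 1 0 0\<bar>"
  have "u z \<ge> - \<delta> * (K + (norm z)\<^sup>2)" if \<delta>: "\<delta> > 0" for \<delta>
  proof -
    let ?f = "\<lambda>w. - u w - \<delta> * (norm (w - 0))\<^sup>2"
    have bd: "bounded ((\<lambda>w. - u w) ` closure \<Omega>)"
      using solution_bounded unfolding bounded_iff by auto
    have "continuous_on (closure \<Omega>) ?f" by (intro continuous_intros solution_continuous)
    from attains_max_superlevel[OF closed_closure this z bounded_quadratic_superlevel[OF bd \<delta>]]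
    obtain m where m: "m \<in> closure \<Omega>" "\<And>w. w \<in> closure \<Omega> \<Longrightarrow> ?f w \<le> ?f m" by blast
    have "u m \<ge> - \<delta> * K"
    proof (cases "m \<in> \<Omega>")
      case True
      have "u m \<ge> \<epsilon>\<^sup>2 * radial_operator CARD('n) p (-\<delta>) 0 ((norm (m - 0))\<^sup>2)"
      proof (rule supersolution_test[OF radial_profile_linear open_dom True subset_refl])
        fix w assume "w \<in> \<Omega>"
        thus "u w - (- \<delta>) * (norm (w - 0))\<^sup>2 \<ge> u m - (- \<delta>) * (norm (m - 0))\<^sup>2"
          using m(2)[of w] closure_subset[of \<Omega>] by auto
      qed (use \<delta> in auto)
      moreover have "\<epsilon>\<^sup>2 * radial_operator CARD('n) p (-\<delta>) 0 ((norm (m - 0))\<^sup>2)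
          = - \<delta> * (\<epsilon>\<^sup>2 * radial_operator CARD('n) p 1 0 0)"
        unfolding radial_operator_def by (simp add: algebra_simps)
      moreover have "\<delta> * (\<epsilon>\<^sup>2 * radial_operator CARD('n) p 1 0 0) \<le> \<delta> * K"
        using \<delta> unfolding K_def by (intro mult_left_mono) auto
      ultimately show ?thesis by simp
    next
      case False
      hence "u m = 1" using m(1) solution_outside by blast
      moreover have "\<delta> * K \<ge> 0" using \<delta> by (simp add: K_def)
      ultimately show ?thesis by simp
    qed
    moreover have "0 \<le> \<delta> * (norm m)\<^sup>2" using \<delta> by simp
    ultimately show ?thesis using m(2)[OF z] by (simp add: algebra_simps)
  qed note * = this
  have "((\<lambda>\<delta>. - \<delta> * (K + (norm z)\<^sup>2)) \<longlongrightarrow> - 0 * (K + (norm z)\<^sup>2)) (at_right 0)"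
    by (intro tendsto_intros)
  moreover have "\<forall>\<^sub>F \<delta> in at_right 0. u z \<ge> - \<delta> * (K + (norm z)\<^sup>2)"
    using eventually_at_right_less[of 0] by eventually_elim (use * in auto)
  ultimately show ?thesis by (auto intro: tendsto_upperbound)
qed

text \<open>At a maximum point of \<open>u\<close> minus the barrier over the closed ball, either
  the viscosity inequality bounds \<open>u\<close> by \<epsilon>^2 times the operator and hence by
  the barrier, or the point lies on the sphere, where \<open>u\<close> is at most 1 and the barrier
  at least 1.\<close>

lemma upper_barrier:
  assumes prof: "radial_profile h h1 h2" and ball: "cball c r \<subseteq> closure \<Omega>" "ball c r \<subseteq> \<Omega>" "r > 0"
    and nz: "\<And>s. s \<ge> 0 \<Longrightarrow> h1 s \<noteq> 0"
    and bd: "h (r\<^sup>2) \<ge> 1"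
    and super: "\<And>s. s \<ge> 0 \<Longrightarrow> \<epsilon>\<^sup>2 * radial_operator CARD('n) p (h1 s) (h2 s) s \<le> h s"
    and z: "z \<in> cball c r"
  shows "u z \<le> h (sqdist z c)"
proof -
  interpret radial_profile h h1 h2 c by fact
  let ?f = "\<lambda>w. u w - h (sqdist w c)"
  have "continuous_on (cball c r) ?f"
    using continuous_on_\<phi> continuous_on_subset[OF solution_continuous ball(1)] unfolding \<phi>_def
    by (intro continuous_on_diff)
  with z obtain m where m: "m \<in> cball c r" "\<And>w. w \<in> cball c r \<Longrightarrow> ?f w \<le> ?f m"
    using continuous_attains_sup[OF compact_cball[of c r], of ?f] by blast
  have "?f m \<le> 0"
  proof (cases "m \<in> ball c r")
    case True
    have "u m \<le> \<epsilon>\<^sup>2 * radial_operator CARD('n) p (h1 (sqdist m c)) (h2 (sqdist m c)) (sqdist m c)"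
      by (rule subsolution_test[OF prof open_ball True ball(2)]) (use m nz in auto)
    thus ?thesis using super[of "sqdist m c"] by simp
  next
    case False
    hence "norm (m - c) = r" using m(1) by (auto simp: dist_norm norm_minus_commute)
    thus ?thesis using bd solution_le_1[of m] m(1) ball by auto
  qed
  thus ?thesis using m(2)[OF z] by simp
qed

text \<open>Here the comparison runs over the whole closure of \<Omega>, and the decay of the
  barrier replaces compactness. Since \<Omega> stays outside the ball, the profile has to be a
  subsolution only for s at least r^2, which keeps the centre out of play.\<close>

lemma lower_barrier:
  assumes prof: "radial_profile h h1 h2" and ball: "\<And>w. w \<in> closure \<Omega> \<Longrightarrow> norm (w - c) \<ge> r" "r > 0"
    and nz: "\<And>s. s \<ge> 0 \<Longrightarrow> h1 s \<noteq> 0"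
    and bd: "\<And>s. s \<ge> r\<^sup>2 \<Longrightarrow> h s \<le> 1"
    and inf: "(h \<longlongrightarrow> 0) at_top"
    and sub: "\<And>s. s \<ge> r\<^sup>2 \<Longrightarrow> \<epsilon>\<^sup>2 * radial_operator CARD('n) p (h1 s) (h2 s) s \<ge> h s"
    and z: "z \<in> closure \<Omega>"
  shows "u z \<ge> h (sqdist z c)"
proof (rule ccontr)
  interpret radial_profile h h1 h2 c by fact
  let ?f = "\<lambda>w. h (sqdist w c) - u w"
  assume "\<not> ?thesis"
  hence pos: "?f z > 0" by simp
  have cont: "continuous_on (closure \<Omega>) ?f"
    using continuous_on_\<phi> solution_continuous unfolding \<phi>_def by (intro continuous_on_diff)
  \<comment> \<open>Because \<open>u\<close> is nonnegative, a competitor with value at least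
    \<open>?f z\<close> has barrier value at least \<open>?f z\<close>, which is positive; the decay
    of \<open>h\<close> then confines it to a bounded set.\<close>
  have "\<forall>\<^sub>F s in at_top. h s < ?f z" using inf pos by (rule order_tendstoD)
  then obtain k where k: "\<And>s. s \<ge> k \<Longrightarrow> h s < ?f z" by (auto simp: eventually_at_top_linorder)
  have "norm w \<le> sqrt \<bar>k\<bar> + norm c" if "w \<in> closure \<Omega>" "?f w \<ge> ?f z" for w
  proof -
    have "h (sqdist w c) \<ge> ?f z" using that solution_nonneg[of w] by simp
    hence "sqdist w c \<le> \<bar>k\<bar>" using k[of "sqdist w c"] by linarith
    hence "norm (w - c) \<le> sqrt \<bar>k\<bar>" by (rule real_le_rsqrt)
    thus ?thesis using norm_triangle_sub[of w c] by simp
  qed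
  hence "bounded {w \<in> closure \<Omega>. ?f w \<ge> ?f z}" by (intro boundedI[where B="sqrt \<bar>k\<bar> + norm c"]) auto
  then obtain m where m: "m \<in> closure \<Omega>" "\<And>w. w \<in> closure \<Omega> \<Longrightarrow> ?f w \<le> ?f m"
    using attains_max_superlevel[OF closed_closure cont z] by blast
  have "sqdist m c \<ge> r\<^sup>2" using ball(1)[OF m(1)] ball(2) by (simp add: power_mono)
  have "?f m \<le> 0"
  proof (cases "m \<in> \<Omega>")
    case True
    have "u m \<ge> \<epsilon>\<^sup>2 * radial_operator CARD('n) p (h1 (sqdist m c)) (h2 (sqdist m c)) (sqdist m c)"
      proof (rule supersolution_test[OF prof open_dom True subset_refl])
      fix w assume "w \<in> \<Omega>"
      hence "?f w \<le> ?f m" using m(2) closure_subset by blast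
      thus "u w - h (sqdist w c) \<ge> u m - h (sqdist m c)" by simp
    qed (use nz in auto)
    thus ?thesis using sub[of "sqdist m c"] \<open>sqdist m c \<ge> r\<^sup>2\<close> by simp
  next
    case False
    hence "u m = 1" using m(1) solution_outside by blast
    thus ?thesis using bd \<open>sqdist m c \<ge> r\<^sup>2\<close> by simp
  qed
  thus False using m(2)[OF z] pos by simp
qed

end

section \<open>Exponential barriers\<close>

abbreviation recip :: "ereal \<Rightarrow> real" where
  "recip p \<equiv> real_of_ereal (1 / p)"

definition smoothed_norm :: "real \<Rightarrow> real \<Rightarrow> real" where
  "smoothed_norm \<delta> s = sqrt (\<delta>\<^sup>2 + s)"

lemma smoothed_norm_pos: "\<delta> > 0 \<Longrightarrow> s \<ge> 0 \<Longrightarrow> smoothed_norm \<delta> s > 0"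
  unfolding smoothed_norm_def by (simp add: add_pos_nonneg)

lemma smoothed_norm_sq: "s \<ge> 0 \<Longrightarrow> (smoothed_norm \<delta> s)\<^sup>2 = \<delta>\<^sup>2 + s"
  unfolding smoothed_norm_def by simp

lemma smoothed_norm_ge: "\<delta> > 0 \<Longrightarrow> s \<ge> 0 \<Longrightarrow> smoothed_norm \<delta> s \<ge> \<delta>"
  unfolding smoothed_norm_def by (intro real_le_rsqrt) simp

lemma smoothed_norm_le: "\<delta> > 0 \<Longrightarrow> r \<ge> 0 \<Longrightarrow> smoothed_norm \<delta> (r\<^sup>2) \<le> r + \<delta>"
  unfolding smoothed_norm_def by (intro real_le_lsqrt) (auto simp: power2_eq_square algebra_simps)

text \<open>Both parts come from factoring g'^2 - g^2 = r'^2 - r^2. The second one says that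
  smoothing costs a factor r' / (r' + 2\<delta>) in the distance to the outer sphere, a relative
  loss even for points very close to that sphere.\<close>

lemma smoothed_norm_diff:
  assumes "\<delta> > 0" "0 \<le> r" "r \<le> r'"
  shows "smoothed_norm \<delta> (r'\<^sup>2) - smoothed_norm \<delta> (r\<^sup>2) \<le> r' - r" (is "?g' - ?g \<le> _")
    and "(smoothed_norm \<delta> (r'\<^sup>2) - smoothed_norm \<delta> (r\<^sup>2)) * (r' + 2 * \<delta>) \<ge> (r' - r) * r'"
proof -
  have g: "?g > 0" "?g' > 0" "?g \<le> r + \<delta>" "?g' \<le> r' + \<delta>"
    using assms by (auto intro: smoothed_norm_pos smoothed_norm_le)
  have "?g \<ge> r" "?g' \<ge> r'" unfolding smoothed_norm_def by (intro real_le_rsqrt; simp)+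
  have le: "?g \<le> ?g'" unfolding smoothed_norm_def using assms by (simp add: power_mono)
  have "?g'\<^sup>2 - ?g\<^sup>2 = r'\<^sup>2 - r\<^sup>2" by (simp add: smoothed_norm_sq)
  hence eq: "(?g' - ?g) * (?g' + ?g) = (r' - r) * (r' + r)" by (simp add: power2_eq_square algebra_simps)
  show "?g' - ?g \<le> r' - r"
  proof (rule ccontr)
    assume "\<not> ?thesis"
    hence "(r' - r) * (r' + r) \<le> (r' - r) * (?g' + ?g)" "(r' - r) * (?g' + ?g) < (?g' - ?g) * (?g' + ?g)"
      using assms \<open>?g \<ge> r\<close> \<open>?g' \<ge> r'\<close> g by (auto intro!: mult_left_mono mult_strict_right_mono)
    thus False using eq by simp
  qed
  have "(r' - r) * r' * (r' + r + 2 * \<delta>) \<le> (r' - r) * (r' + r) * (r' + 2 * \<delta>)"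
    using assms by (simp add: algebra_simps mult_left_mono)
  also have "\<dots> = (?g' - ?g) * (?g' + ?g) * (r' + 2 * \<delta>)" using eq by simp
  also have "\<dots> \<le> (?g' - ?g) * (r' + r + 2 * \<delta>) * (r' + 2 * \<delta>)"
    using g assms le by (intro mult_right_mono mult_left_mono) auto
  finally have "(r' - r) * r' * (r' + r + 2 * \<delta>) \<le> (?g' - ?g) * (r' + 2 * \<delta>) * (r' + r + 2 * \<delta>)"
    by (simp add: mult_ac)
  thus "(?g' - ?g) * (r' + 2 * \<delta>) \<ge> (r' - r) * r'"
    using assms by (simp add: mult_le_cancel_right)
qed

text \<open>The argument \<open>s\<close> is a squared distance, and \<open>g\<close> will be the
  smoothed norm at radius r, which makes the barrier equal to 1 on the sphere of radius r. The next
  two functions are its derivatives in \<open>s\<close>.\<close>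

definition exp_profile :: "real \<Rightarrow> real \<Rightarrow> real \<Rightarrow> real \<Rightarrow> real" where
  "exp_profile \<beta> \<delta> g s = exp (\<beta> * (smoothed_norm \<delta> s - g))"

definition exp_profile1 :: "real \<Rightarrow> real \<Rightarrow> real \<Rightarrow> real \<Rightarrow> real" where
  "exp_profile1 \<beta> \<delta> g s = \<beta> / (2 * smoothed_norm \<delta> s) * exp_profile \<beta> \<delta> g s"

definition exp_profile2 :: "real \<Rightarrow> real \<Rightarrow> real \<Rightarrow> real \<Rightarrow> real" where
  "exp_profile2 \<beta> \<delta> g s =
     (\<beta>\<^sup>2 / (4 * (smoothed_norm \<delta> s)\<^sup>2) - \<beta> / (4 * smoothed_norm \<delta> s ^ 3)) * exp_profile \<beta> \<delta> g s"

lemma radial_profile_exp: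
  assumes "\<delta> > 0"
  shows "radial_profile (exp_profile \<beta> \<delta> g) (exp_profile1 \<beta> \<delta> g) (exp_profile2 \<beta> \<delta> g)"
proof
  fix s :: real assume s: "s \<ge> 0"
  have G: "smoothed_norm \<delta> s > 0" using assms s by (rule smoothed_norm_pos)
  have D: "(smoothed_norm \<delta> has_real_derivative 1 / (2 * smoothed_norm \<delta> s)) (at s)"
    unfolding smoothed_norm_def using add_pos_nonneg[of "\<delta>\<^sup>2" s] assms s
    by (auto intro!: derivative_eq_intros simp: field_simps)
  have D1: "((\<lambda>s. \<beta> / (2 * smoothed_norm \<delta> s)) has_real_derivative - \<beta> / (4 * smoothed_norm \<delta> s ^ 3)) (at s)"
    by (rule DERIV_cong, rule DERIV_divide[OF DERIV_const DERIV_cmult[OF D]])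
      (use G in \<open>simp_all add: field_simps power2_eq_square power3_eq_cube\<close>)
  show D0: "(exp_profile \<beta> \<delta> g has_real_derivative exp_profile1 \<beta> \<delta> g s) (at s)"
    unfolding exp_profile_def exp_profile1_def
    by (rule derivative_eq_intros D refl)+ (simp add: field_simps)
  show "(exp_profile1 \<beta> \<delta> g has_real_derivative exp_profile2 \<beta> \<delta> g s) (at s)"
    unfolding exp_profile1_def[abs_def]
    by (rule DERIV_cong[OF DERIV_mult[OF D1 D0]])
      (use G in \<open>simp add: exp_profile2_def exp_profile1_def field_simps power2_eq_square power3_eq_cube\<close>)
next
  have "smoothed_norm \<delta> s \<noteq> 0" if "s \<in> {0..}" for s
    using smoothed_norm_pos[OF assms] that by (metis atLeast_iff less_irrefl)
  moreover have "continuous_on {0..} (smoothed_norm \<delta>)"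
    unfolding smoothed_norm_def by (intro continuous_intros)
  ultimately show "continuous_on {0..} (exp_profile2 \<beta> \<delta> g)"
    unfolding exp_profile2_def exp_profile_def by (intro continuous_intros) auto
qed

text \<open>For \<beta> of order 1 / \<epsilon> and fixed \<delta>, the terms linear in \<beta>
  become O(\<epsilon>) after multiplication by \<epsilon>^2, and only (1 - 1/p) \<beta>^2 s /
  (\<delta>^2 + s) survives.\<close>

lemma radial_operator_exp_profile:
  assumes "\<delta> > 0" "s \<ge> 0"
  shows "radial_operator N p (exp_profile1 \<beta> \<delta> g s) (exp_profile2 \<beta> \<delta> g s) s =
    exp_profile \<beta> \<delta> g s * ((1 + (real N - 2) * recip p) * (\<beta> / smoothed_norm \<delta> s) +
      (1 - recip p) * (\<beta>\<^sup>2 * s / (smoothed_norm \<delta> s)\<^sup>2 - \<beta> * s / smoothed_norm \<delta> s ^ 3))"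
proof -
  define G E P where "G = smoothed_norm \<delta> s" and "E = exp_profile \<beta> \<delta> g s" and "P = recip p"
  have "G > 0" unfolding G_def using assms by (rule smoothed_norm_pos)
  have "radial_operator N p a b s = (2 * real N * P + 2 - 4 * P) * a + 4 * (1 - P) * b * s" for a b
    unfolding radial_operator_def P_def[symmetric] by (simp add: algebra_simps)
  note * = this
  show ?thesis unfolding *
    unfolding exp_profile1_def exp_profile2_def G_def[symmetric] E_def[symmetric] P_def[symmetric]
    using \<open>G > 0\<close> by (simp add: field_simps power2_eq_square power3_eq_cube)
qed

text \<open>The number \<open>b\<close> is sqrt p', characterized by (1 - 1/p) b^2 = 1; for p =
  \<infinity> this reads b = 1.\<close>

context
  fixes p :: ereal and b :: real
  assumes P: "0 \<le> recip p" "recip p < 1"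
    and b: "b > 0" "(1 - recip p) * b\<^sup>2 = 1"
begin

text \<open>The threshold for \<epsilon> is chosen before the domain, the solution and the centre,
  because the ball will later move with the point at which \<open>u\<close> is estimated.\<close>

lemma decay_in_ball:
  fixes r \<eta> :: real
  assumes N: "CARD('n) \<ge> 2" and r: "r > 0" and \<eta>: "0 < \<eta>" "\<eta> < 1"
  shows "\<exists>\<epsilon>0>0. \<forall>\<epsilon> \<Omega> (u :: real^'n \<Rightarrow> real) c z. 0 < \<epsilon> \<longrightarrow> \<epsilon> < \<epsilon>0 \<longrightarrow> open \<Omega> \<longrightarrow>
     bounded_viscosity_solution p \<epsilon> \<Omega> u \<longrightarrow> ball c r \<subseteq> \<Omega> \<longrightarrow> z \<in> ball c r \<longrightarrow>
     u z \<le> exp (- ((1 - \<eta>) * b * (r - norm (z - c)) / \<epsilon>))"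
proof -
  define P where "P = recip p"
  have P': "0 \<le> P" "P < 1" "(1 - P) * b\<^sup>2 = 1" using P b unfolding P_def by auto
  define N where "N = real CARD('n)"
  have N2: "N \<ge> 2" using N unfolding N_def by simp
  \<comment> \<open>Then r + 2\<delta> = r (1 + \<eta>/2), so that smoothing costs about half of the
    allowed loss \<eta>.\<close>
  define \<delta> where "\<delta> = \<eta> * r / 4"
  have \<delta>: "\<delta> > 0" using r \<eta> by (simp add: \<delta>_def)
  \<comment> \<open>Keeps \<epsilon> N b / \<delta> below \<eta>/2, so that the linear terms fit
    between (1 - \<eta>/2)^2, which is the quadratic term for the rate (1 - \<eta>/2) b /
    \<epsilon>, and 1.\<close>
  define \<epsilon>0 where "\<epsilon>0 = \<eta> * \<delta> / (2 * N * b)"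
  have "\<epsilon>0 > 0" unfolding \<epsilon>0_def using \<eta> \<delta> b N2 by simp
  moreover have "u z \<le> exp (- ((1 - \<eta>) * b * (r - norm (z - c)) / \<epsilon>))"
    if \<epsilon>: "0 < \<epsilon>" "\<epsilon> < \<epsilon>0" and dom: "open \<Omega>" and sol: "bounded_viscosity_solution p \<epsilon> \<Omega> u"
      and ball: "ball c r \<subseteq> \<Omega>" and z: "z \<in> ball c r" for \<epsilon> \<Omega> and u :: "real^'n \<Rightarrow> real" and c z
  proof -
    define \<alpha> where "\<alpha> = (1 - \<eta> / 2) * b / \<epsilon>"
    have \<alpha>: "\<alpha> > 0" using \<eta> b \<epsilon> by (simp add: \<alpha>_def)
    define g where "g = smoothed_norm \<delta> (r\<^sup>2)"
    have cball: "cball c r \<subseteq> closure \<Omega>"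
      using closure_mono[OF ball] r by simp
    have "u z \<le> exp_profile \<alpha> \<delta> g (sqdist z c)"
    proof (rule upper_barrier[OF dom sol radial_profile_exp[OF \<delta>] cball ball r])
      show "exp_profile1 \<alpha> \<delta> g s \<noteq> 0" if "s \<ge> 0" for s
        using smoothed_norm_pos[OF \<delta> that] \<alpha> by (simp add: exp_profile1_def exp_profile_def)
      show "1 \<le> exp_profile \<alpha> \<delta> g (r\<^sup>2)" by (simp add: exp_profile_def g_def)
      show "z \<in> cball c r" using z by auto
      fix s :: real assume s: "s \<ge> 0"
      define G where "G = smoothed_norm \<delta> s"
      let ?rate = "(1 + (N - 2) * P) * (\<alpha> / G) + (1 - P) * (\<alpha>\<^sup>2 * s / G\<^sup>2 - \<alpha> * s / G ^ 3)"
      have G: "G \<ge> \<delta>" "G > 0" "G\<^sup>2 = \<delta>\<^sup>2 + s"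
        unfolding G_def using smoothed_norm_ge[OF \<delta> s] smoothed_norm_pos[OF \<delta> s] smoothed_norm_sq[OF s] by auto
      have "(N - 2) * P \<le> (N - 2) * 1" "0 \<le> (N - 2) * P" using P' N2
        mult_left_mono[of P 1 "N - 2"] by auto
      hence "(1 + (N - 2) * P) * (\<alpha> / G) \<le> N * (\<alpha> / \<delta>)"
        using G \<alpha> \<delta> by (intro mult_mono frac_le) auto
      moreover have "\<alpha>\<^sup>2 * s / G\<^sup>2 \<le> \<alpha>\<^sup>2 * 1" unfolding G(3) using s \<delta>
        by (simp add: divide_le_eq add_pos_nonneg mult_left_mono)
      hence "\<alpha>\<^sup>2 * s / G\<^sup>2 - \<alpha> * s / G ^ 3 \<le> \<alpha>\<^sup>2" using \<alpha> s G by (smt (verit) divide_nonneg_nonneg mult_nonneg_nonneg zero_le_power)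
      hence "(1 - P) * (\<alpha>\<^sup>2 * s / G\<^sup>2 - \<alpha> * s / G ^ 3) \<le> (1 - P) * \<alpha>\<^sup>2" using P' by (intro mult_left_mono) auto
      ultimately have "\<epsilon>\<^sup>2 * ?rate
         \<le> \<epsilon>\<^sup>2 * (N * (\<alpha> / \<delta>) + (1 - P) * \<alpha>\<^sup>2)" by (intro mult_left_mono[OF add_mono] zero_le_power2)
      also have "\<dots> = \<epsilon> * (N * (1 - \<eta> / 2) * b / \<delta>) + (1 - \<eta> / 2)\<^sup>2 * ((1 - P) * b\<^sup>2)"
        unfolding \<alpha>_def using \<epsilon> \<delta> by (simp add: field_simps power2_eq_square)
      also have "\<dots> = \<epsilon> * (N * b / \<delta>) * (1 - \<eta> / 2) + (1 - \<eta> / 2)\<^sup>2" using P' by simp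
      also have "\<dots> \<le> \<eta> / 2 * 1 + (1 - \<eta> / 2)"
      proof (intro add_mono mult_mono)
        have "\<epsilon> * (N * b / \<delta>) \<le> \<epsilon>0 * (N * b / \<delta>)" using \<epsilon> N2 b \<delta> by (intro mult_right_mono) auto
        thus "\<epsilon> * (N * b / \<delta>) \<le> \<eta> / 2" unfolding \<epsilon>0_def using N2 b \<delta> by simp
        show "(1 - \<eta> / 2)\<^sup>2 \<le> 1 - \<eta> / 2"
          using \<eta> mult_left_le[of "1 - \<eta>/2" "1 - \<eta>/2"] by (simp add: power2_eq_square)
      qed (use \<eta> in auto)
      finally have "\<epsilon>\<^sup>2 * ?rate \<le> 1" by simp
      hence "exp_profile \<alpha> \<delta> g s * (\<epsilon>\<^sup>2 * ?rate)
          \<le> exp_profile \<alpha> \<delta> g s * 1" by (intro mult_left_mono) (auto simp: exp_profile_def)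
      thus "\<epsilon>\<^sup>2 * radial_operator CARD('n) p (exp_profile1 \<alpha> \<delta> g s) (exp_profile2 \<alpha> \<delta> g s) s \<le> exp_profile \<alpha> \<delta> g s"
        unfolding radial_operator_exp_profile[OF \<delta> s] G_def N_def P_def by (simp add: mult_ac)
    qed
    also have "\<dots> \<le> exp (- ((1 - \<eta>) * b * (r - norm (z - c)) / \<epsilon>))"
    proof -
      define d where "d = r - norm (z - c)"
      have d: "d > 0" using z by (simp add: d_def dist_norm norm_minus_commute)
      \<comment> \<open>The two losses combine: \<theta> is at least d / (1 + \<eta>/2), hence at
        least (1 - \<eta>/2) d; the rate contributes another factor 1 - \<eta>/2; and (1 -
        \<eta>/2)^2 is at least 1 - \<eta>.\<close>
      define \<theta> where "\<theta> = g - smoothed_norm \<delta> (sqdist z c)"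
      have "d * r \<le> \<theta> * (r + 2 * \<delta>)"
        using smoothed_norm_diff(2)[OF \<delta>, of "norm (z - c)" r] d unfolding d_def \<theta>_def g_def by auto
      also have "r + 2 * \<delta> = r * (1 + \<eta> / 2)" by (simp add: \<delta>_def field_simps)
      finally have "d * r \<le> (\<theta> * (1 + \<eta> / 2)) * r" by (simp add: mult_ac)
      hence "d \<le> \<theta> * (1 + \<eta> / 2)" using r by (simp add: mult_le_cancel_right)
      hence "(1 - \<eta> / 2) * (d * (1 - \<eta> / 2)) \<le> (1 - \<eta> / 2) * ((\<theta> * (1 + \<eta> / 2)) * (1 - \<eta> / 2))"
        using \<eta> by (intro mult_left_mono mult_right_mono) auto
      also have "\<dots> = (1 - \<eta> / 2) * (\<theta> * (1 - \<eta>\<^sup>2 / 4))" by (simp add: power2_eq_square field_simps)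
      also have "\<dots> \<le> (1 - \<eta> / 2) * (\<theta> * 1)"
      proof -
        have "\<theta> \<ge> 0" using \<open>d \<le> \<theta> * (1 + \<eta> / 2)\<close> d \<eta>
          by (smt (verit) mult_nonpos_nonneg divide_nonneg_nonneg)
        thus ?thesis using \<eta> by (intro mult_left_mono) auto
      qed
      finally have "(1 - \<eta> / 2) * (d * (1 - \<eta> / 2)) \<le> (1 - \<eta> / 2) * \<theta>" by simp
      moreover have "(1 - \<eta>) * d \<le> (1 - \<eta> / 2) * (d * (1 - \<eta> / 2))"
      proof -
        have "(1 - \<eta> / 2) * (d * (1 - \<eta> / 2)) = (1 - \<eta>) * d + d * (\<eta>\<^sup>2 / 4)"
          by (simp add: power2_eq_square field_simps)
        thus ?thesis using d by simp
      qed
      ultimately have "(1 - \<eta>) * d * (b / \<epsilon>) \<le> (1 - \<eta> / 2) * \<theta> * (b / \<epsilon>)"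
        using b \<epsilon> by (intro mult_right_mono) auto
      moreover have "\<alpha> * (smoothed_norm \<delta> (sqdist z c) - g) = - (\<alpha> * \<theta>)"
        by (simp add: \<theta>_def algebra_simps)
      moreover have "\<alpha> * \<theta> = (1 - \<eta> / 2) * \<theta> * (b / \<epsilon>)" by (simp add: \<alpha>_def)
      moreover have "(1 - \<eta>) * b * d / \<epsilon> = (1 - \<eta>) * d * (b / \<epsilon>)" by simp
      ultimately show ?thesis unfolding exp_profile_def d_def[symmetric] by (metis exp_le_cancel_iff neg_le_iff_le)
    qed
    finally show ?thesis .
  qed
  ultimately show ?thesis by blast
qed

text \<open>Smoothing weakens the quadratic term by the factor s / (\<delta>^2 + s), which
  degenerates at the centre but is at least 1 / (1 + \<eta>) on s >= r^2 when \<delta>^2 = \<eta>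
  r^2. With the rate (1 + \<eta>) b / \<epsilon> this term is then at least 1 + \<eta>, and the
  threshold lets the negative linear term cost at most \<eta>. The exponent suffers no further loss,
  as the smoothed norm is 1-Lipschitz in the radius.\<close>

lemma decay_outside_ball:
  fixes r \<eta> :: real
  assumes N: "CARD('n) \<ge> 2" and r: "r > 0" and \<eta>: "0 < \<eta>" "\<eta> < 1"
  shows "\<exists>\<epsilon>0>0. \<forall>\<epsilon> \<Omega> (u :: real^'n \<Rightarrow> real) c z. 0 < \<epsilon> \<longrightarrow> \<epsilon> < \<epsilon>0 \<longrightarrow> open \<Omega> \<longrightarrow>
     bounded_viscosity_solution p \<epsilon> \<Omega> u \<longrightarrow> (\<forall>w\<in>closure \<Omega>. norm (w - c) \<ge> r) \<longrightarrow> z \<in> closure \<Omega> \<longrightarrow>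
     u z \<ge> exp (- ((1 + \<eta>) * b * (norm (z - c) - r) / \<epsilon>))"
proof -
  define P where "P = recip p"
  have P': "0 \<le> P" "P < 1" "(1 - P) * b\<^sup>2 = 1" using P b unfolding P_def by auto
  define N where "N = real CARD('n)"
  have N2: "N \<ge> 2" using N unfolding N_def by simp
  define \<delta> where "\<delta> = sqrt \<eta> * r"
  have \<delta>: "\<delta> > 0" "\<delta>\<^sup>2 = \<eta> * r\<^sup>2" using r \<eta> by (simp_all add: \<delta>_def power_mult_distrib)
  define \<epsilon>0 where "\<epsilon>0 = \<eta> * \<delta> / (N * b * (1 + \<eta>))"
  have "\<epsilon>0 > 0" unfolding \<epsilon>0_def using \<eta> \<delta> b N2 by simp
  moreover have "u z \<ge> exp (- ((1 + \<eta>) * b * (norm (z - c) - r) / \<epsilon>))"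
    if \<epsilon>: "0 < \<epsilon>" "\<epsilon> < \<epsilon>0" and dom: "open \<Omega>" and sol: "bounded_viscosity_solution p \<epsilon> \<Omega> u"
      and ball: "\<forall>w\<in>closure \<Omega>. norm (w - c) \<ge> r" and z: "z \<in> closure \<Omega>"
    for \<epsilon> \<Omega> and u :: "real^'n \<Rightarrow> real" and c z
  proof -
    define \<alpha> where "\<alpha> = (1 + \<eta>) * b / \<epsilon>"
    have \<alpha>: "\<alpha> > 0" using \<eta> b \<epsilon> by (simp add: \<alpha>_def)
    define g where "g = smoothed_norm \<delta> (r\<^sup>2)"
    have "u z \<ge> exp_profile (-\<alpha>) \<delta> g (sqdist z c)"
    proof (rule lower_barrier[OF dom sol radial_profile_exp[OF \<delta>(1)] _ r _ _ _ _ z])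
      show "r \<le> norm (w - c)" if "w \<in> closure \<Omega>" for w using ball that by blast
      show "exp_profile1 (-\<alpha>) \<delta> g s \<noteq> 0" if "s \<ge> 0" for s
        using smoothed_norm_pos[OF \<delta>(1) that] \<alpha> by (simp add: exp_profile1_def exp_profile_def)
      show "1 \<ge> exp_profile (-\<alpha>) \<delta> g s" if "s \<ge> r\<^sup>2" for s
        using that \<alpha> by (simp add: exp_profile_def g_def smoothed_norm_def mult_le_0_iff)
      have "filterlim (smoothed_norm \<delta>) at_top at_top"
        unfolding smoothed_norm_def
        by (intro filterlim_compose[OF sqrt_at_top] filterlim_tendsto_add_at_top[OF tendsto_const] filterlim_ident)
      hence "filterlim (\<lambda>s. smoothed_norm \<delta> s - g) at_top at_top"
        by (subst diff_conv_add_uminus, subst add.commute)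
          (rule filterlim_tendsto_add_at_top[OF tendsto_const])
      hence "filterlim (\<lambda>s. - \<alpha> * (smoothed_norm \<delta> s - g)) at_bot at_top"
        using \<alpha> by (intro filterlim_tendsto_neg_mult_at_bot[OF tendsto_const]) auto
      thus "(exp_profile (- \<alpha>) \<delta> g \<longlongrightarrow> 0) at_top"
        unfolding exp_profile_def by (rule filterlim_compose[OF exp_at_bot])
      fix s :: real assume s': "s \<ge> r\<^sup>2"
      hence s: "s \<ge> 0" using order_trans[OF zero_le_power2] by blast
      define G where "G = smoothed_norm \<delta> s"
      let ?rate = "(1 + (N - 2) * P) * (- \<alpha> / G) + (1 - P) * ((- \<alpha>)\<^sup>2 * s / G\<^sup>2 - (- \<alpha>) * s / G ^ 3)"
      have G: "G \<ge> \<delta>" "G > 0" "G\<^sup>2 = \<delta>\<^sup>2 + s"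
        unfolding G_def using smoothed_norm_ge[OF \<delta>(1) s] smoothed_norm_pos[OF \<delta>(1) s] smoothed_norm_sq[OF s] by auto
      have "(N - 2) * P \<le> (N - 2) * 1" "0 \<le> (N - 2) * P" using P' N2
        mult_left_mono[of P 1 "N - 2"] by auto
      hence "(1 + (N - 2) * P) * (\<alpha> / G) \<le> N * (\<alpha> / \<delta>)"
        using G \<alpha> \<delta> by (intro mult_mono frac_le) auto
      hence "- (N * (\<alpha> / \<delta>)) \<le> (1 + (N - 2) * P) * (- \<alpha> / G)" by simp
      moreover have "\<alpha>\<^sup>2 * (1 / (1 + \<eta>)) \<le> \<alpha>\<^sup>2 * (s / G\<^sup>2)"
      proof (rule mult_left_mono)
        have "\<delta>\<^sup>2 \<le> \<eta> * s" using s' \<eta> unfolding \<delta>(2) by simp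
        hence "G\<^sup>2 \<le> (1 + \<eta>) * s" unfolding G(3) by (simp add: algebra_simps)
        thus "1 / (1 + \<eta>) \<le> s / G\<^sup>2" using \<eta> G(2) by (simp add: field_simps)
      qed simp
      hence "\<alpha>\<^sup>2 * (1 / (1 + \<eta>)) \<le> (- \<alpha>)\<^sup>2 * s / G\<^sup>2 - (- \<alpha>) * s / G ^ 3" using \<alpha> s G
        by (smt (verit) divide_nonneg_nonneg mult_nonneg_nonneg zero_le_power times_divide_eq_right power2_minus mult_minus_left minus_divide_left)
      hence "(1 - P) * (\<alpha>\<^sup>2 * (1 / (1 + \<eta>))) \<le> (1 - P) * ((- \<alpha>)\<^sup>2 * s / G\<^sup>2 - (- \<alpha>) * s / G ^ 3)"
        using P' by (intro mult_left_mono) auto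
      ultimately have le: "\<epsilon>\<^sup>2 * (- (N * (\<alpha> / \<delta>)) + (1 - P) * (\<alpha>\<^sup>2 * (1 / (1 + \<eta>)))) \<le>
         \<epsilon>\<^sup>2 * ?rate"
        by (intro mult_left_mono[OF add_mono] zero_le_power2)
      have "\<epsilon>\<^sup>2 * (- (N * (\<alpha> / \<delta>)) + (1 - P) * (\<alpha>\<^sup>2 * (1 / (1 + \<eta>))))
         = - (\<epsilon> * (N * b * (1 + \<eta>) / \<delta>)) + (1 + \<eta>) * ((1 - P) * b\<^sup>2)"
      proof -
        have "\<epsilon> * \<alpha> = (1 + \<eta>) * b" using \<epsilon> by (simp add: \<alpha>_def)
        moreover have "\<epsilon>\<^sup>2 * (- (N * (\<alpha> / \<delta>)) + (1 - P) * (\<alpha>\<^sup>2 * (1 / (1 + \<eta>))))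
           = - (\<epsilon> * (N * (\<epsilon> * \<alpha>) / \<delta>)) + (1 - P) * ((\<epsilon> * \<alpha>)\<^sup>2 / (1 + \<eta>))"
          by (simp add: power2_eq_square right_diff_distrib mult_ac)
        ultimately show ?thesis using \<eta> by (simp add: power_mult_distrib power2_eq_square[of "1 + \<eta>"])
      qed
      moreover have "\<epsilon> * (N * b * (1 + \<eta>) / \<delta>) \<le> \<epsilon>0 * (N * b * (1 + \<eta>) / \<delta>)"
        using \<epsilon> N2 b \<delta> \<eta> by (intro mult_right_mono) auto
      hence "\<epsilon> * (N * b * (1 + \<eta>) / \<delta>) \<le> \<eta>" unfolding \<epsilon>0_def using N2 b \<delta> \<eta> by simp
      ultimately have "1 \<le> \<epsilon>\<^sup>2 * ?rate"
        using le P'(3) by simp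
      hence "exp_profile (-\<alpha>) \<delta> g s * 1 \<le> exp_profile (-\<alpha>) \<delta> g s * (\<epsilon>\<^sup>2 * ?rate)"
        by (intro mult_left_mono) (auto simp: exp_profile_def)
      thus "exp_profile (-\<alpha>) \<delta> g s \<le> \<epsilon>\<^sup>2 * radial_operator CARD('n) p (exp_profile1 (-\<alpha>) \<delta> g s) (exp_profile2 (-\<alpha>) \<delta> g s) s"
        unfolding radial_operator_exp_profile[OF \<delta>(1) s] G_def N_def P_def by (simp add: mult_ac)
    qed
    moreover have "exp_profile (-\<alpha>) \<delta> g (sqdist z c) \<ge> exp (- ((1 + \<eta>) * b * (norm (z - c) - r) / \<epsilon>))"
    proof -
      have "r \<le> norm (z - c)" using ball z by blast
      hence "smoothed_norm \<delta> (sqdist z c) - g \<le> norm (z - c) - r"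
        unfolding g_def using smoothed_norm_diff(1)[OF \<delta>(1), of r "norm (z - c)"] r by simp
      hence "\<alpha> * (smoothed_norm \<delta> (sqdist z c) - g) \<le> \<alpha> * (norm (z - c) - r)"
        using \<alpha> by (intro mult_left_mono) auto
      thus ?thesis unfolding exp_profile_def by (simp add: \<alpha>_def)
    qed
    ultimately show ?thesis by simp
  qed
  ultimately show ?thesis by blast
qed

end

section \<open>Two-sided decay in terms of the distance to the boundary\<close>

text \<open>For points of \<Omega> this is the distance to \<Gamma>; measuring it from the
  complement makes the ball of this radius around the point lie in \<Omega> at once.\<close>

abbreviation bdist :: "'a::metric_space set \<Rightarrow> 'a \<Rightarrow> real" where
  "bdist \<Omega> z \<equiv> infdist z (- \<Omega>)"

text \<open>The upper bound is truncated at \<open>ri\<close> because interior balls of larger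
  radius need not exist; beyond that distance exponential smallness is all that is used.\<close>

abbreviation decay_bounds ::
  "'a::metric_space set \<Rightarrow> (real \<Rightarrow> 'a \<Rightarrow> real) \<Rightarrow> real \<Rightarrow> real \<Rightarrow> real \<Rightarrow> real \<Rightarrow> 'a \<Rightarrow> bool" where
  "decay_bounds \<Omega> u d ri \<eta> \<epsilon> z \<equiv> u \<epsilon> z \<le> exp (- ((1 - \<eta>) * d * min (bdist \<Omega> z) ri / \<epsilon>)) \<and>
     u \<epsilon> z \<ge> exp (- ((1 + \<eta>) * d * bdist \<Omega> z / \<epsilon>))"

lemma ball_bdist_subset: "ball z (bdist \<Omega> z) \<subseteq> \<Omega>"
proof
  fix w assume "w \<in> ball z (bdist \<Omega> z)"
  hence "\<not> bdist \<Omega> z \<le> dist z w" by simp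
  thus "w \<in> \<Omega>" using infdist_le[of w "- \<Omega>" z] by blast
qed

lemma foot_point:
  fixes z :: "'a::heine_borel"
  assumes "open \<Omega>" "- \<Omega> \<noteq> {}"
  obtains w where "w \<notin> \<Omega>" "dist z w = bdist \<Omega> z"
  using infdist_attains_inf[of "- \<Omega>" z] assms by (metis ComplD closed_Compl)

lemma foot_point_frontier:
  fixes z :: "'a::euclidean_space"
  assumes "open \<Omega>" "- \<Omega> \<noteq> {}" "z \<in> \<Omega>"
  obtains w where "w \<in> frontier \<Omega>" "dist z w = bdist \<Omega> z" "bdist \<Omega> z > 0"
proof -
  obtain w where w: "w \<notin> \<Omega>" "dist z w = bdist \<Omega> z" using foot_point assms by metis
  have pos: "bdist \<Omega> z > 0" using w assms(3) by (metis zero_less_dist_iff)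
  have "w \<in> closure (ball z (bdist \<Omega> z))" using w pos by simp
  hence "w \<in> closure \<Omega>" using closure_mono[OF ball_bdist_subset] by blast
  thus ?thesis using that w pos assms(1) by (simp add: frontier_def interior_open)
qed

text \<open>Otherwise the point dividing the segment from \<open>b\<close> to \<open>a\<close> in
  the ratio s : r would lie in both balls.\<close>

lemma dist_ge_of_disjoint_balls:
  fixes a b :: "'a::euclidean_space"
  assumes "ball a r \<subseteq> \<Omega>" "\<Omega> \<inter> cball b s = {}" "r > 0" "s > 0"
  shows "norm (a - b) \<ge> r + s"
proof (rule ccontr)
  assume "\<not> ?thesis"
  hence lt: "norm (a - b) < r + s" by simp
  define t where "t = s / (r + s)"
  have t: "0 < t" "t < 1" using assms by (auto simp: t_def)
  define w where "w = b + t *\<^sub>R (a - b)"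
  have "norm (w - b) = t * norm (a - b)" unfolding w_def using t by simp
  also have "\<dots> \<le> t * (r + s)" using lt t by (intro mult_left_mono) auto
  also have "\<dots> = s" using assms by (simp add: t_def)
  finally have "w \<in> cball b s" by (simp add: dist_norm norm_minus_commute)
  moreover have "a - w = (1 - t) *\<^sub>R (a - b)" unfolding w_def by (simp add: algebra_simps)
  hence "norm (a - w) = (1 - t) * norm (a - b)" using t by simp
  hence "norm (a - w) < (1 - t) * (r + s)" using lt t by simp
  moreover have "(1 - t) * (r + s) = r" using assms by (simp add: t_def field_simps)
  ultimately have "w \<in> ball a r" by (simp add: dist_norm)
  thus False using assms(1,2) \<open>w \<in> cball b s\<close> by blast
qed

text \<open>The two radii add up to at most the distance of the centres, so equality holds in the
  triangle inequality through \<open>w\<close>, and the three points are collinear.\<close>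

lemma touching_balls_aligned:
  fixes a b w :: "'a::euclidean_space"
  assumes "ball a r \<subseteq> \<Omega>" "\<Omega> \<inter> cball b s = {}" "r > 0" "s > 0"
    and w: "w \<in> cball a r" "w \<in> cball b s"
  shows "norm (w - b) = s" and "a = w + (r / s) *\<^sub>R (w - b)"
proof -
  have ge: "norm (a - b) \<ge> r + s" using dist_ge_of_disjoint_balls assms by blast
  have le: "norm (a - w) \<le> r" "norm (w - b) \<le> s"
    using w by (auto simp: dist_norm norm_minus_commute)
  have tri: "norm ((a - w) + (w - b)) \<le> norm (a - w) + norm (w - b)" by (rule norm_triangle_ineq)
  hence eq: "norm (a - w) = r" "norm (w - b) = s"
    "norm ((a - w) + (w - b)) = norm (a - w) + norm (w - b)"
    using ge le by (auto simp: algebra_simps)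
  thus "norm (w - b) = s" by simp
  have "r *\<^sub>R (w - b) = s *\<^sub>R (a - w)" using eq norm_triangle_eq[of "a - w" "w - b"] by simp
  hence "(1 / s) *\<^sub>R (r *\<^sub>R (w - b)) = a - w" using assms(4) by simp
  thus "a = w + (r / s) *\<^sub>R (w - b)" by simp
qed

context
  fixes p :: ereal and b ri re :: real and \<Omega> :: "(real^'n) set" and u :: "real \<Rightarrow> real^'n \<Rightarrow> real"
  assumes P: "0 \<le> recip p" "recip p < 1"
    and b: "b > 0" "(1 - recip p) * b\<^sup>2 = 1"
    and N: "CARD('n) \<ge> 2"
    and dom: "open \<Omega>" "- \<Omega> \<noteq> {}"
    and r: "ri > 0" "re > 0"
    and balls: "\<And>y. y \<in> frontier \<Omega> \<Longrightarrow> \<exists>zi\<in>\<Omega>. \<exists>ze\<in>- closure \<Omega>.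
        ball zi ri \<subseteq> \<Omega> \<and> \<Omega> \<subseteq> - cball ze re \<and> cball zi ri \<inter> cball ze re = {y}"
    and sol: "\<And>\<epsilon>. \<epsilon> > 0 \<Longrightarrow> bounded_viscosity_solution p \<epsilon> \<Omega> (u \<epsilon>)"
begin

text \<open>At the foot point \<open>w\<close> the exterior ball touches both the uniform interior
  ball and the largest ball around \<open>z\<close> inside \<Omega>. Hence \<open>z\<close> and the
  interior centre lie on the same ray from the exterior centre through \<open>w\<close>, and the
  distance from \<open>z\<close> to the interior sphere is exactly its distance to \<Gamma>. For
  points deep inside, the ball is centred at \<open>z\<close> itself.\<close>

lemma interior_ball_through_point:
  assumes z: "z \<in> \<Omega>"
  obtains c where "ball c ri \<subseteq> \<Omega>" "z \<in> ball c ri" "ri - norm (z - c) = min (bdist \<Omega> z) ri"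
proof (cases "bdist \<Omega> z < ri")
  case True
  obtain w where w: "w \<in> frontier \<Omega>" "dist z w = bdist \<Omega> z" and pos: "bdist \<Omega> z > 0"
    using foot_point_frontier[OF dom z] .
  obtain zi ze where zz: "ball zi ri \<subseteq> \<Omega>" "\<Omega> \<inter> cball ze re = {}" "cball zi ri \<inter> cball ze re = {w}"
    using balls[OF w(1)] by blast
  have wze: "w \<in> cball zi ri" "w \<in> cball ze re" using zz(3) by auto
  have zi: "norm (w - ze) = re" "zi = w + (ri / re) *\<^sub>R (w - ze)"
    using touching_balls_aligned[OF zz(1,2) r wze] .
  have "z = w + (bdist \<Omega> z / re) *\<^sub>R (w - ze)"
    using touching_balls_aligned(2)[OF ball_bdist_subset zz(2) pos r(2) _ wze(2)] w(2) by simp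
  hence "z - zi = (bdist \<Omega> z / re) *\<^sub>R (w - ze) - (ri / re) *\<^sub>R (w - ze)" using zi(2) by (metis add_diff_cancel_left)
  also have "\<dots> = ((bdist \<Omega> z - ri) / re) *\<^sub>R (w - ze)"
    by (metis diff_divide_distrib scaleR_left_diff_distrib)
  finally have "norm (z - zi) = ri - bdist \<Omega> z" using zi(1) r True by simp
  moreover from this have "z \<in> ball zi ri" using pos by (simp add: dist_norm norm_minus_commute)
  ultimately show ?thesis using that[OF zz(1)] True by simp
next
  case False
  hence "ball z ri \<subseteq> \<Omega>" using ball_bdist_subset[of z \<Omega>] subset_ball[of ri "bdist \<Omega> z" z] by auto
  thus ?thesis using that[of z] False r by simp
qed

text \<open>For the lower bound the triangle inequality through the foot point suffices: it bounds
  the distance from \<open>z\<close> to the exterior sphere by the distance to \<Gamma>.\<close>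

lemma solution_decay:
  assumes \<eta>: "0 < \<eta>" "\<eta> < 1"
  shows "\<exists>\<epsilon>0>0. \<forall>\<epsilon> z. 0 < \<epsilon> \<longrightarrow> \<epsilon> < \<epsilon>0 \<longrightarrow> z \<in> \<Omega> \<longrightarrow>
     decay_bounds \<Omega> u b ri \<eta> \<epsilon> z"
proof -
  obtain \<epsilon>1 where \<epsilon>1: "\<epsilon>1 > 0" and up: "\<And>\<epsilon> \<Omega> (u :: real^'n \<Rightarrow> real) c z. 0 < \<epsilon> \<Longrightarrow> \<epsilon> < \<epsilon>1 \<Longrightarrow> open \<Omega> \<Longrightarrow>
     bounded_viscosity_solution p \<epsilon> \<Omega> u \<Longrightarrow> ball c ri \<subseteq> \<Omega> \<Longrightarrow> z \<in> ball c ri \<Longrightarrow>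
     u z \<le> exp (- ((1 - \<eta>) * b * (ri - norm (z - c)) / \<epsilon>))"
    using decay_in_ball[OF P b N r(1) \<eta>] by blast
  obtain \<epsilon>2 where \<epsilon>2: "\<epsilon>2 > 0" and low: "\<And>\<epsilon> \<Omega> (u :: real^'n \<Rightarrow> real) c z. 0 < \<epsilon> \<Longrightarrow> \<epsilon> < \<epsilon>2 \<Longrightarrow> open \<Omega> \<Longrightarrow>
     bounded_viscosity_solution p \<epsilon> \<Omega> u \<Longrightarrow> (\<forall>w\<in>closure \<Omega>. norm (w - c) \<ge> re) \<Longrightarrow> z \<in> closure \<Omega> \<Longrightarrow>
     u z \<ge> exp (- ((1 + \<eta>) * b * (norm (z - c) - re) / \<epsilon>))"
    using decay_outside_ball[OF P b N r(2) \<eta>] by blast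
  have "decay_bounds \<Omega> u b ri \<eta> \<epsilon> z"
    if \<epsilon>: "0 < \<epsilon>" "\<epsilon> < min \<epsilon>1 \<epsilon>2" and z: "z \<in> \<Omega>" for \<epsilon> z
  proof
    obtain c where c: "ball c ri \<subseteq> \<Omega>" "z \<in> ball c ri" "ri - norm (z - c) = min (bdist \<Omega> z) ri"
      using interior_ball_through_point[OF z] .
    show "u \<epsilon> z \<le> exp (- ((1 - \<eta>) * b * min (bdist \<Omega> z) ri / \<epsilon>))"
      using up[OF _ _ dom(1) sol c(1,2)] \<epsilon> c(3) by simp
    obtain w where w: "w \<in> frontier \<Omega>" "dist z w = bdist \<Omega> z"
      using foot_point_frontier[OF dom z] by metis
    obtain zi ze where zz: "\<Omega> \<subseteq> - cball ze re" "cball zi ri \<inter> cball ze re = {w}"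
      using balls[OF w(1)] by blast
    have "closure \<Omega> \<subseteq> - ball ze re"
      using zz(1) by (intro closure_minimal) auto
    hence far: "\<forall>v\<in>closure \<Omega>. norm (v - ze) \<ge> re" by (auto simp: dist_norm norm_minus_commute)
    have "w \<in> cball ze re" using zz(2) by auto
    hence "norm (w - ze) \<le> re" by (simp add: dist_norm norm_minus_commute)
    hence "norm (z - ze) - re \<le> bdist \<Omega> z"
      using w(2) norm_triangle_ineq[of "z - w" "w - ze"] by (simp add: dist_norm)
    hence "(1 + \<eta>) * b * (norm (z - ze) - re) / \<epsilon> \<le> (1 + \<eta>) * b * bdist \<Omega> z / \<epsilon>"
      using \<eta> b \<epsilon> by (intro divide_right_mono mult_left_mono) auto
    hence "exp (- ((1 + \<eta>) * b * bdist \<Omega> z / \<epsilon>)) \<le> exp (- ((1 + \<eta>) * b * (norm (z - ze) - re) / \<epsilon>))" by simp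
    also have "\<dots> \<le> u \<epsilon> z" using low[OF _ _ dom(1) sol far] z \<epsilon> closure_subset by fastforce
    finally show "u \<epsilon> z \<ge> exp (- ((1 + \<eta>) * b * bdist \<Omega> z / \<epsilon>))" .
  qed
  moreover have "min \<epsilon>1 \<epsilon>2 > 0" using \<epsilon>1 \<epsilon>2 by simp
  ultimately show ?thesis by blast
qed

end

section \<open>Geometry at the contact point\<close>

text \<open>\<nu> and the N - 1 vectors \<open>e i\<close> are independent and as many as the
  dimension, so they span. The defect of the expansion is orthogonal to all of them, hence to
  itself.\<close>

lemma orthonormal_family_expand:
  fixes \<nu> :: "real^'n" and e :: "nat \<Rightarrow> real^'n"
  assumes \<nu>: "norm \<nu> = 1"
    and e\<nu>: "\<And>i. i \<in> {1..<CARD('n)} \<Longrightarrow> e i \<bullet> \<nu> = 0"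
    and ee: "\<And>i j. i \<in> {1..<CARD('n)} \<Longrightarrow> j \<in> {1..<CARD('n)} \<Longrightarrow> e i \<bullet> e j = (if i = j then 1 else 0)"
  shows "h = (h \<bullet> \<nu>) *\<^sub>R \<nu> + (\<Sum>j\<in>{1..<CARD('n)}. (h \<bullet> e j) *\<^sub>R e j)"
proof -
  let ?J = "{1..<CARD('n)}" and ?S = "insert \<nu> (e ` {1..<CARD('n)})"
  have \<nu>\<nu>: "\<nu> \<bullet> \<nu> = 1" using \<nu> by (simp add: dot_square_norm)
  have nz: "\<nu> \<noteq> 0" "\<And>i. i \<in> ?J \<Longrightarrow> e i \<noteq> 0" using \<nu> ee by fastforce+
  have inj: "inj_on e ?J" using ee by (intro inj_onI) (metis zero_neq_one)
  have notin: "\<nu> \<notin> e ` ?J" using e\<nu> \<nu>\<nu> by fastforce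
  have card: "card ?S = CARD('n)" using notin card_image[OF inj] by simp
  have "pairwise orthogonal ?S"
    using e\<nu> ee by (auto simp: pairwise_def orthogonal_def inner_commute)
  moreover have "0 \<notin> ?S" using nz by auto
  ultimately have "independent ?S" by (rule pairwise_orthogonal_independent)
  hence "dim (span ?S) = DIM(real^'n)" using card dim_eq_card_independent by fastforce
  hence span: "span ?S = UNIV" using dim_eq_full by (metis dim_span)
  define g where "g = h - ((h \<bullet> \<nu>) *\<^sub>R \<nu> + (\<Sum>j\<in>?J. (h \<bullet> e j) *\<^sub>R e j))"
  have "g \<bullet> \<nu> = 0" unfolding g_def
    by (simp add: inner_diff_left inner_add_left inner_sum_left e\<nu> \<nu>\<nu>)
  moreover have "g \<bullet> e i = 0" if "i \<in> ?J" for i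
  proof -
    have "(\<Sum>j\<in>?J. (h \<bullet> e j) * (e j \<bullet> e i)) = (\<Sum>j\<in>?J. if j = i then h \<bullet> e j else 0)"
      using that by (intro sum.cong) (auto simp: ee)
    also have "\<dots> = h \<bullet> e i" using that by simp
    moreover have "\<nu> \<bullet> e i = 0" using e\<nu>[OF that] by (simp add: inner_commute)
    ultimately show ?thesis unfolding g_def
      by (simp add: inner_diff_left inner_add_left inner_sum_left)
  qed
  ultimately have "\<And>v. v \<in> ?S \<Longrightarrow> orthogonal g v" by (auto simp: orthogonal_def)
  hence "orthogonal g g" using orthogonal_to_span span by blast
  thus ?thesis unfolding g_def by (simp add: orthogonal_self)
qed

lemma orthonormal_family_norm:
  fixes \<nu> :: "real^'n" and e :: "nat \<Rightarrow> real^'n"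
  assumes "norm \<nu> = 1"
    and "\<And>i. i \<in> {1..<CARD('n)} \<Longrightarrow> e i \<bullet> \<nu> = 0"
    and "\<And>i j. i \<in> {1..<CARD('n)} \<Longrightarrow> j \<in> {1..<CARD('n)} \<Longrightarrow> e i \<bullet> e j = (if i = j then 1 else 0)"
  shows "(norm h)\<^sup>2 = (h \<bullet> \<nu>)\<^sup>2 + (\<Sum>j\<in>{1..<CARD('n)}. (h \<bullet> e j)\<^sup>2)"
proof -
  have "(norm h)\<^sup>2 = h \<bullet> ((h \<bullet> \<nu>) *\<^sub>R \<nu> + (\<Sum>j\<in>{1..<CARD('n)}. (h \<bullet> e j) *\<^sub>R e j))"
    using orthonormal_family_expand[OF assms, of h] by (simp add: power2_norm_eq_inner)
  thus ?thesis by (simp add: inner_add_right inner_sum_right power2_eq_square)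
qed

lemma second_order_Taylor:
  fixes \<gamma> :: "real^'n \<Rightarrow> real"
  assumes C2: "C2_on UNIV \<gamma>" and crit: "grad \<gamma> y = 0" and \<eta>: "\<eta> > 0"
  obtains \<rho> where "\<rho> > 0"
    "\<And>v. norm v < \<rho> \<Longrightarrow> \<bar>\<gamma> (y + v) - \<gamma> y - ((hessian \<gamma> y *v v) \<bullet> v) / 2\<bar> \<le> \<eta> * (norm v)\<^sup>2"
proof -
  have "(grad \<gamma> has_derivative frechet_derivative (grad \<gamma>) (at y)) (at y)"
    using C2 frechet_derivative_works unfolding C2_on_def by blast
  moreover have "frechet_derivative (grad \<gamma>) (at y) = (\<lambda>v. hessian \<gamma> y *v v)"
    unfolding hessian_def using matrix_works[folded linear_matrix_vector_mul_eq]
      has_derivative_linear[OF calculation] by fastforce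
  ultimately have D: "(grad \<gamma> has_derivative (\<lambda>v. hessian \<gamma> y *v v)) (at y)" by simp
  from D[unfolded has_derivative_at_alt] \<eta> obtain \<rho> where \<rho>: "\<rho> > 0"
    "\<And>w. norm (w - y) < \<rho> \<Longrightarrow> norm (grad \<gamma> w - grad \<gamma> y - hessian \<gamma> y *v (w - y)) \<le> \<eta> * norm (w - y)"
    by blast
  have "\<bar>\<gamma> (y + v) - \<gamma> y - ((hessian \<gamma> y *v v) \<bullet> v) / 2\<bar> \<le> \<eta> * (norm v)\<^sup>2" if v: "norm v < \<rho>" for v
  proof -
    \<comment> \<open>The derivative of \<open>f\<close> is the first-order remainder of the
      gradient paired with \<open>v\<close>, so differentiability of the gradient at
      \<open>y\<close> controls it and a single use of the mean value theorem gives the quadratic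
      estimate.\<close>
    define f where "f \<tau> = \<gamma> (y + \<tau> *\<^sub>R v) - \<tau>\<^sup>2 / 2 * ((hessian \<gamma> y *v v) \<bullet> v)" for \<tau> :: real
    have f': "(f has_real_derivative (grad \<gamma> (y + \<tau> *\<^sub>R v) - hessian \<gamma> y *v (\<tau> *\<^sub>R v)) \<bullet> v) (at \<tau>)" for \<tau>
    proof -
      have "(\<gamma> has_derivative (\<lambda>h. h \<bullet> grad \<gamma> (y + \<tau> *\<^sub>R v))) (at (y + \<tau> *\<^sub>R v))"
        using C2 GDERIV_grad[of \<gamma> "y + \<tau> *\<^sub>R v"] unfolding C2_on_def gderiv_def by blast
      moreover have "((\<lambda>\<tau>. y + \<tau> *\<^sub>R v) has_derivative (\<lambda>h. h *\<^sub>R v)) (at \<tau>)"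
        by (auto intro!: derivative_eq_intros)
      ultimately have "((\<lambda>\<tau>. \<gamma> (y + \<tau> *\<^sub>R v)) has_derivative (\<lambda>h. (h *\<^sub>R v) \<bullet> grad \<gamma> (y + \<tau> *\<^sub>R v))) (at \<tau>)"
        by (rule has_derivative_compose[rotated])
      moreover have "(\<lambda>h. (h *\<^sub>R v) \<bullet> grad \<gamma> (y + \<tau> *\<^sub>R v)) = (*) (grad \<gamma> (y + \<tau> *\<^sub>R v) \<bullet> v)"
        by (auto simp: inner_commute mult.commute)
      ultimately have 1: "((\<lambda>\<tau>. \<gamma> (y + \<tau> *\<^sub>R v)) has_real_derivative (grad \<gamma> (y + \<tau> *\<^sub>R v) \<bullet> v)) (at \<tau>)"
        unfolding has_field_derivative_def by simp
      show ?thesis unfolding f_def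
        by (rule DERIV_cong[OF DERIV_diff[OF 1 DERIV_cmult_right[OF DERIV_cdivide[OF DERIV_pow]]]])
          (simp add: inner_diff_left matrix_vector_mult_scaleR)
    qed
    have "\<exists>\<xi>>0. \<xi> < 1 \<and> f 1 - f 0 = (1 - 0) * ((grad \<gamma> (y + \<xi> *\<^sub>R v) - hessian \<gamma> y *v (\<xi> *\<^sub>R v)) \<bullet> v)"
      by (rule MVT2) (use f' in auto)
    then obtain \<xi> where \<xi>: "0 < \<xi>" "\<xi> < 1" "f 1 - f 0 = (grad \<gamma> (y + \<xi> *\<^sub>R v) - hessian \<gamma> y *v (\<xi> *\<^sub>R v)) \<bullet> v"
      by auto
    have "norm (\<xi> *\<^sub>R v) \<le> norm v" using \<xi> mult_right_mono[of \<xi> 1 "norm v"] by simp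
    have "\<bar>f 1 - f 0\<bar> \<le> norm (grad \<gamma> (y + \<xi> *\<^sub>R v) - hessian \<gamma> y *v (\<xi> *\<^sub>R v)) * norm v"
      unfolding \<xi>(3) by (rule Cauchy_Schwarz_ineq2)
    also have "\<dots> \<le> (\<eta> * norm (\<xi> *\<^sub>R v)) * norm v"
      using \<rho>(2)[of "y + \<xi> *\<^sub>R v"] \<open>norm (\<xi> *\<^sub>R v) \<le> norm v\<close> v crit by (intro mult_right_mono) auto
    also have "\<dots> \<le> (\<eta> * norm v) * norm v"
      using \<open>norm (\<xi> *\<^sub>R v) \<le> norm v\<close> \<eta> by (intro mult_right_mono mult_left_mono) auto
    finally show ?thesis by (simp add: f_def power2_eq_square)
  qed
  thus ?thesis using that \<rho>(1) by blast
qed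

text \<open>The gradient vanishes at \<open>y\<close> and is continuous there, so the Lipschitz
  constant can be prescribed. This is what makes height above the graph and distance to it agree to
  first order.\<close>

lemma Lipschitz_near_critical_point:
  fixes \<gamma> :: "real^'n \<Rightarrow> real"
  assumes C2: "C2_on UNIV \<gamma>" and crit: "grad \<gamma> y = 0" and \<eta>: "\<eta> > 0"
  obtains \<rho> where "\<rho> > 0"
    "\<And>v w. v \<in> ball y \<rho> \<Longrightarrow> w \<in> ball y \<rho> \<Longrightarrow> \<bar>\<gamma> v - \<gamma> w\<bar> \<le> \<eta> * norm (v - w)"
proof -
  have "isCont (grad \<gamma>) y"
    using C2 unfolding C2_on_def by (simp add: differentiable_imp_continuous_within)
  then obtain \<rho> where \<rho>: "\<rho> > 0" "\<And>w. dist w y < \<rho> \<Longrightarrow> dist (grad \<gamma> w) (grad \<gamma> y) < \<eta>"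
    using \<eta> unfolding continuous_at_eps_delta by blast
  have "norm (\<gamma> v - \<gamma> w) \<le> \<eta> * norm (v - w)" if "v \<in> ball y \<rho>" "w \<in> ball y \<rho>" for v w
  proof (rule differentiable_bound[OF convex_ball])
    fix z assume z: "z \<in> ball y \<rho>"
    show "(\<gamma> has_derivative (\<lambda>h. h \<bullet> grad \<gamma> z)) (at z within ball y \<rho>)"
      using C2 GDERIV_grad[of \<gamma> z] unfolding C2_on_def gderiv_def
      by (meson UNIV_I has_derivative_at_withinI)
    have "norm (grad \<gamma> z) \<le> \<eta>" using \<rho>(2)[of z] z crit by (simp add: dist_commute)
    thus "onorm (\<lambda>h. h \<bullet> grad \<gamma> z) \<le> \<eta>"
      by (intro onorm_le) (smt (verit, best) Cauchy_Schwarz_ineq2 mult.commute mult_right_mono norm_ge_zero real_norm_def)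
  qed (use that in auto)
  thus ?thesis using that \<rho>(1) by simp
qed

section \<open>The touching ball in the principal frame at the contact point\<close>

locale touching_ball =
  fixes \<Omega> :: "(real^'n) set" and x y \<nu> :: "real^'n" and R :: real and \<gamma> :: "real^'n \<Rightarrow> real"
    and \<kappa> :: "nat \<Rightarrow> real" and e :: "nat \<Rightarrow> real^'n"
  assumes dom: "open \<Omega>" and R: "R > 0" and ball: "ball x R \<subseteq> \<Omega>"
    and touch: "cball x R \<inter> (- \<Omega>) = {y}"
    and graph: "C2_graph_at \<Omega> y \<nu> \<gamma>" and crit: "grad \<gamma> y = 0"
    and e\<nu>: "\<And>i. i \<in> {1..<CARD('n)} \<Longrightarrow> e i \<bullet> \<nu> = 0"
    and ee: "\<And>i j. i \<in> {1..<CARD('n)} \<Longrightarrow> j \<in> {1..<CARD('n)} \<Longrightarrow> e i \<bullet> e j = (if i = j then 1 else 0)"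
    and eigen: "\<And>i. i \<in> {1..<CARD('n)} \<Longrightarrow> hessian \<gamma> y *v e i = \<kappa> i *\<^sub>R e i"
    and curv: "\<And>i. i \<in> {1..<CARD('n)} \<Longrightarrow> \<kappa> i < 1 / R"
begin


lemma \<nu>: "norm \<nu> = 1" and \<gamma>_C2: "C2_on UNIV \<gamma>" and \<gamma>_const: "\<gamma> (z + t *\<^sub>R \<nu>) = \<gamma> z"
  using graph unfolding C2_graph_at_def by auto

lemma \<nu>\<nu>: "\<nu> \<bullet> \<nu> = 1" using \<nu> by (simp add: dot_square_norm)

lemma expand: "h = (h \<bullet> \<nu>) *\<^sub>R \<nu> + (\<Sum>j\<in>{1..<CARD('n)}. (h \<bullet> e j) *\<^sub>R e j)"
  by (rule orthonormal_family_expand[OF \<nu> e\<nu> ee])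

lemma parseval: "(norm h)\<^sup>2 = (h \<bullet> \<nu>)\<^sup>2 + (\<Sum>j\<in>{1..<CARD('n)}. (h \<bullet> e j)\<^sup>2)"
  by (rule orthonormal_family_norm[OF \<nu> e\<nu> ee])

lemma graph_ball:
  obtains r where "r > 0" "\<And>z. z \<in> ball y r \<Longrightarrow> z \<in> \<Omega> \<longleftrightarrow> \<gamma> z < z \<bullet> \<nu>"
  using graph unfolding C2_graph_at_def by blast

lemma y: "y \<notin> \<Omega>" "dist x y = R"
proof -
  show 1: "y \<notin> \<Omega>" using touch by auto
  have "y \<in> cball x R" "y \<notin> ball x R" using touch ball by auto
  thus "dist x y = R" by simp
qed

lemma isCont_\<gamma>: "isCont \<gamma> z"
  using \<gamma>_C2 unfolding C2_on_def by (simp add: differentiable_imp_continuous_within)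

lemma inward_step:
  assumes "v \<bullet> (x - y) > 0"
  shows "\<forall>\<^sub>F s in at_right 0. y + s *\<^sub>R v \<in> ball x R"
proof -
  have "((\<lambda>s. s * (norm v)\<^sup>2) \<longlongrightarrow> 0 * (norm v)\<^sup>2) (at_right 0)" by (intro tendsto_intros)
  hence "\<forall>\<^sub>F s in at_right 0. s * (norm v)\<^sup>2 < 2 * (v \<bullet> (x - y))"
    by (rule order_tendstoD) (use assms in auto)
  with eventually_at_right_less[of "0::real"] show ?thesis
  proof eventually_elim
    case (elim s)
    have "(norm (x - (y + s *\<^sub>R v)))\<^sup>2 = (norm (x - y))\<^sup>2 - s * (2 * (v \<bullet> (x - y)) - s * (norm v)\<^sup>2)"
      unfolding power2_norm_eq_inner by (simp add: inner_simps inner_commute algebra_simps power2_eq_square)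
    also have "\<dots> < (norm (x - y))\<^sup>2" using elim by simp
    finally have "norm (x - (y + s *\<^sub>R v)) < norm (x - y)" by (rule power_less_imp_less_base) simp
    thus ?case using y by (simp add: dist_norm)
  qed
qed

lemma tendsto_ray: "((\<lambda>s. y + s *\<^sub>R v) \<longlongrightarrow> y) (at_right 0)"
proof -
  have "((\<lambda>s. y + s *\<^sub>R v) \<longlongrightarrow> y + 0 *\<^sub>R v) (at_right 0)" by (intro tendsto_intros)
  thus ?thesis by simp
qed

lemma \<gamma>_below: "v \<bullet> (x - y) > 0 \<Longrightarrow> \<forall>\<^sub>F s in at_right 0. \<gamma> (y + s *\<^sub>R v) < (y + s *\<^sub>R v) \<bullet> \<nu>"
proof -
  assume v: "v \<bullet> (x - y) > 0"
  obtain r where r: "r > 0" "\<And>z. z \<in> ball y r \<Longrightarrow> z \<in> \<Omega> \<longleftrightarrow> \<gamma> z < z \<bullet> \<nu>" using graph_ball by blast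
  have "\<forall>\<^sub>F s in at_right 0. y + s *\<^sub>R v \<in> ball y r"
    using topological_tendstoD[OF tendsto_ray open_ball] r(1) by simp
  with inward_step[OF v] show ?thesis by eventually_elim (use ball r(2) in blast)
qed

text \<open>As \<open>y\<close> is not in \<Omega>, it lies on or below the graph; the radius from
  \<open>y\<close> towards \<open>x\<close> starts inside \<Omega>, and its limit gives the opposite
  inequality.\<close>

lemma \<gamma>_y: "\<gamma> y = y \<bullet> \<nu>"
proof (rule antisym)
  obtain r where r: "r > 0" "\<And>z. z \<in> ball y r \<Longrightarrow> z \<in> \<Omega> \<longleftrightarrow> \<gamma> z < z \<bullet> \<nu>" using graph_ball by blast
  show "y \<bullet> \<nu> \<le> \<gamma> y" using r(2)[of y] r(1) y(1) by simp
  have "x - y \<noteq> 0" using y(2) R by auto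
  hence "(x - y) \<bullet> (x - y) > 0" by simp
  hence ev: "\<forall>\<^sub>F s in at_right 0. \<gamma> (y + s *\<^sub>R (x - y)) \<le> (y + s *\<^sub>R (x - y)) \<bullet> \<nu>"
    by (rule eventually_mono[OF \<gamma>_below]) auto
  have l: "((\<lambda>s. \<gamma> (y + s *\<^sub>R (x - y))) \<longlongrightarrow> \<gamma> y) (at_right 0)"
    by (rule isCont_tendsto_compose[OF isCont_\<gamma> tendsto_ray])
  have r: "((\<lambda>s. (y + s *\<^sub>R (x - y)) \<bullet> \<nu>) \<longlongrightarrow> y \<bullet> \<nu>) (at_right 0)"
    by (intro tendsto_inner tendsto_const tendsto_ray)
  show "\<gamma> y \<le> y \<bullet> \<nu>" by (rule tendsto_le[OF _ r l ev]) simp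
qed

text \<open>Otherwise some direction would point into the ball while decreasing the height over the
  tangent hyperplane.\<close>
lemma center: "x = y + R *\<^sub>R \<nu>"
proof -
  define m where "m = (1 / R) *\<^sub>R (x - y)"
  have m: "norm m = 1" "m \<bullet> m = 1" using y(2) R by (simp_all add: m_def dist_norm power2_norm_eq_inner[symmetric] power2_eq_square[symmetric] dot_square_norm power_divide)
  have half: "v \<bullet> \<nu> \<ge> 0" if "v \<bullet> m > 0" for v
  proof (rule ccontr)
    assume neg: "\<not> v \<bullet> \<nu> \<ge> 0"
    hence "v \<noteq> 0" by auto
    have "v \<bullet> (x - y) > 0" using that R by (simp add: m_def zero_less_divide_iff)
    note ev = \<gamma>_below[OF this]
    \<comment> \<open>This is the slope at which the ray along \<open>v\<close> descends. A graph
      with Lipschitz constant \<eta> cannot fall below such a ray, whereas the ray lies in the ball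
      and so strictly above the graph.\<close>
    define \<eta> where "\<eta> = - (v \<bullet> \<nu>) / norm v"
    have \<eta>: "\<eta> > 0" using neg \<open>v \<noteq> 0\<close> unfolding \<eta>_def by (intro divide_pos_pos) auto
    obtain \<rho> where \<rho>: "\<rho> > 0" "\<And>v w. v \<in> ball y \<rho> \<Longrightarrow> w \<in> ball y \<rho> \<Longrightarrow> \<bar>\<gamma> v - \<gamma> w\<bar> \<le> \<eta> * norm (v - w)"
      using Lipschitz_near_critical_point[OF \<gamma>_C2 crit \<eta>] by blast
    have "\<forall>\<^sub>F s in at_right 0. y + s *\<^sub>R v \<in> ball y \<rho>"
      using topological_tendstoD[OF tendsto_ray open_ball] \<rho>(1) by simp
    with ev have "\<forall>\<^sub>F s::real in at_right 0. False"
      using eventually_at_right_less[of "0::real"]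
    proof eventually_elim
      case (elim s)
      have "\<gamma> y - \<gamma> (y + s *\<^sub>R v) \<le> \<eta> * norm (s *\<^sub>R v)"
        using \<rho>(2)[of "y + s *\<^sub>R v" y] elim(2) \<rho>(1) by simp
      also have "\<dots> = - s * (v \<bullet> \<nu>)" using elim(3) \<open>v \<noteq> 0\<close> by (simp add: \<eta>_def)
      finally show ?case using elim(1) \<gamma>_y by (simp add: inner_add_left)
    qed
    thus False by simp
  qed
  have "m = \<nu>"
  proof (rule ccontr)
    assume "m \<noteq> \<nu>"
    hence "0 < (m - \<nu>) \<bullet> (m - \<nu>)" by simp
    also have "\<dots> = 2 * (1 - m \<bullet> \<nu>)" using m \<nu>\<nu> by (simp add: inner_simps inner_commute)
    finally have lt: "m \<bullet> \<nu> < 1" by simp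
    \<comment> \<open>For two different unit vectors the difference is the witness: it has positive
      product with \<open>m\<close> and negative product with \<nu>.\<close>
    have "(m - \<nu>) \<bullet> m > 0" "(m - \<nu>) \<bullet> \<nu> < 0" using lt m \<nu>\<nu> by (simp_all add: inner_simps inner_commute)
    thus False using half by fastforce
  qed
  moreover have "R *\<^sub>R m = x - y" using R by (simp add: m_def)
  ultimately have "R *\<^sub>R \<nu> = x - y" by simp
  thus ?thesis by (simp add: algebra_simps)
qed

text \<open>With origin at \<open>y\<close> and centre \<open>R *\<^sub>R \<nu>\<close> the constant
  term cancels. Apart from the squared normal coordinate, all remaining terms are of the same order
  under the anisotropic scaling.\<close>

lemma in_ball_iff: "w \<in> ball x R \<longleftrightarrow>
   ((w - y) \<bullet> \<nu>)\<^sup>2 + (\<Sum>j\<in>{1..<CARD('n)}. ((w - y) \<bullet> e j)\<^sup>2) < 2 * R * ((w - y) \<bullet> \<nu>)"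
proof -
  have "w \<in> ball x R \<longleftrightarrow> (norm (x - w))\<^sup>2 < R\<^sup>2"
    using R by (simp add: dist_norm abs_less_iff power_strict_mono power2_less_imp_less
       order.strict_iff_not abs_le_square_iff[symmetric])
  also have "x - w = R *\<^sub>R \<nu> - (w - y)" using center by simp
  also have "(norm \<dots>)\<^sup>2 = R\<^sup>2 - 2 * R * ((w - y) \<bullet> \<nu>) + (norm (w - y))\<^sup>2"
    unfolding power2_norm_eq_inner using \<nu>\<nu> by (simp add: inner_diff_left inner_diff_right inner_commute power2_eq_square algebra_simps)
  also have "\<dots> < R\<^sup>2 \<longleftrightarrow> (norm (w - y))\<^sup>2 < 2 * R * ((w - y) \<bullet> \<nu>)" by auto
  finally show ?thesis by (simp only: parseval[of "w - y"])
qed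

text \<open>The Hessian form of \<gamma> at \<open>y\<close>, diagonal in the principal frame; the
  direction \<nu> contributes nothing because \<gamma> is constant along it.\<close>

definition curvature_form :: "real^'n \<Rightarrow> real" where
  "curvature_form h = (\<Sum>j\<in>{1..<CARD('n)}. \<kappa> j * (h \<bullet> e j)\<^sup>2)"

text \<open>Replacing \<open>h\<close> by its tangential part does not change \<gamma>, so the error
  involves tangential squares only. These are bounded by 2R times the height inside the touching
  ball and scale exactly like \<epsilon>.\<close>

lemma \<gamma>_Taylor:
  assumes \<eta>: "\<eta> > 0"
  obtains \<rho> where "\<rho> > 0"
    "\<And>h. norm h < \<rho> \<Longrightarrow> \<bar>\<gamma> (y + h) - \<gamma> y - curvature_form h / 2\<bar> \<le> \<eta> * (\<Sum>j\<in>{1..<CARD('n)}. (h \<bullet> e j)\<^sup>2)"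
proof -
  obtain \<rho> where \<rho>: "\<rho> > 0"
    "\<And>v. norm v < \<rho> \<Longrightarrow> \<bar>\<gamma> (y + v) - \<gamma> y - ((hessian \<gamma> y *v v) \<bullet> v) / 2\<bar> \<le> \<eta> * (norm v)\<^sup>2"
    using second_order_Taylor[OF \<gamma>_C2 crit \<eta>] by blast
  have "\<bar>\<gamma> (y + h) - \<gamma> y - curvature_form h / 2\<bar> \<le> \<eta> * (\<Sum>j\<in>{1..<CARD('n)}. (h \<bullet> e j)\<^sup>2)" if h: "norm h < \<rho>" for h
  proof -
    define v where "v = (\<Sum>j\<in>{1..<CARD('n)}. (h \<bullet> e j) *\<^sub>R e j)"
    have "h = (h \<bullet> \<nu>) *\<^sub>R \<nu> + v" unfolding v_def by (rule expand)
    hence "y + h = y + ((h \<bullet> \<nu>) *\<^sub>R \<nu> + v)" by (rule arg_cong)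
    also have "\<dots> = (y + v) + (h \<bullet> \<nu>) *\<^sub>R \<nu>" by simp
    finally have hv: "y + h = (y + v) + (h \<bullet> \<nu>) *\<^sub>R \<nu>" .
    have v\<nu>: "v \<bullet> \<nu> = 0" unfolding v_def by (simp add: inner_sum_left e\<nu>)
    have v: "v = h - (h \<bullet> \<nu>) *\<^sub>R \<nu>" using \<open>h = _ + v\<close> by (simp add: eq_diff_eq add.commute)
    have ve: "v \<bullet> e j = h \<bullet> e j" if "j \<in> {1..<CARD('n)}" for j
      unfolding v using e\<nu>[OF that] by (simp add: inner_diff_left inner_diff_right inner_commute)
    have nv: "(norm v)\<^sup>2 = (\<Sum>j\<in>{1..<CARD('n)}. (h \<bullet> e j)\<^sup>2)" unfolding parseval[of v] v\<nu> using ve by simp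
    hence "(norm v)\<^sup>2 \<le> (norm h)\<^sup>2" unfolding parseval[of h] by simp
    hence nv\<rho>: "norm v < \<rho>" using h by (simp add: abs_le_square_iff[symmetric])
    have "hessian \<gamma> y *v v = (\<Sum>j\<in>{1..<CARD('n)}. (\<kappa> j * (h \<bullet> e j)) *\<^sub>R e j)"
      unfolding v_def using eigen
      by (simp add: linear_sum[OF matrix_vector_mul_linear] matrix_vector_mult_scaleR mult.commute)
    hence "(hessian \<gamma> y *v v) \<bullet> v = (\<Sum>j\<in>{1..<CARD('n)}. \<kappa> j * (h \<bullet> e j) * (e j \<bullet> v))" by (simp add: inner_sum_left)
    also have "\<dots> = curvature_form h" unfolding curvature_form_def
      by (intro sum.cong) (auto simp: ve inner_commute[of "e _" v] power2_eq_square)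
    finally have "(hessian \<gamma> y *v v) \<bullet> v = curvature_form h" .
    moreover note nv\<rho>
    moreover have "\<gamma> (y + h) = \<gamma> (y + v)" unfolding hv by (rule \<gamma>_const)
    ultimately show ?thesis using \<rho>(2)[of v] nv by simp
  qed
  thus ?thesis using that \<rho>(1) by blast
qed

section \<open>Distance to the boundary near the contact point and on the ball\<close>

lemma complement_nonempty: "- \<Omega> \<noteq> {}" using y by blast

lemma bdist_pos: "z \<in> \<Omega> \<Longrightarrow> bdist \<Omega> z > 0"
  using foot_point_frontier[OF dom complement_nonempty] by metis

lemma bdist_le_dist: "bdist \<Omega> z \<le> norm (z - y)"
  using infdist_le[of y "- \<Omega>" z] y by (simp add: dist_norm)

text \<open>The gap along \<nu> ends at a point of the graph outside \<Omega>, so it bounds the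
  distance from above. Conversely the foot point lies on or below the graph, and a Lipschitz
  constant \<eta> of \<gamma> lets the gap exceed the distance by a factor 1 + \<eta> at
  most.\<close>

lemma bdist_near:
  assumes \<eta>: "\<eta> > 0"
  obtains \<rho> where "\<rho> > 0"
    "\<And>z. z \<in> ball y \<rho> \<Longrightarrow> z \<in> \<Omega> \<Longrightarrow> bdist \<Omega> z \<le> z \<bullet> \<nu> - \<gamma> z \<and> z \<bullet> \<nu> - \<gamma> z \<le> (1 + \<eta>) * bdist \<Omega> z"
proof -
  obtain r where r: "r > 0" "\<And>z. z \<in> ball y r \<Longrightarrow> z \<in> \<Omega> \<longleftrightarrow> \<gamma> z < z \<bullet> \<nu>" using graph_ball by blast
  obtain \<rho>1 where \<rho>1: "\<rho>1 > 0" "\<And>v w. v \<in> ball y \<rho>1 \<Longrightarrow> w \<in> ball y \<rho>1 \<Longrightarrow> \<bar>\<gamma> v - \<gamma> w\<bar> \<le> \<eta> * norm (v - w)"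
    using Lipschitz_near_critical_point[OF \<gamma>_C2 crit \<eta>] by blast
  obtain \<rho>2 where \<rho>2: "\<rho>2 > 0" "\<And>v w. v \<in> ball y \<rho>2 \<Longrightarrow> w \<in> ball y \<rho>2 \<Longrightarrow> \<bar>\<gamma> v - \<gamma> w\<bar> \<le> 1 * norm (v - w)"
    using Lipschitz_near_critical_point[OF \<gamma>_C2 crit zero_less_one] by blast
  \<comment> \<open>The point below \<open>z\<close> on the graph is within 3\<rho> of
    \<open>y\<close> and the foot point within 2\<rho>, so both stay where the graph description and
    the Lipschitz bounds hold.\<close>
  define \<rho> where "\<rho> = min (min r \<rho>1) \<rho>2 / 4"
  have \<rho>: "\<rho> > 0" "4 * \<rho> \<le> r" "4 * \<rho> \<le> \<rho>1" "4 * \<rho> \<le> \<rho>2" using r \<rho>1 \<rho>2 by (auto simp: \<rho>_def)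
  have "bdist \<Omega> z \<le> z \<bullet> \<nu> - \<gamma> z \<and> z \<bullet> \<nu> - \<gamma> z \<le> (1 + \<eta>) * bdist \<Omega> z" if z: "z \<in> ball y \<rho>" "z \<in> \<Omega>" for z
  proof
    define T where "T = z \<bullet> \<nu> - \<gamma> z"
    have nz: "norm (z - y) < \<rho>" using z by (simp add: dist_norm norm_minus_commute)
    have Tpos: "T > 0" using z r(2)[of z] \<rho> by (simp add: T_def)
    have "T = (z - y) \<bullet> \<nu> - (\<gamma> z - \<gamma> y)" using \<gamma>_y by (simp add: T_def inner_diff_left)
    moreover have "\<bar>(z - y) \<bullet> \<nu>\<bar> \<le> norm (z - y)" using Cauchy_Schwarz_ineq2[of "z - y" \<nu>] \<nu> by simp
    moreover have "\<bar>\<gamma> z - \<gamma> y\<bar> \<le> norm (z - y)" using \<rho>2(2)[of z y] z \<rho> by simp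
    ultimately have T2: "T \<le> 2 * norm (z - y)" by linarith
    define w where "w = z + (- T) *\<^sub>R \<nu>"
    have "norm (w - z) = T" using Tpos \<nu> by (simp add: w_def)
    moreover have "norm (w - y) \<le> norm (w - z) + norm (z - y)"
      using norm_triangle_ineq[of "w - z" "z - y"] by simp
    ultimately have "w \<in> ball y r" using T2 nz \<rho> by (simp add: dist_norm norm_minus_commute)
    moreover have "\<gamma> w = \<gamma> z" unfolding w_def by (rule \<gamma>_const)
    moreover have "w \<bullet> \<nu> = \<gamma> z" unfolding w_def inner_add_left inner_scaleR_left \<nu>\<nu> T_def by simp
    ultimately have "w \<notin> \<Omega>" using r(2) by simp
    hence "bdist \<Omega> z \<le> dist z w" by (intro infdist_le) simp
    thus "bdist \<Omega> z \<le> z \<bullet> \<nu> - \<gamma> z" using \<open>norm (w - z) = T\<close> by (simp add: T_def dist_norm norm_minus_commute)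
    obtain f where f: "f \<notin> \<Omega>" "dist z f = bdist \<Omega> z" using foot_point[OF dom complement_nonempty] by blast
    have "norm (f - y) \<le> norm (z - f) + norm (z - y)"
      using norm_triangle_ineq[of "f - z" "z - y"] by (simp add: norm_minus_commute)
    also have "norm (z - f) \<le> norm (z - y)" using f(2) bdist_le_dist[of z] by (simp add: dist_norm)
    finally have fy: "norm (f - y) < 2 * \<rho>" using nz by simp
    hence "f \<in> ball y r" "f \<in> ball y \<rho>1" using \<rho> by (auto simp: dist_norm norm_minus_commute)
    hence "f \<bullet> \<nu> \<le> \<gamma> f" using r(2) f(1) by force
    hence "T \<le> (z - f) \<bullet> \<nu> + (\<gamma> f - \<gamma> z)" by (simp add: T_def inner_diff_left)
    also have "(z - f) \<bullet> \<nu> \<le> norm (z - f)" using Cauchy_Schwarz_ineq2[of "z - f" \<nu>] \<nu> by simp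
    also have "\<gamma> f - \<gamma> z \<le> \<eta> * norm (z - f)"
      using \<rho>1(2)[of f z] \<open>f \<in> ball y \<rho>1\<close> z \<rho> by (simp add: norm_minus_commute)
    finally show "z \<bullet> \<nu> - \<gamma> z \<le> (1 + \<eta>) * bdist \<Omega> z" using f(2) by (simp add: T_def dist_norm algebra_simps)
  qed
  thus ?thesis using that \<rho>(1) by blast
qed

text \<open>The source of an integrable majorant. Near \<open>y\<close> the boundary rises by at
  most about K S / 2, with S the sum of the tangential squares, while inside the ball S is at most
  2R times the height; since K < 1/R, a fixed fraction of the height remains.\<close>

lemma bdist_lower_on_ball:
  assumes ri: "ri > 0"
  obtains c where "c > 0" "\<And>w. w \<in> ball x R \<Longrightarrow> min (bdist \<Omega> w) ri \<ge> c * ((w - y) \<bullet> \<nu>)"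
proof -
  \<comment> \<open>Inserting 0 makes the maximum well defined and K nonnegative, which guarantees
    that the coefficient multiplying S below has the right sign.\<close>
  define K where "K = Max (insert 0 (\<kappa> ` {1..<CARD('n)}))"
  have K: "K < 1 / R" "\<And>j. j \<in> {1..<CARD('n)} \<Longrightarrow> \<kappa> j \<le> K"
  proof -
    show "K < 1 / R" unfolding K_def using curv R by auto
    show "\<kappa> j \<le> K" if "j \<in> {1..<CARD('n)}" for j unfolding K_def using that by (intro Max_ge) auto
  qed
  \<comment> \<open>One quarter of the margin serves as Taylor error; the gap is then at least
    2\<eta>R times the height, and passing from gap to distance halves it.\<close>
  define \<eta> where "\<eta> = (1 / R - K) / 4"
  have \<eta>: "\<eta> > 0" using K by (simp add: \<eta>_def)
  obtain \<rho>1 where \<rho>1: "\<rho>1 > 0"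
    "\<And>h. norm h < \<rho>1 \<Longrightarrow> \<bar>\<gamma> (y + h) - \<gamma> y - curvature_form h / 2\<bar> \<le> \<eta> * (\<Sum>j\<in>{1..<CARD('n)}. (h \<bullet> e j)\<^sup>2)"
    using \<gamma>_Taylor[OF \<eta>] by blast
  obtain \<rho>2 where \<rho>2: "\<rho>2 > 0"
    "\<And>z. z \<in> ball y \<rho>2 \<Longrightarrow> z \<in> \<Omega> \<Longrightarrow> bdist \<Omega> z \<le> z \<bullet> \<nu> - \<gamma> z \<and> z \<bullet> \<nu> - \<gamma> z \<le> (1 + 1) * bdist \<Omega> z"
    using bdist_near[OF zero_less_one] by blast
  define \<rho> where "\<rho> = min (min \<rho>1 \<rho>2) ri"
  have \<rho>: "\<rho> > 0" "\<rho> \<le> \<rho>1" "\<rho> \<le> \<rho>2" "\<rho> \<le> ri" using \<rho>1 \<rho>2 ri by (auto simp: \<rho>_def)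
  have near: "min (bdist \<Omega> w) ri \<ge> (\<eta> * R) * ((w - y) \<bullet> \<nu>)" if w: "w \<in> ball x R" "norm (w - y) < \<rho>" for w
  proof -
    define s where "s = (w - y) \<bullet> \<nu>"
    define S where "S = (\<Sum>j\<in>{1..<CARD('n)}. ((w - y) \<bullet> e j)\<^sup>2)"
    have S: "S \<ge> 0" unfolding S_def by (intro sum_nonneg) auto
    have S2: "S \<le> 2 * R * s" using w(1) zero_le_power2[of s] unfolding in_ball_iff S_def[symmetric] s_def[symmetric] by linarith
    have "curvature_form (w - y) \<le> (\<Sum>j\<in>{1..<CARD('n)}. K * ((w - y) \<bullet> e j)\<^sup>2)"
      unfolding curvature_form_def using K by (intro sum_mono mult_right_mono) auto
    hence cf: "curvature_form (w - y) \<le> K * S" by (simp add: S_def sum_distrib_left)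
    have "\<gamma> w - \<gamma> y \<le> curvature_form (w - y) / 2 + \<eta> * S"
      using \<rho>1(2)[of "w - y"] w(2) \<rho> by (simp add: S_def)
    hence "s - (\<gamma> w - \<gamma> y) \<ge> s - (K / 2 + \<eta>) * S" using cf by (simp add: algebra_simps)
    moreover have "(K / 2 + \<eta>) * S = (1 / R - 2 * \<eta>) / 2 * S"
    proof -
      have "4 * \<eta> = 1 / R - K" unfolding \<eta>_def by (subst times_divide_eq_right, rule nonzero_mult_div_cancel_left) simp
      hence "K / 2 + \<eta> = (1 / R - 2 * \<eta>) / 2" by (simp add: field_simps)
      thus ?thesis by simp
    qed
    moreover have "(1 / R - 2 * \<eta>) / 2 * S \<le> (1 - 2 * \<eta> * R) * s"
    proof -
      have "0 \<le> 1 / R - 2 * \<eta>"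
      proof -
        have "K \<ge> 0" unfolding K_def by simp
        thus ?thesis using R by (simp add: \<eta>_def field_simps)
      qed
      hence "(1 / R - 2 * \<eta>) / 2 * S \<le> (1 / R - 2 * \<eta>) / 2 * (2 * R * s)" using S2 by (intro mult_left_mono) auto
      also have "\<dots> = (1 - 2 * \<eta> * R) * s" using R by (simp add: field_simps)
      finally show ?thesis .
    qed
    ultimately have "s - (\<gamma> w - \<gamma> y) \<ge> s - (1 - 2 * \<eta> * R) * s" by linarith
    also have "s - (1 - 2 * \<eta> * R) * s = 2 * (\<eta> * R * s)" by (simp add: algebra_simps)
    finally have "s - (\<gamma> w - \<gamma> y) \<ge> 2 * (\<eta> * R * s)" .
    moreover have "s - (\<gamma> w - \<gamma> y) = w \<bullet> \<nu> - \<gamma> w" using \<gamma>_y by (simp add: s_def inner_diff_left)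
    moreover have "w \<bullet> \<nu> - \<gamma> w \<le> 2 * bdist \<Omega> w"
      using \<rho>2(2)[of w] w(2) subsetD[OF ball w(1)] \<rho> by (simp add: dist_norm norm_minus_commute)
    ultimately have "bdist \<Omega> w \<ge> \<eta> * R * s" by simp
    moreover have "bdist \<Omega> w < ri" using bdist_le_dist[of w] w(2) \<rho> by simp
    ultimately show ?thesis by (simp add: s_def)
  qed
  \<comment> \<open>Away from the unique contact point the closed ball is a compact subset of
    \<Omega>, so the distance to the boundary has a positive minimum there.\<close>
  have "compact (cball x R - ball y \<rho>)" by (rule compact_diff[OF compact_cball open_ball])
  moreover have "continuous_on (cball x R - ball y \<rho>) (\<lambda>w. bdist \<Omega> w)" by (intro continuous_intros)
  moreover have sub: "cball x R - ball y \<rho> \<subseteq> \<Omega>"   proof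
    fix w assume w: "w \<in> cball x R - ball y \<rho>"
    show "w \<in> \<Omega>"
    proof (rule ccontr)
      assume "w \<notin> \<Omega>"
      hence "w = y" using touch w by blast
      thus False using w \<rho>(1) by simp
    qed
  qed
  ultimately obtain d where d: "d > 0" "\<And>w. w \<in> cball x R - ball y \<rho> \<Longrightarrow> bdist \<Omega> w \<ge> d"
  proof (cases "cball x R - ball y \<rho> = {}")
    case True
    thus ?thesis using that[OF zero_less_one] by blast
  next
    case False
    then obtain m where "m \<in> cball x R - ball y \<rho>" "\<And>w. w \<in> cball x R - ball y \<rho> \<Longrightarrow> bdist \<Omega> m \<le> bdist \<Omega> w"
      using continuous_attains_inf[of "cball x R - ball y \<rho>" "bdist \<Omega>"]
        \<open>compact _\<close> \<open>continuous_on _ _\<close> by blast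
    thus ?thesis using that[of "bdist \<Omega> m"] bdist_pos sub by blast
  qed
  \<comment> \<open>Heights in the ball are below 2R, so the second entry turns the constant bound
    away from \<open>y\<close> into one proportional to the height.\<close>
  define c where "c = min (\<eta> * R) (min d ri / (2 * R))"
  have c: "c > 0" "c \<le> \<eta> * R" "c \<le> min d ri / (2 * R)" using \<eta> R d ri by (auto simp: c_def)
  have "min (bdist \<Omega> w) ri \<ge> c * ((w - y) \<bullet> \<nu>)" if w: "w \<in> ball x R" for w
  proof -
    define s where "s = (w - y) \<bullet> \<nu>"
    have "s\<^sup>2 \<le> s\<^sup>2 + (\<Sum>j\<in>{1..<CARD('n)}. ((w - y) \<bullet> e j)\<^sup>2)" by (simp add: sum_nonneg)
    hence lt: "s\<^sup>2 < 2 * R * s" using w unfolding in_ball_iff s_def by linarith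
    have s: "s > 0" "s < 2 * R"
    proof -
      show "s > 0"
      proof (rule ccontr)
        assume "\<not> s > 0"
        hence "2 * R * s \<le> 0" using R by (simp add: mult_le_0_iff)
        thus False using lt zero_le_power2[of s] by linarith
      qed
      thus "s < 2 * R" using lt by (simp add: power2_eq_square)
    qed
    show ?thesis
    proof (cases "norm (w - y) < \<rho>")
      case True
      thus ?thesis using near[OF w True] c(2) s mult_right_mono[of c "\<eta> * R" s] unfolding s_def by linarith
    next
      case False
      hence "bdist \<Omega> w \<ge> d" using d(2)[of w] w by (auto simp: dist_norm norm_minus_commute)
      moreover have "c * s \<le> min d ri / (2 * R) * (2 * R)" using c s d ri R by (intro mult_mono) auto
      ultimately show ?thesis using R unfolding s_def by (auto simp: min_def split: if_splits)
    qed
  qed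
  thus ?thesis using that c(1) by blast
qed

section \<open>Anisotropic zoom: scaled distances converge to the height over the osculating
  paraboloid\<close>

definition height :: "real^'n \<Rightarrow> real" where
  "height h = h \<bullet> \<nu> - curvature_form h / 2"

definition dilation :: "real \<Rightarrow> real^'n \<Rightarrow> real^'n" where
  "dilation \<epsilon> h = (\<epsilon> * (h \<bullet> \<nu>)) *\<^sub>R \<nu> + (\<Sum>j\<in>{1..<CARD('n)}. (sqrt \<epsilon> * (h \<bullet> e j)) *\<^sub>R e j)"

lemma dilation_inner:
  shows "dilation \<epsilon> h \<bullet> \<nu> = \<epsilon> * (h \<bullet> \<nu>)"
    and "j \<in> {1..<CARD('n)} \<Longrightarrow> dilation \<epsilon> h \<bullet> e j = sqrt \<epsilon> * (h \<bullet> e j)"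
proof -
  show "dilation \<epsilon> h \<bullet> \<nu> = \<epsilon> * (h \<bullet> \<nu>)"
    unfolding dilation_def by (simp add: inner_add_left inner_sum_left \<nu>\<nu> e\<nu>)
  assume j: "j \<in> {1..<CARD('n)}"
  have "(\<Sum>i\<in>{1..<CARD('n)}. (sqrt \<epsilon> * (h \<bullet> e i)) * (e i \<bullet> e j)) = (\<Sum>i\<in>{1..<CARD('n)}. if i = j then sqrt \<epsilon> * (h \<bullet> e i) else 0)"
    using j by (intro sum.cong) (auto simp: ee)
  also have "\<dots> = sqrt \<epsilon> * (h \<bullet> e j)" using j by simp
  moreover have "\<nu> \<bullet> e j = 0" using e\<nu>[OF j] by (simp add: inner_commute)
  ultimately show "dilation \<epsilon> h \<bullet> e j = sqrt \<epsilon> * (h \<bullet> e j)"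
    unfolding dilation_def by (simp add: inner_add_left inner_sum_left)
qed

lemma tendsto_dilation:
  assumes "(\<epsilon> \<longlongrightarrow> 0) F"
  shows "((\<lambda>k. dilation (\<epsilon> k) h) \<longlongrightarrow> 0) F"
proof -
  have "((\<lambda>k. dilation (\<epsilon> k) h) \<longlongrightarrow> (0 * (h \<bullet> \<nu>)) *\<^sub>R \<nu> + (\<Sum>j\<in>{1..<CARD('n)}. (sqrt 0 * (h \<bullet> e j)) *\<^sub>R e j)) F"
    unfolding dilation_def by (intro tendsto_intros assms)
  thus ?thesis by simp
qed

lemma dilation_in_ball_iff:
  assumes "\<epsilon> > 0"
  shows "y + dilation \<epsilon> h \<in> ball x R \<longleftrightarrow>
    \<epsilon> * (h \<bullet> \<nu>)\<^sup>2 + (\<Sum>j\<in>{1..<CARD('n)}. (h \<bullet> e j)\<^sup>2) < 2 * R * (h \<bullet> \<nu>)"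
proof -
  have "(\<Sum>j\<in>{1..<CARD('n)}. (dilation \<epsilon> h \<bullet> e j)\<^sup>2) = \<epsilon> * (\<Sum>j\<in>{1..<CARD('n)}. (h \<bullet> e j)\<^sup>2)"
    using assms by (simp add: dilation_inner power_mult_distrib sum_distrib_left)
  hence "y + dilation \<epsilon> h \<in> ball x R \<longleftrightarrow>
     \<epsilon> * (\<epsilon> * (h \<bullet> \<nu>)\<^sup>2 + (\<Sum>j\<in>{1..<CARD('n)}. (h \<bullet> e j)\<^sup>2)) < \<epsilon> * (2 * R * (h \<bullet> \<nu>))"
    unfolding in_ball_iff by (simp add: dilation_inner power_mult_distrib algebra_simps power2_eq_square)
  thus ?thesis by (simp only: mult_less_cancel_left_pos[OF assms])
qed

text \<open>The normal coordinate, the curvature form and the Taylor error all scale by exactly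
  \<epsilon>, so the gap divided by \<epsilon> converges. The distance follows because it differs
  from the gap by an arbitrarily small relative error and the limit is finite.\<close>

lemma bdist_dilation_tendsto:
  assumes \<epsilon>: "\<And>k. \<epsilon> k > 0" "\<epsilon> \<longlonglongrightarrow> 0"
    and in\<Omega>: "\<forall>\<^sub>F k in sequentially. y + dilation (\<epsilon> k) h \<in> \<Omega>"
  shows "(\<lambda>k. bdist \<Omega> (y + dilation (\<epsilon> k) h) / \<epsilon> k) \<longlonglongrightarrow> height h"
proof -
  let ?z = "\<lambda>k. y + dilation (\<epsilon> k) h"
  let ?T = "\<lambda>k. (?z k \<bullet> \<nu> - \<gamma> (?z k)) / \<epsilon> k"
  define S where "S = (\<Sum>j\<in>{1..<CARD('n)}. (h \<bullet> e j)\<^sup>2)"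
  have S: "S \<ge> 0" unfolding S_def by (intro sum_nonneg) auto
  have lim0: "(\<lambda>k. dilation (\<epsilon> k) h) \<longlonglongrightarrow> 0" by (rule tendsto_dilation[OF \<epsilon>(2)])
  have small: "\<forall>\<^sub>F k in sequentially. norm (dilation (\<epsilon> k) h) < \<rho>" if "\<rho> > 0" for \<rho>
    using tendstoD[OF lim0 that] by simp
  have T: "?T \<longlonglongrightarrow> height h"
  proof (rule tendstoI)
    fix r :: real assume r: "r > 0"
    define \<eta> where "\<eta> = r / (S + 1) / 2"
    have \<eta>: "\<eta> > 0" "\<eta> * S < r" using r S mult_nonneg_nonneg[of S r] by (auto simp: \<eta>_def field_simps add_pos_nonneg intro: add_nonneg_pos)
    obtain \<rho> where \<rho>: "\<rho> > 0"
      "\<And>h. norm h < \<rho> \<Longrightarrow> \<bar>\<gamma> (y + h) - \<gamma> y - curvature_form h / 2\<bar> \<le> \<eta> * (\<Sum>j\<in>{1..<CARD('n)}. (h \<bullet> e j)\<^sup>2)"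
      using \<gamma>_Taylor[OF \<eta>(1)] by blast
    from small[OF \<rho>(1)] show "\<forall>\<^sub>F k in sequentially. dist (?T k) (height h) < r"
    proof eventually_elim
      case (elim k)
      let ?d = "dilation (\<epsilon> k) h"
      have "curvature_form ?d = \<epsilon> k * curvature_form h" "(\<Sum>j\<in>{1..<CARD('n)}. (?d \<bullet> e j)\<^sup>2) = \<epsilon> k * S"
        using \<epsilon>(1)[of k] unfolding curvature_form_def S_def
        by (auto simp: dilation_inner power_mult_distrib sum_distrib_left mult_ac)
      hence "\<bar>\<gamma> (y + ?d) - \<gamma> y - \<epsilon> k * curvature_form h / 2\<bar> \<le> \<epsilon> k * (\<eta> * S)"
        using \<rho>(2)[OF elim] by (simp add: mult_ac)
      moreover have "\<epsilon> k * ?T k = (y + ?d) \<bullet> \<nu> - \<gamma> (y + ?d)" using \<epsilon>(1)[of k] by simp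
      hence "\<epsilon> k * (?T k - height h) = - (\<gamma> (y + ?d) - \<gamma> y - \<epsilon> k * curvature_form h / 2)"
        using \<gamma>_y by (simp add: height_def dilation_inner inner_add_left right_diff_distrib)
      ultimately have "\<bar>\<epsilon> k * (?T k - height h)\<bar> \<le> \<epsilon> k * (\<eta> * S)" by (simp only: abs_minus)
      hence "\<bar>?T k - height h\<bar> \<le> \<eta> * S" using \<epsilon>(1)[of k] by (simp add: abs_mult)
      thus ?case using \<eta> by (simp add: dist_real_def)
    qed
  qed
  show ?thesis
  proof (rule tendstoI)
    fix r :: real assume r: "r > 0"
    define \<eta> where "\<eta> = r / (\<bar>height h\<bar> + 1) / 2"
    have \<eta>: "\<eta> > 0" "\<eta> * (\<bar>height h\<bar> + 1) = r / 2" using r by (auto simp: \<eta>_def field_simps add_pos_nonneg)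
    obtain \<rho> where \<rho>: "\<rho> > 0" "\<And>z. z \<in> ball y \<rho> \<Longrightarrow> z \<in> \<Omega> \<Longrightarrow>
        bdist \<Omega> z \<le> z \<bullet> \<nu> - \<gamma> z \<and> z \<bullet> \<nu> - \<gamma> z \<le> (1 + \<eta>) * bdist \<Omega> z"
      using bdist_near[OF \<eta>(1)] by blast
    have 1: "\<forall>\<^sub>F k in sequentially. dist (?T k) (height h) < min 1 (r / 2)" using r by (intro tendstoD[OF T]) simp
    from 1 in\<Omega> small[OF \<rho>(1)]
    show "\<forall>\<^sub>F k in sequentially. dist (bdist \<Omega> (?z k) / \<epsilon> k) (height h) < r"
    proof eventually_elim
      case (elim k)
      define D where "D = bdist \<Omega> (?z k) / \<epsilon> k"
      define T where "T = ?T k"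
      have "?z k \<in> ball y \<rho>" using elim(3) by (simp add: dist_norm)
      from \<rho>(2)[OF this elim(2)] have D: "D \<le> T" "T \<le> (1 + \<eta>) * D"
        unfolding D_def T_def using \<epsilon>(1)[of k] divide_right_mono less_imp_le by (metis, metis times_divide_eq_right)
      have T: "\<bar>T - height h\<bar> < 1" "\<bar>T - height h\<bar> < r / 2" using elim(1) by (simp_all add: T_def dist_real_def)
      have "T - D \<le> \<eta> * D" using D by (simp add: algebra_simps)
      also have "\<dots> \<le> \<eta> * (\<bar>height h\<bar> + 1)"
        using D(1) T(1) \<eta>(1) by (intro mult_left_mono) auto
      finally have "T - D \<le> r / 2" using \<eta>(2) by simp
      thus ?case using D(1) T(2) unfolding D_def[symmetric] dist_real_def by linarith
    qed
  qed
qed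

end

section \<open>Integration over a paraboloid\<close>

lemma nn_integral_gaussian:
  assumes a: "a > 0"
  shows "(\<integral>\<^sup>+x. ennreal (exp (- (a * x\<^sup>2 / 2))) \<partial>lborel) = ennreal (sqrt (2 * pi / a))"
proof -
  define \<sigma> where "\<sigma> = 1 / sqrt a"
  have \<sigma>: "\<sigma> > 0" "\<sigma>\<^sup>2 = 1 / a" using a by (simp_all add: \<sigma>_def power_divide)
  have eq: "exp (- (a * x\<^sup>2 / 2)) = sqrt (2 * pi / a) * normal_density 0 \<sigma> x" for x
    unfolding normal_density_def \<sigma> using a by simp
  have "(\<integral>\<^sup>+x. ennreal (exp (- (a * x\<^sup>2 / 2))) \<partial>lborel)
     = ennreal (\<integral>x. sqrt (2 * pi / a) * normal_density 0 \<sigma> x \<partial>lborel)"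
    unfolding eq using \<sigma> a
    by (intro nn_integral_eq_integral integrable_mult_right integrable_normal_density) auto
  thus ?thesis using \<sigma> by simp
qed

lemma nn_integral_exponential_tail:
  assumes c: "c > 0"
  shows "(\<integral>\<^sup>+s. ennreal (indicator {m<..} s * exp (- (c * (s - k)))) \<partial>lborel) = ennreal (exp (- (c * (m - k))) / c)"
proof -
  have "(\<integral>\<^sup>+s. ennreal (indicator {m<..} s * exp (- (c * (s - k)))) \<partial>lborel)
      = (\<integral>\<^sup>+s. ennreal (exp (- (c * (s - k)))) * indicator {m..} s \<partial>lborel)"
    by (intro nn_integral_cong_AE, use AE_lborel_singleton[of m] in eventually_elim)
      (auto simp: indicator_def)
  also have "\<dots> = ennreal (0 - (- exp (- (c * (m - k))) / c))"
  proof (rule nn_integral_FTC_atLeast)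
    show "((\<lambda>s. - exp (- (c * (s - k))) / c) has_real_derivative exp (- (c * (s - k)))) (at s)" for s
      using c by (auto intro!: derivative_eq_intros)
    have "filterlim (\<lambda>s. s - k) at_top at_top"
      by (subst diff_conv_add_uminus, subst add.commute) (rule filterlim_tendsto_add_at_top[OF tendsto_const filterlim_ident])
    hence "filterlim (\<lambda>s. - c * (s - k)) at_bot at_top"
      using c by (intro filterlim_tendsto_neg_mult_at_bot[OF tendsto_const]) auto
    hence "((\<lambda>s. exp (- c * (s - k))) \<longlongrightarrow> 0) at_top" by (rule filterlim_compose[OF exp_at_bot])
    hence "((\<lambda>s. - exp (- c * (s - k)) / c) \<longlongrightarrow> - 0 / c) at_top" using c by (intro tendsto_intros) auto
    thus "((\<lambda>s. - exp (- (c * (s - k))) / c) \<longlongrightarrow> 0) at_top" by simp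
  qed auto
  finally show ?thesis by simp
qed

text \<open>The strict epigraph of a paraboloid, with \<open>i0\<close> pointing upwards.\<close>
definition paraboloid :: "'a::euclidean_space \<Rightarrow> real \<Rightarrow> 'a set" where
  "paraboloid i0 R = {w. (\<Sum>b\<in>Basis - {i0}. (w \<bullet> b)\<^sup>2) < 2 * R * (w \<bullet> i0)}"

text \<open>Used twice: with the curvatures for \<open>a\<close> it is the blow-up limit of the
  integrands, and with \<open>a\<close> zero and a smaller \<open>c\<close> it is their common
  majorant.\<close>

definition paraboloid_weight :: "'a::euclidean_space \<Rightarrow> real \<Rightarrow> real \<Rightarrow> ('a \<Rightarrow> real) \<Rightarrow> 'a \<Rightarrow> real" where
  "paraboloid_weight i0 R c a w = indicator (paraboloid i0 R) w *
     exp (- (c * (w \<bullet> i0 - (\<Sum>b\<in>Basis - {i0}. a b * (w \<bullet> b)\<^sup>2) / 2)))"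

lemma paraboloid_weight_measurable [measurable]: "paraboloid_weight i0 R c a \<in> borel_measurable borel"
proof -
  have [measurable]: "paraboloid i0 R \<in> sets borel"
    unfolding paraboloid_def by measurable
  show ?thesis unfolding paraboloid_weight_def by measurable
qed

text \<open>The height is integrated out first, which leaves a product of Gaussians.\<close>
lemma nn_integral_paraboloid_weight:
  fixes i0 :: "'a::euclidean_space"
  assumes i0: "i0 \<in> Basis" and R: "R > 0" and c: "c > 0"
    and a: "\<And>b. b \<in> Basis - {i0} \<Longrightarrow> a b < 1 / R"
  shows "(\<integral>\<^sup>+w. ennreal (paraboloid_weight i0 R c a w) \<partial>lborel) =
    ennreal ((1 / c) * (\<Prod>b\<in>Basis - {i0}. sqrt (2 * pi / (c * (1 / R - a b)))))"
proof -
  interpret product_sigma_finite "\<lambda>_::'a. lborel :: real measure" ..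
  let ?B = "Basis - {i0} :: 'a set"
  have B: "finite ?B" "i0 \<notin> ?B" "insert i0 ?B = Basis" using i0 by auto
  let ?W = "\<lambda>f :: 'a \<Rightarrow> real. \<Sum>b\<in>Basis. f b *\<^sub>R b"
  have comp: "?W f \<bullet> b = f b" if "b \<in> Basis" for f b using that by simp
  have meas[measurable]: "?W \<in> measurable (\<Pi>\<^sub>M b\<in>Basis. lborel) borel" by measurable
  have "(\<integral>\<^sup>+w. ennreal (paraboloid_weight i0 R c a w) \<partial>lborel)
     = (\<integral>\<^sup>+f. ennreal (paraboloid_weight i0 R c a (?W f)) \<partial>(\<Pi>\<^sub>M b\<in>insert i0 ?B. lborel))"
    unfolding B(3) by (subst lborel_eq, subst nn_integral_distr) simp_all
  also have "\<dots> = (\<integral>\<^sup>+f. (\<integral>\<^sup>+s. ennreal (paraboloid_weight i0 R c a (?W (f(i0 := s)))) \<partial>lborel) \<partial>(\<Pi>\<^sub>M b\<in>?B. lborel))"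
    by (rule product_nn_integral_insert[OF B(1,2)]) (unfold B(3), measurable)
  also have "\<dots> = (\<integral>\<^sup>+f. ennreal (1 / c) * (\<Prod>b\<in>?B. ennreal (exp (- (c * (1 / R - a b) * (f b)\<^sup>2 / 2)))) \<partial>(\<Pi>\<^sub>M b\<in>?B. lborel))"
  proof (rule nn_integral_cong)
    fix f
    \<comment> \<open>For fixed horizontal coordinates the height runs upwards from
      \<open>?m\<close>, and \<open>?k\<close> is the level of the osculating paraboloid. The
      difference \<open>?m - ?k\<close> is a diagonal quadratic form with coefficients (1/R - a b) /
      2, positive by the curvature condition.\<close>
    let ?m = "(\<Sum>b\<in>?B. (f b)\<^sup>2) / (2 * R)" and ?k = "(\<Sum>b\<in>?B. a b * (f b)\<^sup>2) / 2"
    have "paraboloid_weight i0 R c a (?W (f(i0 := s))) = indicator {?m<..} s * exp (- (c * (s - ?k)))" for s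
    proof -
      have 1: "?W (f(i0 := s)) \<bullet> i0 = s" using comp[OF i0] by simp
      have 2: "?W (f(i0 := s)) \<bullet> b = f b" if "b \<in> ?B" for b using comp[of b "f(i0 := s)"] that by simp
      have "(\<Sum>b\<in>?B. (?W (f(i0 := s)) \<bullet> b)\<^sup>2) = (\<Sum>b\<in>?B. (f b)\<^sup>2)"
        "(\<Sum>b\<in>?B. a b * (?W (f(i0 := s)) \<bullet> b)\<^sup>2) = (\<Sum>b\<in>?B. a b * (f b)\<^sup>2)"
        by (intro sum.cong refl; simp only: 2)+
      thus ?thesis unfolding paraboloid_weight_def paraboloid_def using R 1
        by (simp add: indicator_def divide_less_eq mult.commute)
    qed
    hence "(\<integral>\<^sup>+s. ennreal (paraboloid_weight i0 R c a (?W (f(i0 := s)))) \<partial>lborel) = ennreal (exp (- (c * (?m - ?k))) / c)"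
      using nn_integral_exponential_tail[OF c, of ?m ?k] by simp
    also have "exp (- (c * (?m - ?k))) = (\<Prod>b\<in>?B. exp (- (c * (1 / R - a b) * (f b)\<^sup>2 / 2)))"
    proof -
      have "- (c * (1 / R - a b) * (f b)\<^sup>2 / 2) = (- c / (2 * R)) * (f b)\<^sup>2 + (c / 2) * (a b * (f b)\<^sup>2)" for b
        using R by (simp add: field_simps)
      hence "(\<Sum>b\<in>?B. - (c * (1 / R - a b) * (f b)\<^sup>2 / 2)) = - (c * (?m - ?k))"
        by (simp only: sum.distrib sum_distrib_left[symmetric]) (simp add: algebra_simps)
      thus ?thesis unfolding exp_sum[OF B(1), symmetric] by simp
    qed
    finally show "(\<integral>\<^sup>+s. ennreal (paraboloid_weight i0 R c a (?W (f(i0 := s)))) \<partial>lborel)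
        = ennreal (1 / c) * (\<Prod>b\<in>?B. ennreal (exp (- (c * (1 / R - a b) * (f b)\<^sup>2 / 2))))"
      using c by (simp add: prod_ennreal prod_nonneg ennreal_mult[symmetric])
  qed
  also have "\<dots> = ennreal (1 / c) * (\<integral>\<^sup>+f. (\<Prod>b\<in>?B. ennreal (exp (- (c * (1 / R - a b) * (f b)\<^sup>2 / 2)))) \<partial>(\<Pi>\<^sub>M b\<in>?B. lborel))"
    by (rule nn_integral_cmult) measurable
  also have "(\<integral>\<^sup>+f. (\<Prod>b\<in>?B. ennreal (exp (- (c * (1 / R - a b) * (f b)\<^sup>2 / 2)))) \<partial>(\<Pi>\<^sub>M b\<in>?B. lborel))
      = (\<Prod>b\<in>?B. \<integral>\<^sup>+x. ennreal (exp (- (c * (1 / R - a b) * x\<^sup>2 / 2))) \<partial>lborel)"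
    by (rule product_nn_integral_prod[OF B(1)]) measurable
  also have "\<dots> = (\<Prod>b\<in>?B. ennreal (sqrt (2 * pi / (c * (1 / R - a b)))))"
    by (intro prod.cong refl nn_integral_gaussian) (use c a in auto)
  also have "\<dots> = ennreal (\<Prod>b\<in>?B. sqrt (2 * pi / (c * (1 / R - a b))))"
    by (rule prod_ennreal) (use c less_imp_le[OF a] in \<open>auto intro!: divide_nonneg_nonneg mult_nonneg_nonneg\<close>)
  finally show ?thesis
    using c a by (simp add: ennreal_mult'[symmetric])
qed

lemma paraboloid_weight_integral:
  fixes i0 :: "'a::euclidean_space"
  assumes "i0 \<in> Basis" "R > 0" "c > 0" "\<And>b. b \<in> Basis - {i0} \<Longrightarrow> a b < 1 / R"
  shows "integrable lborel (paraboloid_weight i0 R c a)"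
    and "(\<integral>w. paraboloid_weight i0 R c a w \<partial>lborel) =
       (1 / c) * (\<Prod>b\<in>Basis - {i0}. sqrt (2 * pi / (c * (1 / R - a b))))"
proof -
  have nonneg: "paraboloid_weight i0 R c a w \<ge> 0" for w unfolding paraboloid_weight_def by simp
  have pos: "0 \<le> (1 / c) * (\<Prod>b\<in>Basis - {i0}. sqrt (2 * pi / (c * (1 / R - a b))))"
    using assms(3) less_imp_le[OF assms(4)]
    by (intro mult_nonneg_nonneg prod_nonneg) (auto intro!: divide_nonneg_nonneg mult_nonneg_nonneg)
  note nn = nn_integral_paraboloid_weight[OF assms]
  show "integrable lborel (paraboloid_weight i0 R c a)"
    by (rule integrableI_nonneg) (use nonneg nn in auto)
  show "(\<integral>w. paraboloid_weight i0 R c a w \<partial>lborel) =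
       (1 / c) * (\<Prod>b\<in>Basis - {i0}. sqrt (2 * pi / (c * (1 / R - a b))))"
    by (subst integral_eq_nn_integral) (use nonneg nn pos in auto)
qed

section \<open>Rotation invariance of Lebesgue measure and the change of variables\<close>

text \<open>Testing Haar uniqueness against the unit ball, which is invariant under rotations.\<close>
lemma nn_integral_lborel_orthogonal:
  fixes f :: "'a::euclidean_space \<Rightarrow> ennreal" and Q :: "'a \<Rightarrow> 'a"
  assumes Q: "orthogonal_transformation Q" and f[measurable]: "f \<in> borel_measurable borel"
  shows "(\<integral>\<^sup>+x. f (Q x) \<partial>lborel) = (\<integral>\<^sup>+x. f x \<partial>lborel)"
proof -
  define g :: "'a \<Rightarrow> ennreal" where "g = indicator (cball 0 1)"
  have [measurable]: "g \<in> borel_measurable borel"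
    unfolding g_def by (rule borel_measurable_indicator) (simp add: borel_closed)
  have lin: "linear Q" using Q by (rule orthogonal_transformation_linear)
  have [measurable]: "Q \<in> borel_measurable borel"
    using lin by (intro borel_measurable_continuous_onI linear_continuous_on)
      (simp add: linear_conv_bounded_linear)
  have trans: "(\<integral>\<^sup>+x. h (c + x) \<partial>lborel) = (\<integral>\<^sup>+x. h x \<partial>lborel)"
    if h[measurable]: "h \<in> borel_measurable borel" for h :: "'a \<Rightarrow> ennreal" and c
    by (subst (2) lborel_distr_plus[of c, symmetric], subst nn_integral_distr) simp_all
  have gQ: "g (- Q x) = g x" for x
    using orthogonal_transformation_norm[OF Q, of x] by (simp add: g_def indicator_def)
  let ?V = "\<integral>\<^sup>+x. g x \<partial>lborel"
  have V: "?V \<noteq> 0" "?V \<noteq> \<infinity>"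
  proof -
    have vol: "unit_ball_vol (real DIM('a)) \<noteq> 0"
      using unit_ball_vol_pos[of "real DIM('a)"] by (metis less_irrefl of_nat_0_le_iff)
    have "?V = emeasure lborel (cball (0::'a) 1)" by (simp add: g_def)
    thus "?V \<noteq> 0" "?V \<noteq> \<infinity>" using emeasure_cball[of 1 "0::'a"] vol by auto
  qed
  \<comment> \<open>Both integrals are compared after multiplication by the volume of the unit ball,
    positive and finite and so cancellable. Translating z by - Q x, then x by a preimage of z, then
    z by Q x moves Q from the argument of \<open>f\<close> to that of \<open>g\<close>, where - Q
    acts trivially.\<close>
  have "(\<integral>\<^sup>+x. f (Q x) \<partial>lborel) * ?V = (\<integral>\<^sup>+x. (\<integral>\<^sup>+z. f (Q x) * g z \<partial>lborel) \<partial>lborel)"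
    by (simp add: nn_integral_cmult nn_integral_multc)
  also have "\<dots> = (\<integral>\<^sup>+x. (\<integral>\<^sup>+z. f (Q x) * g (- Q x + z) \<partial>lborel) \<partial>lborel)"
    by (intro nn_integral_cong trans[symmetric]) measurable
  also have "\<dots> = (\<integral>\<^sup>+z. (\<integral>\<^sup>+x. f (Q x) * g (- Q x + z) \<partial>lborel) \<partial>lborel)"
    by (rule lborel_pair.Fubini') measurable
  also have "\<dots> = (\<integral>\<^sup>+z. (\<integral>\<^sup>+x. f (Q x + z) * g (- Q x) \<partial>lborel) \<partial>lborel)"
  proof (rule nn_integral_cong)
    fix z
    obtain c where c: "Q c = z" using orthogonal_transformation_surj[OF Q] by (metis surjD)
    have Qc: "Q (c + x) = Q x + z" for x using linear_add[OF lin, of c x] c by simp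
    have "(\<integral>\<^sup>+x. f (Q x) * g (- Q x + z) \<partial>lborel) = (\<integral>\<^sup>+x. f (Q (c + x)) * g (- Q (c + x) + z) \<partial>lborel)"
      by (rule trans[symmetric]) measurable
    also have "\<dots> = (\<integral>\<^sup>+x. f (Q x + z) * g (- Q x) \<partial>lborel)" unfolding Qc by simp
    finally show "(\<integral>\<^sup>+x. f (Q x) * g (- Q x + z) \<partial>lborel) = (\<integral>\<^sup>+x. f (Q x + z) * g (- Q x) \<partial>lborel)" .
  qed
  also have "\<dots> = (\<integral>\<^sup>+x. (\<integral>\<^sup>+z. f (Q x + z) * g (- Q x) \<partial>lborel) \<partial>lborel)"
    by (rule lborel_pair.Fubini') measurable
  also have "\<dots> = (\<integral>\<^sup>+x. (\<integral>\<^sup>+z. f z \<partial>lborel) * g x \<partial>lborel)"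
  proof (rule nn_integral_cong)
    fix x
    have "(\<integral>\<^sup>+z. f (Q x + z) * g (- Q x) \<partial>lborel) = (\<integral>\<^sup>+z. f z * g (- Q x) \<partial>lborel)"
      by (rule trans[where h="\<lambda>z. f z * g (- Q x)"]) measurable
    thus "(\<integral>\<^sup>+z. f (Q x + z) * g (- Q x) \<partial>lborel) = (\<integral>\<^sup>+z. f z \<partial>lborel) * g x"
      by (simp add: nn_integral_multc gQ)
  qed
  also have "\<dots> = (\<integral>\<^sup>+z. f z \<partial>lborel) * ?V" by (rule nn_integral_cmult) measurable
  finally show ?thesis using V ennreal_mult_cancel_left[of ?V] by (metis infinity_ennreal_def mult.commute)
qed

text \<open>The substitution splits into a translation, an isometry and a diagonal scaling; only the
  last contributes to the Jacobian.\<close>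

lemma lborel_integral_rigid_scaling:
  fixes f :: "'a::euclidean_space \<Rightarrow> real" and Q :: "'a \<Rightarrow> 'a"
  assumes Q: "orthogonal_transformation Q" and f[measurable]: "f \<in> borel_measurable borel"
    and c: "\<And>b. b \<in> Basis \<Longrightarrow> c b > 0"
  shows "(\<integral>z. f z \<partial>lborel) = (\<Prod>b\<in>Basis. c b) * (\<integral>w. f (y + Q (\<Sum>b\<in>Basis. (c b * (w \<bullet> b)) *\<^sub>R b)) \<partial>lborel)"
proof -
  have [measurable]: "Q \<in> borel_measurable borel"
    using Q by (intro borel_measurable_continuous_onI linear_continuous_on)
      (simp add: linear_conv_bounded_linear[symmetric] orthogonal_transformation_linear)
  have "distr lborel borel Q = lborel"
  proof (rule measure_eqI)
    fix A assume "A \<in> sets (distr lborel borel Q)"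
    hence A: "A \<in> sets borel" by simp
    have "emeasure (distr lborel borel Q) A = (\<integral>\<^sup>+x. indicator A x \<partial>distr lborel borel Q)" using A by simp
    also have "\<dots> = (\<integral>\<^sup>+x. indicator A (Q x) \<partial>lborel)" by (rule nn_integral_distr) (use A in measurable)
    also have "\<dots> = (\<integral>\<^sup>+x. indicator A x \<partial>lborel)" by (rule nn_integral_lborel_orthogonal[OF Q]) (use A in measurable)
    finally show "emeasure (distr lborel borel Q) A = emeasure lborel A" using A by simp
  qed simp
  hence "(\<integral>z. f z \<partial>lborel) = (\<integral>z. f z \<partial>distr (distr lborel borel Q) borel ((+) y))"
    by (simp add: lborel_distr_plus)
  also have "\<dots> = (\<integral>x. f (y + Q x) \<partial>lborel)"
    by (subst integral_distr, measurable, subst integral_distr) simp_all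
  also have "\<dots> = (\<integral>x. f (y + Q x) \<partial>density (distr lborel borel (\<lambda>w. 0 + (\<Sum>b\<in>Basis. (c b * (w \<bullet> b)) *\<^sub>R b)))
      (\<lambda>_. (\<Prod>b\<in>Basis. \<bar>c b\<bar>)))"
    by (subst lborel_affine_euclidean[of c 0]) (use c in force)+
  also have "\<dots> = (\<integral>w. (\<Prod>b\<in>Basis. c b) * f (y + Q (\<Sum>b\<in>Basis. (c b * (w \<bullet> b)) *\<^sub>R b)) \<partial>lborel)"
  proof -
    have "(\<Prod>b\<in>Basis. \<bar>c b\<bar>) = (\<Prod>b\<in>Basis. c b)" using c by (intro prod.cong) (auto simp: less_imp_le)
    thus ?thesis
      by (subst integral_density) (use c less_imp_le in \<open>auto intro!: prod_nonneg simp: integral_distr\<close>)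
  qed
  finally show ?thesis by simp
qed

section \<open>Blow-up at the contact point\<close>

context touching_ball
begin

text \<open>One coordinate direction is arbitrarily declared vertical, and \<beta> matches the
  others with the indices of the principal directions; \<open>Q\<close> then carries the standard
  basis to the frame at \<open>y\<close>, so that integrals can be computed coordinatewise.\<close>

definition i0 :: "real^'n" where "i0 = (SOME i. i \<in> Basis)"

definition \<beta> :: "real^'n \<Rightarrow> nat" where
  "\<beta> = (SOME \<beta>. bij_betw \<beta> (Basis - {i0}) {1..<CARD('n)})"

lemma i0: "i0 \<in> Basis"
  unfolding i0_def using nonempty_Basis by (metis ex_in_conv someI_ex)

lemma \<beta>: "bij_betw \<beta> (Basis - {i0}) {1..<CARD('n)}"
proof -
  have "card (Basis - {i0}) = card {1..<CARD('n)}" using i0 by simp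
  hence "\<exists>\<beta>. bij_betw \<beta> (Basis - {i0}) {1..<CARD('n)}" by (intro finite_same_card_bij) auto
  thus ?thesis unfolding \<beta>_def by (rule someI_ex)
qed

lemma \<beta>_in: "b \<in> Basis - {i0} \<Longrightarrow> \<beta> b \<in> {1..<CARD('n)}"
  using \<beta> by (rule bij_betwE[rule_format])

lemma Basis_split: "Basis = insert i0 (Basis - {i0})" and finite_Basis': "finite (Basis - {i0})"
  using i0 by auto

definition Q :: "real^'n \<Rightarrow> real^'n" where
  "Q w = (w \<bullet> i0) *\<^sub>R \<nu> + (\<Sum>b\<in>Basis - {i0}. (w \<bullet> b) *\<^sub>R e (\<beta> b))"

lemma Q_inner:
  shows "Q w \<bullet> \<nu> = w \<bullet> i0" and "b \<in> Basis - {i0} \<Longrightarrow> Q w \<bullet> e (\<beta> b) = w \<bullet> b"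
proof -
  have "(\<Sum>b\<in>Basis - {i0}. (w \<bullet> b) * (e (\<beta> b) \<bullet> \<nu>)) = 0"
    using e\<nu>[OF \<beta>_in] by (intro sum.neutral) auto
  thus "Q w \<bullet> \<nu> = w \<bullet> i0" unfolding Q_def by (simp add: inner_add_left inner_sum_left \<nu>\<nu>)
  assume b: "b \<in> Basis - {i0}"
  have "(\<Sum>a\<in>Basis - {i0}. (w \<bullet> a) * (e (\<beta> a) \<bullet> e (\<beta> b))) = (\<Sum>a\<in>Basis - {i0}. if a = b then w \<bullet> a else 0)"
  proof (intro sum.cong refl)
    fix a assume a: "a \<in> Basis - {i0}"
    have "\<beta> a = \<beta> b \<longleftrightarrow> a = b" using \<beta> a b by (meson bij_betw_def inj_on_eq_iff)
    thus "(w \<bullet> a) * (e (\<beta> a) \<bullet> e (\<beta> b)) = (if a = b then w \<bullet> a else 0)"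
      using ee[OF \<beta>_in[OF a] \<beta>_in[OF b]] by simp
  qed
  also have "\<dots> = w \<bullet> b" using b finite_Basis' by simp
  finally have "(\<Sum>a\<in>Basis - {i0}. (w \<bullet> a) * (e (\<beta> a) \<bullet> e (\<beta> b))) = w \<bullet> b" .
  moreover have "\<nu> \<bullet> e (\<beta> b) = 0" using e\<nu>[OF \<beta>_in[OF b]] by (simp add: inner_commute)
  ultimately show "Q w \<bullet> e (\<beta> b) = w \<bullet> b" unfolding Q_def by (simp add: inner_add_left inner_sum_left)
qed

lemma sum_Q: "(\<Sum>j\<in>{1..<CARD('n)}. F j (Q w \<bullet> e j)) = (\<Sum>b\<in>Basis - {i0}. F (\<beta> b) (w \<bullet> b))"
proof -
  have "(\<Sum>j\<in>{1..<CARD('n)}. F j (Q w \<bullet> e j)) = (\<Sum>b\<in>Basis - {i0}. F (\<beta> b) (Q w \<bullet> e (\<beta> b)))"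
    by (rule sum.reindex_bij_betw[OF \<beta>, symmetric])
  also have "\<dots> = (\<Sum>b\<in>Basis - {i0}. F (\<beta> b) (w \<bullet> b))"
    by (intro sum.cong refl) (simp only: Q_inner)
  finally show ?thesis .
qed

lemma orthogonal_Q: "orthogonal_transformation Q"
proof -
  have "linear Q"
    unfolding Q_def by (intro linearI)
      (simp_all add: inner_add_left sum.distrib scaleR_add_left scaleR_add_right scaleR_sum_right)
  moreover have "norm (Q w) = norm w" for w
  proof -
    have "(norm (Q w))\<^sup>2 = (w \<bullet> i0)\<^sup>2 + (\<Sum>b\<in>Basis - {i0}. (w \<bullet> b)\<^sup>2)"
      unfolding parseval[of "Q w"] sum_Q[where F="\<lambda>_ t. t\<^sup>2"] Q_inner(1) ..
    also have "\<dots> = (\<Sum>b\<in>Basis. (w \<bullet> b)\<^sup>2)"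
      by (subst (2) Basis_split, subst sum.insert) auto
    also have "\<dots> = (norm w)\<^sup>2"
      unfolding power2_norm_eq_inner by (subst euclidean_inner) (simp add: power2_eq_square)
    finally show ?thesis by simp
  qed
  ultimately show ?thesis by (simp add: orthogonal_transformation)
qed

lemma height_Q: "height (Q w) = w \<bullet> i0 - (\<Sum>b\<in>Basis - {i0}. \<kappa> (\<beta> b) * (w \<bullet> b)\<^sup>2) / 2"
  unfolding height_def curvature_form_def sum_Q[where F="\<lambda>j t. \<kappa> j * t\<^sup>2"] Q_inner(1) ..

abbreviation zoom :: "real \<Rightarrow> real^'n \<Rightarrow> real^'n" where
  "zoom \<epsilon> w \<equiv> y + dilation \<epsilon> (Q w)"

lemma dilation_Q_in_ball_iff:
  assumes "\<epsilon> > 0"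
  shows "y + dilation \<epsilon> (Q w) \<in> ball x R \<longleftrightarrow>
    \<epsilon> * (w \<bullet> i0)\<^sup>2 + (\<Sum>b\<in>Basis - {i0}. (w \<bullet> b)\<^sup>2) < 2 * R * (w \<bullet> i0)"
  unfolding dilation_in_ball_iff[OF assms] sum_Q[where F="\<lambda>_ t. t\<^sup>2"] Q_inner(1) ..

definition scale :: "real \<Rightarrow> real^'n \<Rightarrow> real" where
  "scale \<epsilon> b = (if b = i0 then \<epsilon> else sqrt \<epsilon>)"

lemma dilation_Q: "dilation \<epsilon> (Q w) = Q (\<Sum>b\<in>Basis. (scale \<epsilon> b * (w \<bullet> b)) *\<^sub>R b)"
proof -
  let ?v = "\<Sum>b\<in>Basis. (scale \<epsilon> b * (w \<bullet> b)) *\<^sub>R b"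
  have v: "?v \<bullet> b = scale \<epsilon> b * (w \<bullet> b)" if "b \<in> Basis" for b using that by simp
  have "dilation \<epsilon> (Q w) = (\<epsilon> * (w \<bullet> i0)) *\<^sub>R \<nu> + (\<Sum>b\<in>Basis - {i0}. (sqrt \<epsilon> * (w \<bullet> b)) *\<^sub>R e (\<beta> b))"
    unfolding dilation_def Q_inner(1) sum.reindex_bij_betw[OF \<beta>, symmetric]
    by (intro arg_cong2[where f="(+)"] sum.cong refl) (simp only: Q_inner)
  also have "\<dots> = Q ?v"
    unfolding Q_def v[OF i0]
    by (intro arg_cong2[where f="(+)"] sum.cong refl) (auto simp: v scale_def)
  finally show ?thesis .
qed

text \<open>One normal factor \<epsilon> and N - 1 tangential factors sqrt \<epsilon>: this is where
  the exponent (N + 1) / 2 originates.\<close>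

lemma prod_scale:
  assumes "\<epsilon> > 0"
  shows "(\<Prod>b\<in>Basis. scale \<epsilon> b) = \<epsilon> powr ((real CARD('n) + 1) / 2)"
proof -
  have "(\<Prod>b\<in>Basis. scale \<epsilon> b) = \<epsilon> * (\<Prod>b\<in>Basis - {i0}. sqrt \<epsilon>)"
    by (subst Basis_split, subst prod.insert) (auto simp: scale_def)
  also have "\<dots> = \<epsilon> * sqrt \<epsilon> ^ (CARD('n) - 1)" using i0 by simp
  also have "\<dots> = \<epsilon> powr 1 * (\<epsilon> powr (1/2)) powr real (CARD('n) - 1)"
    using assms by (subst powr_realpow) (simp_all add: powr_half_sqrt)
  also have "\<dots> = \<epsilon> powr (1 + 1/2 * real (CARD('n) - 1))" by (simp only: powr_powr powr_add)
  also have "1 + 1/2 * real (CARD('n) - 1) = (real CARD('n) + 1) / 2"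
    by (simp add: of_nat_diff Suc_leI field_simps)
  finally show ?thesis .
qed

lemma integral_dilation:
  fixes f :: "real^'n \<Rightarrow> real"
  assumes "f \<in> borel_measurable borel" "\<epsilon> > 0"
  shows "\<epsilon> powr (- ((real CARD('n) + 1) / 2)) * (\<integral>z. f z \<partial>lborel) = (\<integral>w. f (y + dilation \<epsilon> (Q w)) \<partial>lborel)"
proof -
  have "(\<integral>z. f z \<partial>lborel) = (\<Prod>b\<in>Basis. scale \<epsilon> b) * (\<integral>w. f (y + dilation \<epsilon> (Q w)) \<partial>lborel)"
    unfolding dilation_Q
    by (rule lborel_integral_rigid_scaling[OF orthogonal_Q assms(1)]) (use assms(2) in \<open>simp add: scale_def\<close>)
  thus ?thesis unfolding prod_scale[OF assms(2)] using assms(2) by (simp add: powr_minus)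
qed

end

text \<open>The equation is left behind here: continuity, the bounds 0 and 1 and the two-sided decay
  with rate \<open>d\<close>, later sqrt p', are all that is kept of the solutions.\<close>

locale decaying_family = touching_ball \<Omega> x y \<nu> R \<gamma> \<kappa> e
  for \<Omega> :: "(real^'n) set" and x y \<nu> R \<gamma> \<kappa> e +
  fixes u :: "real \<Rightarrow> real^'n \<Rightarrow> real" and d ri :: real
  assumes d: "d > 0" and ri: "ri > 0"
    and u_cont: "\<And>\<epsilon>. \<epsilon> > 0 \<Longrightarrow> continuous_on (ball x R) (u \<epsilon>)"
    and u01: "\<And>\<epsilon> z. \<epsilon> > 0 \<Longrightarrow> z \<in> \<Omega> \<Longrightarrow> 0 \<le> u \<epsilon> z \<and> u \<epsilon> z \<le> 1"
    and decay: "\<And>\<eta>. 0 < \<eta> \<Longrightarrow> \<eta> < 1 \<Longrightarrow> \<exists>\<epsilon>0>0. \<forall>\<epsilon> z. 0 < \<epsilon> \<longrightarrow> \<epsilon> < \<epsilon>0 \<longrightarrow> z \<in> \<Omega> \<longrightarrow>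
     decay_bounds \<Omega> u d ri \<eta> \<epsilon> z"
begin

abbreviation blowup_weight :: "real \<Rightarrow> real^'n \<Rightarrow> real" where
  "blowup_weight r \<equiv> paraboloid_weight i0 R (r * d) (\<lambda>b. \<kappa> (\<beta> b))"

abbreviation upper_part :: "real \<Rightarrow> real \<Rightarrow> real \<Rightarrow> real" where
  "upper_part r \<epsilon> l \<equiv> \<integral>z. indicator (ball x R) z * (max 0 (u \<epsilon> z - l)) powr r \<partial>lborel"

text \<open>Normalized by \<open>l\<close>, so that the integrand lies between 0 and 1 and the
  integral has a nontrivial limit; the factor \<open>l powr r\<close> is restored in the
  moment.\<close>

abbreviation lower_part :: "real \<Rightarrow> real \<Rightarrow> real \<Rightarrow> real" where
  "lower_part r \<epsilon> l \<equiv> \<integral>z. indicator (ball x R) z * (max 0 (1 - u \<epsilon> z / l)) powr r \<partial>lborel"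

lemma decay_eventually:
  assumes \<epsilon>: "\<And>k. \<epsilon> k > 0" "\<epsilon> \<longlonglongrightarrow> 0" and \<eta>: "0 < \<eta>" "\<eta> < 1"
  shows "\<forall>\<^sub>F k in sequentially. \<forall>z\<in>\<Omega>.
     decay_bounds \<Omega> u d ri \<eta> (\<epsilon> k) z"
proof -
  obtain \<epsilon>0 where \<epsilon>0: "\<epsilon>0 > 0" "\<And>\<epsilon> z. 0 < \<epsilon> \<Longrightarrow> \<epsilon> < \<epsilon>0 \<Longrightarrow> z \<in> \<Omega> \<Longrightarrow>
     decay_bounds \<Omega> u d ri \<eta> \<epsilon> z"
    using decay[OF \<eta>] by blast
  have "\<forall>\<^sub>F k in sequentially. \<epsilon> k < \<epsilon>0" using \<epsilon>(2) \<epsilon>0(1) by (rule order_tendstoD)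
  thus ?thesis by eventually_elim (use \<epsilon>0(2) \<epsilon>(1) in blast)
qed

text \<open>A crude rate, sufficient wherever only a majorant or pointwise smallness is
  required.\<close>

lemma decay_half:
  assumes "\<And>k. \<epsilon> k > 0" "\<epsilon> \<longlonglongrightarrow> 0"
  shows "\<forall>\<^sub>F k in sequentially. \<forall>z\<in>\<Omega>. u (\<epsilon> k) z \<le> exp (- (d / 2 * min (bdist \<Omega> z) ri / \<epsilon> k))"
proof -
  have "\<forall>\<^sub>F k in sequentially. \<forall>z\<in>\<Omega>.
     decay_bounds \<Omega> u d ri (1 / 2) (\<epsilon> k) z"
    by (rule decay_eventually[OF assms]) auto
  thus ?thesis by (rule eventually_mono) auto
qed

text \<open>For each \<eta> the quantity - ln u / d eventually lies within a relative error \<eta>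
  of the scaled distance, which converges and is therefore bounded. The truncation at
  \<open>ri\<close> is inactive because the points approach \<Gamma>.\<close>

lemma u_at_dilation_tendsto:
  assumes \<epsilon>: "\<And>k. \<epsilon> k > 0" "\<epsilon> \<longlonglongrightarrow> 0"
    and in\<Omega>: "\<forall>\<^sub>F k in sequentially. y + dilation (\<epsilon> k) h \<in> \<Omega>"
  shows "(\<lambda>k. u (\<epsilon> k) (y + dilation (\<epsilon> k) h)) \<longlonglongrightarrow> exp (- (d * height h))"
proof -
  let ?z = "\<lambda>k. y + dilation (\<epsilon> k) h"
  let ?D = "\<lambda>k. bdist \<Omega> (?z k) / \<epsilon> k"
  define L where "L k = - ln (u (\<epsilon> k) (?z k)) / d" for k
  have D: "?D \<longlonglongrightarrow> height h" by (rule bdist_dilation_tendsto[OF assms])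
  have "(\<lambda>k. norm (dilation (\<epsilon> k) h)) \<longlonglongrightarrow> 0"
    using tendsto_dilation[OF \<epsilon>(2)] tendsto_norm_zero by blast
  hence small: "\<forall>\<^sub>F k in sequentially. norm (dilation (\<epsilon> k) h) < ri" using ri by (rule order_tendstoD)
  have main: "\<forall>\<^sub>F k in sequentially. u (\<epsilon> k) (?z k) = exp (- (d * L k)) \<and> \<bar>L k - ?D k\<bar> \<le> \<eta> * ?D k"
    if \<eta>: "0 < \<eta>" "\<eta> < 1" for \<eta>
    using decay_eventually[OF \<epsilon> \<eta>] in\<Omega> small
  proof eventually_elim
    case (elim k)
    have "bdist \<Omega> (?z k) < ri" using bdist_le_dist[of "?z k"] elim(3) by simp
    hence up: "u (\<epsilon> k) (?z k) \<le> exp (- ((1 - \<eta>) * d * ?D k))"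
      and low: "u (\<epsilon> k) (?z k) \<ge> exp (- ((1 + \<eta>) * d * ?D k))"
      using elim(1,2) by auto
    have pos: "u (\<epsilon> k) (?z k) > 0" by (rule less_le_trans[OF exp_gt_zero low])
    have "ln (u (\<epsilon> k) (?z k)) \<le> - ((1 - \<eta>) * d * ?D k)" using up pos by (metis ln_exp ln_mono)
    moreover have "- ((1 + \<eta>) * d * ?D k) \<le> ln (u (\<epsilon> k) (?z k))"
      using low pos by (metis exp_gt_zero ln_exp ln_mono)
    moreover have dL: "d * L k = - ln (u (\<epsilon> k) (?z k))" using d by (simp add: L_def)
    ultimately have "d * ((1 - \<eta>) * ?D k) \<le> d * L k" "d * L k \<le> d * ((1 + \<eta>) * ?D k)"
      by (simp_all add: mult_ac)
    hence "(1 - \<eta>) * ?D k \<le> L k" "L k \<le> (1 + \<eta>) * ?D k"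
      using d by (simp_all only: mult_le_cancel_left_pos)
    moreover have "(1 - \<eta>) * D \<le> l \<Longrightarrow> l \<le> (1 + \<eta>) * D \<Longrightarrow> \<bar>l - D\<bar> \<le> \<eta> * D" for D l :: real
      by (auto simp: abs_le_iff algebra_simps)
    ultimately have "\<bar>L k - ?D k\<bar> \<le> \<eta> * ?D k" by blast
    thus ?case using dL pos by simp
  qed
  have "(\<lambda>k. L k - ?D k) \<longlonglongrightarrow> 0"
  proof (rule tendstoI)
    fix r :: real assume r: "r > 0"
    define \<eta> where "\<eta> = min (1/2) (r / (\<bar>height h\<bar> + 1) / 2)"
    have \<eta>: "0 < \<eta>" "\<eta> < 1" using r by (auto simp: \<eta>_def intro!: divide_pos_pos)
    have "\<eta> * (\<bar>height h\<bar> + 1) \<le> r / (\<bar>height h\<bar> + 1) / 2 * (\<bar>height h\<bar> + 1)"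
      unfolding \<eta>_def by (intro mult_right_mono) auto
    also have "\<dots> = r / 2" by (simp add: field_simps)
    finally have \<eta>r: "\<eta> * (\<bar>height h\<bar> + 1) < r" using r by simp
    have "\<forall>\<^sub>F k in sequentially. dist (?D k) (height h) < 1" by (rule tendstoD[OF D]) simp
    with main[OF \<eta>] show "\<forall>\<^sub>F k in sequentially. dist (L k - ?D k) 0 < r"
    proof eventually_elim
      case (elim k)
      have "\<eta> * ?D k \<le> \<eta> * (\<bar>height h\<bar> + 1)"
        using elim(2) \<eta> by (intro mult_left_mono) (auto simp: dist_real_def)
      thus ?case using elim(1) \<eta>r by (simp add: dist_real_def)
    qed
  qed
  hence "(\<lambda>k. (L k - ?D k) + ?D k) \<longlonglongrightarrow> 0 + height h" using D by (rule tendsto_add)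
  hence "L \<longlonglongrightarrow> height h" by simp
  hence "(\<lambda>k. exp (- (d * L k))) \<longlonglongrightarrow> exp (- (d * height h))" by (intro tendsto_intros)
  moreover have "\<forall>\<^sub>F k in sequentially. exp (- (d * L k)) = u (\<epsilon> k) (?z k)"
    using main[of "1/2"] by (auto elim: eventually_mono)
  ultimately show ?thesis by (rule Lim_transform_eventually)
qed

lemma u_indicator_measurable: "\<epsilon> > 0 \<Longrightarrow> (\<lambda>z. indicator (ball x R) z * u \<epsilon> z) \<in> borel_measurable borel"
  using borel_measurable_continuous_on_indicator[OF _ u_cont] by simp

text \<open>Continuity of \<open>u \<epsilon>\<close> is known only on the ball, so inside
  \<open>F\<close> it is replaced by its extension by zero, which is Borel.\<close>

lemma comp_u_measurable:
  assumes "\<epsilon> > 0" and F[measurable]: "F \<in> borel_measurable borel"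
  shows "(\<lambda>z. indicator (ball x R) z * (F (u \<epsilon> z) :: real)) \<in> borel_measurable borel"
proof -
  note [measurable] = u_indicator_measurable[OF assms(1)]
  have [measurable]: "ball x R \<in> sets borel" by (simp add: borel_open)
  have "(\<lambda>z. indicator (ball x R) z * F (indicator (ball x R) z * u \<epsilon> z)) \<in> borel_measurable borel"
    by measurable
  moreover have "(\<lambda>z. indicator (ball x R) z * F (indicator (ball x R) z * u \<epsilon> z)) = (\<lambda>z. indicator (ball x R) z * F (u \<epsilon> z))"
    by (auto simp: indicator_def)
  ultimately show ?thesis by simp
qed

text \<open>Blow-up at the contact point: the rescaled ball fills a paraboloid and the rescaled solution
  becomes an exponential of the height over the osculating paraboloid of the boundary.\<close>
lemma positive_part_tendsto:
  assumes \<epsilon>: "\<And>k. \<epsilon> k > 0" "\<epsilon> \<longlonglongrightarrow> 0" and l: "\<And>k. l k \<ge> 0" "l \<longlonglongrightarrow> 0" and r: "r > 0"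
  shows "(\<lambda>k. \<epsilon> k powr (- ((real CARD('n) + 1) / 2)) *
      upper_part r (\<epsilon> k) (l k))
    \<longlonglongrightarrow> (\<integral>w. blowup_weight r w \<partial>lborel)"
proof -
  define f where "f k w = indicator (ball x R) (zoom (\<epsilon> k) w) *
     (max 0 (u (\<epsilon> k) (zoom (\<epsilon> k) w) - l k)) powr r" for k w
  have meas: "(\<lambda>z. indicator (ball x R) z * (max 0 (u (\<epsilon> k) z - l k)) powr r) \<in> borel_measurable borel" for k
    by (rule comp_u_measurable[OF \<epsilon>(1), where F="\<lambda>v. (max 0 (v - l k)) powr r"]) measurable
  have eq: "\<epsilon> k powr (- ((real CARD('n) + 1) / 2)) *
      upper_part r (\<epsilon> k) (l k) = (\<integral>w. f k w \<partial>lborel)" for k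
    unfolding f_def by (rule integral_dilation[OF meas \<epsilon>(1)])
  have Q_meas[measurable]: "(\<lambda>w. zoom (\<epsilon> k) w) \<in> borel_measurable borel" for k
    unfolding dilation_def Q_def by measurable
  have f_meas: "f k \<in> borel_measurable lborel" for k
    using measurable_compose[OF Q_meas meas, of k k] unfolding f_def by simp
  obtain c where c: "c > 0" "\<And>w. w \<in> ball x R \<Longrightarrow> min (bdist \<Omega> w) ri \<ge> c * ((w - y) \<bullet> \<nu>)"
    using bdist_lower_on_ball[OF ri] by blast
  \<comment> \<open>The crude rate d/2, times the constant \<open>c\<close> by which the height
    bounds the distance from below, raised to the power r.\<close>
  define c' where "c' = r * (d * c / 2)"
  have c': "c' > 0" using r d c by (simp add: c'_def)
  \<comment> \<open>Every rescaled ball lies inside the limit paraboloid, so one majorant supported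
    there serves all k.\<close>
  have par: "w \<in> paraboloid i0 R" if "zoom (\<epsilon> k) w \<in> ball x R" for w k
  proof -
    have "0 \<le> \<epsilon> k * (w \<bullet> i0)\<^sup>2" using \<epsilon>(1)[of k] by simp
    thus ?thesis using that unfolding dilation_Q_in_ball_iff[OF \<epsilon>(1)] paraboloid_def by simp
  qed
  have dom: "\<forall>\<^sub>F k in sequentially. \<forall>w. norm (f k w) \<le> paraboloid_weight i0 R c' (\<lambda>_. 0) w"
    using decay_half[OF \<epsilon>]
  proof eventually_elim
    case (elim k)
    show ?case
    proof
      fix w
      let ?z = "zoom (\<epsilon> k) w"
      show "norm (f k w) \<le> paraboloid_weight i0 R c' (\<lambda>_. 0) w"
      proof (cases "?z \<in> ball x R")
        case True
        have "w \<bullet> i0 = ((?z - y) \<bullet> \<nu>) / \<epsilon> k" using \<epsilon>(1)[of k] by (simp add: dilation_inner Q_inner)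
        moreover have "c * ((?z - y) \<bullet> \<nu>) / \<epsilon> k \<le> min (bdist \<Omega> ?z) ri / \<epsilon> k"
          using c(2)[OF True] \<epsilon>(1)[of k] by (intro divide_right_mono) auto
        ultimately have "c * (w \<bullet> i0) \<le> min (bdist \<Omega> ?z) ri / \<epsilon> k" by simp
        hence "d / 2 * (c * (w \<bullet> i0)) \<le> d / 2 * (min (bdist \<Omega> ?z) ri / \<epsilon> k)" using d by (intro mult_left_mono) auto
        hence "exp (- (d / 2 * min (bdist \<Omega> ?z) ri / \<epsilon> k)) \<le> exp (- (d * c / 2 * (w \<bullet> i0)))"
          by (simp add: mult_ac)
        moreover have "u (\<epsilon> k) ?z \<le> exp (- (d / 2 * min (bdist \<Omega> ?z) ri / \<epsilon> k))"
          using elim True ball by blast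
        ultimately have "u (\<epsilon> k) ?z \<le> exp (- (d * c / 2 * (w \<bullet> i0)))" by (rule order_trans[rotated])
        hence "max 0 (u (\<epsilon> k) ?z - l k) \<le> exp (- (d * c / 2 * (w \<bullet> i0)))" using l(1)[of k] exp_ge_zero[of "- (d * c / 2 * (w \<bullet> i0))"] by linarith
        hence "(max 0 (u (\<epsilon> k) ?z - l k)) powr r \<le> exp (- (d * c / 2 * (w \<bullet> i0))) powr r"
          using r by (intro powr_mono2) auto
        also have "\<dots> = exp (- (c' * (w \<bullet> i0)))" by (simp add: powr_def c'_def mult_ac)
        finally show ?thesis using True par[OF True]
          by (simp add: f_def paraboloid_weight_def)
      qed (simp add: f_def paraboloid_weight_def)
    qed
  qed
  have lim: "(\<lambda>k. f k w) \<longlonglongrightarrow> blowup_weight r w" for w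
  proof (cases "w \<in> paraboloid i0 R")
    case True
    let ?z = "\<lambda>k. zoom (\<epsilon> k) w"
    have "(\<lambda>k. \<epsilon> k * (w \<bullet> i0)\<^sup>2 + (\<Sum>b\<in>Basis - {i0}. (w \<bullet> b)\<^sup>2)) \<longlonglongrightarrow> 0 * (w \<bullet> i0)\<^sup>2 + (\<Sum>b\<in>Basis - {i0}. (w \<bullet> b)\<^sup>2)"
      by (intro tendsto_intros \<epsilon>)
    hence "\<forall>\<^sub>F k in sequentially. \<epsilon> k * (w \<bullet> i0)\<^sup>2 + (\<Sum>b\<in>Basis - {i0}. (w \<bullet> b)\<^sup>2) < 2 * R * (w \<bullet> i0)"
      by (rule order_tendstoD) (use True in \<open>simp add: paraboloid_def\<close>)
    hence in_ball: "\<forall>\<^sub>F k in sequentially. ?z k \<in> ball x R"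
      by (simp add: dilation_Q_in_ball_iff \<epsilon>(1) del: mem_ball)
    hence "\<forall>\<^sub>F k in sequentially. ?z k \<in> \<Omega>" by eventually_elim (use ball in blast)
    hence "(\<lambda>k. u (\<epsilon> k) (?z k)) \<longlonglongrightarrow> exp (- (d * height (Q w)))" by (rule u_at_dilation_tendsto[OF \<epsilon>])
    hence "(\<lambda>k. (max 0 (u (\<epsilon> k) (?z k) - l k)) powr r) \<longlonglongrightarrow> (max 0 (exp (- (d * height (Q w))) - 0)) powr r"
      using l(2) by (intro tendsto_powr tendsto_max tendsto_diff tendsto_const) (auto simp: max_def)
    also have "(max 0 (exp (- (d * height (Q w))) - 0)) powr r = blowup_weight r w"
      using True by (simp add: paraboloid_weight_def powr_def height_Q max_def mult_ac)
    finally show ?thesis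
      by (rule Lim_transform_eventually) (use in_ball in eventually_elim, simp add: f_def)
  next
    case False
    hence out: "zoom (\<epsilon> k) w \<notin> ball x R" for k using par[of k w] by blast
    have "f k w = 0" for k unfolding f_def indicator_simps(2)[OF out] by simp
    thus ?thesis using False by (simp add: paraboloid_weight_def)
  qed
  \<comment> \<open>The majorant is valid only from some index on, hence the shift by K before
    dominated convergence.\<close>
  obtain K where K: "\<And>k w. k \<ge> K \<Longrightarrow> norm (f k w) \<le> paraboloid_weight i0 R c' (\<lambda>_. 0) w"
    using dom unfolding eventually_sequentially by blast
  have "(\<lambda>k. \<integral>w. f (k + K) w \<partial>lborel) \<longlonglongrightarrow> (\<integral>w. blowup_weight r w \<partial>lborel)"
  proof (rule integral_dominated_convergence)
    show "integrable lborel (paraboloid_weight i0 R c' (\<lambda>_. 0))"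
      by (rule paraboloid_weight_integral[OF i0 R c']) (use R in simp)
    show "AE w in lborel. (\<lambda>k. f (k + K) w) \<longlonglongrightarrow> blowup_weight r w"
      using lim LIMSEQ_ignore_initial_segment by blast
    show "AE w in lborel. norm (f (k + K) w) \<le> paraboloid_weight i0 R c' (\<lambda>_. 0) w" for k
      using K[of "k + K"] by simp
  qed (use f_meas in auto)
  thus ?thesis unfolding eq by (rule LIMSEQ_offset)
qed

text \<open>A fixed point of the ball has positive distance to \<Gamma>, so \<open>u\<close> is
  exponentially small there; \<open>fast\<close> says that \<open>l\<close> decays more slowly than
  any such exponential.\<close>

lemma negative_part_tendsto:
  assumes \<epsilon>: "\<And>k. \<epsilon> k > 0" "\<epsilon> \<longlonglongrightarrow> 0" and l: "\<And>k. l k > 0" and r: "r > 0"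
    and fast: "\<And>a. a > 0 \<Longrightarrow> (\<lambda>k. exp (- (a / \<epsilon> k)) / l k) \<longlonglongrightarrow> 0"
  shows "(\<lambda>k. lower_part r (\<epsilon> k) (l k))
    \<longlonglongrightarrow> measure lborel (ball x R)"
proof -
  have "(\<lambda>k. lower_part r (\<epsilon> k) (l k))
    \<longlonglongrightarrow> (\<integral>z. indicator (ball x R) z \<partial>lborel)"
  proof (rule integral_dominated_convergence)
    show "(\<lambda>z. indicator (ball x R) z * (max 0 (1 - u (\<epsilon> k) z / l k)) powr r) \<in> borel_measurable lborel" for k
      using comp_u_measurable[OF \<epsilon>(1), where F="\<lambda>v. (max 0 (1 - v / l k)) powr r"] by simp
    show int: "integrable lborel (indicator (ball x R) :: _ \<Rightarrow> real)"
      by (rule integrable_real_indicator) (use emeasure_bounded_finite[OF bounded_ball] in auto)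
    thus "(indicator (ball x R) :: _ \<Rightarrow> real) \<in> borel_measurable lborel" by simp
    show "AE z in lborel. norm (indicator (ball x R) z * (max 0 (1 - u (\<epsilon> k) z / l k)) powr r)
        \<le> indicator (ball x R) z" for k
    proof (rule AE_I2)
      fix z
      show "norm (indicator (ball x R) z * (max 0 (1 - u (\<epsilon> k) z / l k)) powr r) \<le> indicator (ball x R) z"
      proof (cases "z \<in> ball x R")
        case True
        hence "u (\<epsilon> k) z / l k \<ge> 0" using u01[OF \<epsilon>(1), of z k] ball l[of k] by auto
        hence "(max 0 (1 - u (\<epsilon> k) z / l k)) powr r \<le> 1 powr r" using r by (intro powr_mono2) auto
        thus ?thesis using True by simp
      qed simp
    qed
    have "(\<lambda>k. indicator (ball x R) z * (max 0 (1 - u (\<epsilon> k) z / l k)) powr r) \<longlonglongrightarrow> indicator (ball x R) z" for z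
    proof (cases "z \<in> ball x R")
      case True
      hence z: "z \<in> \<Omega>" using ball by blast
      define a where "a = d / 2 * min (bdist \<Omega> z) ri"
      have a: "a > 0" using d ri bdist_pos[OF z] by (simp add: a_def)
      have "(\<lambda>k. u (\<epsilon> k) z / l k) \<longlonglongrightarrow> 0"
      proof (rule tendsto_sandwich[OF _ _ tendsto_const fast[OF a]])
        show "\<forall>\<^sub>F k in sequentially. 0 \<le> u (\<epsilon> k) z / l k"
          using u01[OF \<epsilon>(1) z] l less_imp_le by (intro always_eventually) (auto intro!: divide_nonneg_nonneg)
        show "\<forall>\<^sub>F k in sequentially. u (\<epsilon> k) z / l k \<le> exp (- (a / \<epsilon> k)) / l k"
          using decay_half[OF \<epsilon>]
        proof eventually_elim
          case (elim k)
          have "u (\<epsilon> k) z \<le> exp (- (a / \<epsilon> k))" using elim z by (simp add: a_def)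
          thus ?case using l[of k] by (intro divide_right_mono) auto
        qed
      qed
      hence "(\<lambda>k. (max 0 (1 - u (\<epsilon> k) z / l k)) powr r) \<longlonglongrightarrow> (max 0 (1 - 0)) powr r"
        by (intro tendsto_powr tendsto_max tendsto_diff tendsto_const) auto
      thus ?thesis using True by simp
    qed simp
    thus "AE z in lborel. (\<lambda>k. indicator (ball x R) z * (max 0 (1 - u (\<epsilon> k) z / l k)) powr r) \<longlonglongrightarrow> indicator (ball x R) z"
      by simp
  qed
  thus ?thesis by simp
qed

end

section \<open>The q-mean as the zero of a monotone moment\<close>

text \<open>The odd function sign(t) |t|^r, which for r = q - 1 is the derivative of |t|^q up to the
  factor q.\<close>

definition signed_power :: "real \<Rightarrow> real \<Rightarrow> real" where
  "signed_power r t = (max 0 t) powr r - (max 0 (- t)) powr r"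

lemma signed_power_strict_mono:
  assumes "r > 0" "s < t"
  shows "signed_power r s < signed_power r t"
proof -
  have le: "(max 0 s) powr r \<le> (max 0 t) powr r" "(max 0 (- t)) powr r \<le> (max 0 (- s)) powr r"
    using assms by (auto intro!: powr_mono2)
  show ?thesis
  proof (cases "t > 0")
    case True
    hence "(max 0 s) powr r < (max 0 t) powr r" using assms by (intro powr_less_mono2) auto
    thus ?thesis using le unfolding signed_power_def by linarith
  next
    case False
    hence "(max 0 (- t)) powr r < (max 0 (- s)) powr r" using assms by (intro powr_less_mono2) auto
    thus ?thesis using le unfolding signed_power_def by linarith
  qed
qed

lemma signed_power_mono: "r > 0 \<Longrightarrow> s \<le> t \<Longrightarrow> signed_power r s \<le> signed_power r t"
  using signed_power_strict_mono[of r s t] by (cases "s = t") auto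

lemma signed_power_bound: "r > 0 \<Longrightarrow> \<bar>t\<bar> \<le> B \<Longrightarrow> \<bar>signed_power r t\<bar> \<le> B powr r"
proof -
  assume r: "r > 0" and t: "\<bar>t\<bar> \<le> B"
  have "(max 0 t) powr r \<le> B powr r" "(max 0 (-t)) powr r \<le> B powr r"
    using r t by (auto intro!: powr_mono2)
  moreover have "(max 0 t) powr r \<ge> 0" "(max 0 (-t)) powr r \<ge> 0" by auto
  ultimately show ?thesis unfolding signed_power_def by linarith
qed

lemma continuous_signed_power: "r > 0 \<Longrightarrow> continuous_on UNIV (signed_power r)"
  unfolding signed_power_def by (intro continuous_on_diff continuous_on_powr' continuous_intros) auto

lemma DERIV_abs_powr:
  fixes q t :: real
  assumes q: "q > 1"
  shows "((\<lambda>t. \<bar>t\<bar> powr q) has_real_derivative q * signed_power (q - 1) t) (at t)"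
proof -
  consider "t > 0" | "t < 0" | "t = 0" by linarith
  thus ?thesis
  proof cases
    case 1
    have "((\<lambda>t. t powr q) has_real_derivative q * signed_power (q - 1) t) (at t)"
      using 1 by (auto intro!: derivative_eq_intros simp: signed_power_def powr_diff)
    moreover have "\<forall>\<^sub>F s in nhds t. s powr q = \<bar>s\<bar> powr q"
      using eventually_nhds_in_open[of "{0<..}" t] 1 by (auto elim!: eventually_mono)
    ultimately show ?thesis by (subst (asm) DERIV_cong_ev) auto
  next
    case 2
    have "((\<lambda>t. (- t) powr q) has_real_derivative q * signed_power (q - 1) t) (at t)"
      using 2 by (auto intro!: derivative_eq_intros simp: signed_power_def powr_diff)
    moreover have "\<forall>\<^sub>F s in nhds t. (- s) powr q = \<bar>s\<bar> powr q"
      using eventually_nhds_in_open[of "{..<0}" t] 2 by (auto elim!: eventually_mono)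
    ultimately show ?thesis by (subst (asm) DERIV_cong_ev) auto
  next
    case 3
    \<comment> \<open>At 0 the difference quotient is bounded by |h|^(q - 1), which tends to 0 since
      q > 1.\<close>
    have "((\<lambda>h::real. \<bar>h\<bar> powr (q - 1)) \<longlongrightarrow> \<bar>0\<bar> powr (q - 1)) (at 0)"
      using q by (intro tendsto_powr' tendsto_intros) auto
    hence "((\<lambda>h::real. \<bar>h\<bar> powr (q - 1)) \<longlongrightarrow> 0) (at 0)" by simp
    hence "((\<lambda>h::real. \<bar>h\<bar> powr q / h) \<longlongrightarrow> 0) (at 0)"
    proof (rule Lim_null_comparison[rotated])
      have "norm (\<bar>h\<bar> powr q / h) \<le> \<bar>h\<bar> powr (q - 1)" for h :: real
        by (cases "h = 0") (auto simp: powr_diff abs_mult)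
      thus "\<forall>\<^sub>F h::real in at 0. norm (\<bar>h\<bar> powr q / h) \<le> \<bar>h\<bar> powr (q - 1)" by simp
    qed
    thus ?thesis using 3 by (simp add: DERIV_def signed_power_def)
  qed
qed

text \<open>Strict convexity of |t|^q: by the mean value theorem the increment equals the derivative
  at an intermediate point, and the derivative is strictly increasing.\<close>

lemma abs_powr_above_tangent:
  fixes a b q :: real
  assumes q: "q > 1" and ne: "a \<noteq> b"
  shows "\<bar>a\<bar> powr q > \<bar>b\<bar> powr q + q * signed_power (q - 1) b * (a - b)"
proof (cases "a > b")
  case True
  have "\<exists>z>b. z < a \<and> \<bar>a\<bar> powr q - \<bar>b\<bar> powr q = (a - b) * (q * signed_power (q - 1) z)"
    using True by (rule MVT2) (rule DERIV_abs_powr[OF q])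
  then obtain z where z: "z > b" "\<bar>a\<bar> powr q - \<bar>b\<bar> powr q = (a - b) * (q * signed_power (q - 1) z)" by blast
  have "(a - b) * (q * signed_power (q - 1) z) > (a - b) * (q * signed_power (q - 1) b)"
    using True q z(1) by (intro mult_strict_left_mono signed_power_strict_mono) auto
  thus ?thesis using z(2) by (simp add: mult_ac)
next
  case False
  hence lt: "a < b" using ne by simp
  have "\<exists>z>a. z < b \<and> \<bar>b\<bar> powr q - \<bar>a\<bar> powr q = (b - a) * (q * signed_power (q - 1) z)"
    using lt by (rule MVT2) (rule DERIV_abs_powr[OF q])
  then obtain z where z: "z < b" "\<bar>b\<bar> powr q - \<bar>a\<bar> powr q = (b - a) * (q * signed_power (q - 1) z)" by blast
  have "(b - a) * (q * signed_power (q - 1) z) < (b - a) * (q * signed_power (q - 1) b)"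
    using lt q z(1) by (intro mult_strict_left_mono signed_power_strict_mono) auto
  hence "\<bar>b\<bar> powr q - \<bar>a\<bar> powr q < - (q * signed_power (q - 1) b * (a - b))" using z(2) by (simp add: algebra_simps)
  thus ?thesis by linarith
qed

context
  fixes M :: "'a measure" and v :: "'a \<Rightarrow> real" and q :: real
  assumes M: "finite_measure M" "emeasure M (space M) \<noteq> 0"
    and v[measurable]: "v \<in> borel_measurable M" and v01: "\<And>z. z \<in> space M \<Longrightarrow> 0 \<le> v z \<and> v z \<le> 1"
    and q: "q > 1"
begin

interpretation finite_measure M by (rule M)

text \<open>Formally - 1/q times the derivative in \<open>l\<close> of the integral of |v - l|^q, so
  that its zero is the critical point of a strictly convex function.\<close>

definition moment :: "real \<Rightarrow> real" where
  "moment l = (\<integral>z. signed_power (q - 1) (v z - l) \<partial>M)"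

lemma signed_power_measurable [measurable]: "signed_power (q - 1) \<in> borel_measurable borel"
  unfolding signed_power_def by measurable

lemma v_diff_bound: "z \<in> space M \<Longrightarrow> \<bar>v z - l\<bar> \<le> 1 + \<bar>l\<bar>"
  using v01[of z] by linarith

lemma integrable_signed_power: "integrable M (\<lambda>z. signed_power (q - 1) (v z - l))"
  by (rule integrable_const_bound[where B="(1 + \<bar>l\<bar>) powr (q - 1)"])
    (use signed_power_bound[OF _ v_diff_bound] q in auto)

lemma integrable_abs_powr: "integrable M (\<lambda>z. \<bar>v z - l\<bar> powr q)"
  by (rule integrable_const_bound[where B="(1 + \<bar>l\<bar>) powr q"])
    (use v_diff_bound q in \<open>auto intro!: powr_mono2\<close>)

lemma moment_antimono: "l \<le> l' \<Longrightarrow> moment l' \<le> moment l"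
  unfolding moment_def using q
  by (intro integral_mono integrable_signed_power signed_power_mono) auto

lemma moment_continuous: "continuous_on UNIV moment"
proof (rule continuous_on_sequentiallyI)
  fix l :: "nat \<Rightarrow> real" and l0 :: real
  assume l: "l \<longlonglongrightarrow> l0"
  obtain B where B: "\<And>k. \<bar>l k\<bar> \<le> B"
    using convergent_imp_Bseq[OF convergentI[OF l]] unfolding Bseq_def by auto
  have "(\<lambda>k. \<integral>z. signed_power (q - 1) (v z - l k) \<partial>M) \<longlonglongrightarrow> (\<integral>z. signed_power (q - 1) (v z - l0) \<partial>M)"
  proof (rule integral_dominated_convergence[where w="\<lambda>_. (1 + B) powr (q - 1)"])
    have "isCont (signed_power (q - 1)) t" for t
      using continuous_signed_power[of "q - 1"] q by (simp add: continuous_on_eq_continuous_at)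
    thus "AE z in M. (\<lambda>k. signed_power (q - 1) (v z - l k)) \<longlonglongrightarrow> signed_power (q - 1) (v z - l0)"
      by (intro AE_I2) (rule isCont_tendsto_compose[OF _ tendsto_diff[OF tendsto_const l]])
    show "AE z in M. norm (signed_power (q - 1) (v z - l k)) \<le> (1 + B) powr (q - 1)" for k
    proof (rule AE_I2)
      fix z assume "z \<in> space M"
      hence "\<bar>v z - l k\<bar> \<le> 1 + B" using v_diff_bound[of z "l k"] B[of k] by linarith
      thus "norm (signed_power (q - 1) (v z - l k)) \<le> (1 + B) powr (q - 1)"
        using signed_power_bound[of "q - 1"] q by simp
    qed
  qed auto
  thus "(\<lambda>k. moment (l k)) \<longlonglongrightarrow> moment l0" unfolding moment_def .
qed

lemma moment_root: "\<exists>m. moment m = 0"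
proof -
  have "moment 0 \<ge> 0" unfolding moment_def
    using v01 by (intro integral_nonneg_AE AE_I2) (simp add: signed_power_def)
  moreover have "(\<integral>z. signed_power (q - 1) (v z - 1) \<partial>M) \<le> (\<integral>z. 0 \<partial>M)"
    using v01 by (intro integral_mono integrable_signed_power) (simp_all add: signed_power_def)
  hence "moment 1 \<le> 0" unfolding moment_def by simp
  ultimately show ?thesis
    using IVT2'[of moment 1 0 0] continuous_on_subset[OF moment_continuous] by auto
qed

text \<open>Integrating the tangent inequality at \<open>v - m\<close>, the linear term becomes a
  multiple of the moment and vanishes; strictness survives because the space has positive
  measure.\<close>

lemma abs_powr_integral_less:
  assumes m: "moment m = 0" and l: "l \<noteq> m"
  shows "(\<integral>z. \<bar>v z - m\<bar> powr q \<partial>M) < (\<integral>z. \<bar>v z - l\<bar> powr q \<partial>M)"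
proof -
  let ?g = "\<lambda>z. \<bar>v z - m\<bar> powr q + q * signed_power (q - 1) (v z - m) * (m - l)"
  have gi: "integrable M ?g"
    using integrable_abs_powr integrable_signed_power by (intro Bochner_Integration.integrable_add integrable_mult_left integrable_mult_right) auto
  have "(\<integral>z. ?g z \<partial>M) = (\<integral>z. \<bar>v z - m\<bar> powr q \<partial>M) + q * moment m * (m - l)"
    using integrable_abs_powr integrable_signed_power by (simp add: moment_def)
  moreover have "(\<integral>z. ?g z \<partial>M) < (\<integral>z. \<bar>v z - l\<bar> powr q \<partial>M)"
  proof (rule integral_less_AE_space[OF gi integrable_abs_powr])
    have "?g z < \<bar>v z - l\<bar> powr q" for z
      using abs_powr_above_tangent[OF q, of "v z - l" "v z - m"] l by (simp add: algebra_simps)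
    thus "AE z in M. ?g z < \<bar>v z - l\<bar> powr q" by simp
  qed (rule M(2))
  ultimately show ?thesis using m by simp
qed

lemma Lq_norm_eq: "Lq_norm (ereal q) M (\<lambda>z. v z - l) = ereal ((\<integral>z. \<bar>v z - l\<bar> powr q \<partial>M) powr (1 / q))"
  unfolding Lq_norm_def using integrable_abs_powr by simp

lemma Lq_minimizer_eq:
  assumes m: "moment m = 0"
  shows "(THE \<mu>. \<forall>\<xi>::real. Lq_norm (ereal q) M (\<lambda>z. v z - \<mu>) \<le> Lq_norm (ereal q) M (\<lambda>z. v z - \<xi>)) = m"
proof (rule the_equality)
  show "\<forall>\<xi>::real. Lq_norm (ereal q) M (\<lambda>z. v z - m) \<le> Lq_norm (ereal q) M (\<lambda>z. v z - \<xi>)"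
  proof
    fix \<xi>
    have "(\<integral>z. \<bar>v z - m\<bar> powr q \<partial>M) \<le> (\<integral>z. \<bar>v z - \<xi>\<bar> powr q \<partial>M)"
      using abs_powr_integral_less[OF m, of \<xi>] by (cases "\<xi> = m") auto
    thus "Lq_norm (ereal q) M (\<lambda>z. v z - m) \<le> Lq_norm (ereal q) M (\<lambda>z. v z - \<xi>)"
      unfolding Lq_norm_eq using q by (auto intro!: powr_mono2 integral_nonneg_AE)
  qed
next
  fix \<mu> :: real
  assume *: "\<forall>\<xi>::real. Lq_norm (ereal q) M (\<lambda>z. v z - \<mu>) \<le> Lq_norm (ereal q) M (\<lambda>z. v z - \<xi>)"
  show "\<mu> = m"
  proof (rule ccontr)
    assume "\<mu> \<noteq> m"
    hence "(\<integral>z. \<bar>v z - m\<bar> powr q \<partial>M) powr (1 / q) < (\<integral>z. \<bar>v z - \<mu>\<bar> powr q \<partial>M) powr (1 / q)"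
      using q by (intro powr_less_mono2 abs_powr_integral_less[OF m]) (auto intro!: integral_nonneg_AE)
    thus False using *[rule_format, of m] unfolding Lq_norm_eq by simp
  qed
qed

text \<open>Shows that the description in the q-mean is proper: a zero of the moment exists by the
  intermediate value theorem, and every zero is the unique minimizer.\<close>

lemma Lq_minimizer_moment:
  "moment (THE \<mu>. \<forall>\<xi>::real. Lq_norm (ereal q) M (\<lambda>z. v z - \<mu>) \<le> Lq_norm (ereal q) M (\<lambda>z. v z - \<xi>)) = 0"
  using moment_root Lq_minimizer_eq by metis

end

text \<open>The N - 1 Gaussian factors and the tail factor 1/c, with c = rd, combine to
  c^(-(N+1)/2); the powers of R cancel against the volume of the ball; and the duplication formula
  turns the Gamma value in that volume into N! / Gamma((N + 1) / 2).\<close>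

lemma powr_limit_constant:
  fixes a :: "'b \<Rightarrow> real" and r d R :: real and n :: nat
  assumes A: "finite A" "card A = n - 1" and n: "n \<ge> 1" and pos: "r > 0" "d > 0" "R > 0"
    and a: "\<And>b. b \<in> A \<Longrightarrow> a b < 1 / R"
  shows "(1 / (r * d)) * (\<Prod>b\<in>A. sqrt (2 * pi / (r * d * (1 / R - a b)))) * R powr ((real n + 1) / 2)
      / (unit_ball_vol (real n) * R ^ n) =
    2 powr (- (real n + 1) / 2) * fact n / (r powr ((real n + 1) / 2) * Gamma ((real n + 1) / 2))
      / sqrt ((d\<^sup>2) powr ((real n + 1) / 2) * (\<Prod>b\<in>A. 1 - R * a b))"
proof -
  define c where "c = r * d"
  define k where "k = (real n + 1) / 2"
  have c: "c > 0" using pos by (simp add: c_def)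
  have S: "0 < 1 - R * a b" if "b \<in> A" for b using a[OF that] pos by (simp add: field_simps)
  define P where "P = (\<Prod>b\<in>A. 1 - R * a b)"
  have P: "P > 0" unfolding P_def using S by (intro prod_pos) auto
  have "sqrt (2 * pi / (c * (1 / R - a b))) = sqrt (2 * pi * R / c) / sqrt (1 - R * a b)" if "b \<in> A" for b
  proof -
    have "2 * pi / (c * (1 / R - a b)) = (2 * pi * R / c) / (1 - R * a b)"
      using pos c S[OF that] by (simp add: field_simps)
    thus ?thesis by (simp only: real_sqrt_divide[of "2 * pi * R / c"])
  qed
  hence "(\<Prod>b\<in>A. sqrt (2 * pi / (c * (1 / R - a b)))) = (\<Prod>b\<in>A. sqrt (2 * pi * R / c) / sqrt (1 - R * a b))"
    by (intro prod.cong) auto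
  also have "\<dots> = sqrt (2 * pi * R / c) ^ (n - 1) / sqrt P"
  proof -
    have "(\<Prod>b\<in>A. sqrt (1 - R * a b)) = sqrt P"
      unfolding P_def using A(1) by (induction rule: finite_induct) (simp_all add: real_sqrt_mult)
    thus ?thesis unfolding prod_dividef by (simp add: A(2))
  qed
  also have "sqrt (2 * pi * R / c) ^ (n - 1) = (2 * pi * R / c) powr (k - 1)"
  proof -
    have "sqrt (2 * pi * R / c) ^ (n - 1) = ((2 * pi * R / c) powr (1/2)) powr real (n - 1)"
      using pos c by (subst powr_realpow) (simp_all add: powr_half_sqrt)
    also have "\<dots> = (2 * pi * R / c) powr (k - 1)"
      unfolding powr_powr using n by (simp add: k_def of_nat_diff field_simps)
    finally show ?thesis .
  qed
  also have "(2 * pi * R / c) powr (k - 1) = 2 powr (k - 1) * pi powr (k - 1) * R powr (k - 1) / c powr (k - 1)"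
    using pos c by (simp add: powr_divide powr_mult)
  finally have prod: "(\<Prod>b\<in>A. sqrt (2 * pi / (c * (1 / R - a b))))
     = 2 powr (k - 1) * pi powr (k - 1) * R powr (k - 1) / c powr (k - 1) / sqrt P" .
  have ck: "c * c powr (k - 1) = c powr k" using c by (simp add: powr_diff)
  have k2: "k - 1 + k = real n" unfolding k_def by (simp add: field_simps)
  have Rk: "R powr (k - 1) * R powr k = R ^ n"
  proof -
    have "R powr (k - 1) * R powr k = R powr real n" unfolding powr_add[symmetric] by (simp add: k2)
    thus ?thesis using pos by (simp add: powr_realpow)
  qed
  have lhs: "(1 / c) * (\<Prod>b\<in>A. sqrt (2 * pi / (c * (1 / R - a b)))) * R powr k / (unit_ball_vol (real n) * R ^ n)
     = 2 powr (k - 1) * pi powr (k - 1) / (c powr k * sqrt P * unit_ball_vol (real n))"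
    unfolding prod Rk[symmetric] ck[symmetric] using pos by simp
  have vol: "unit_ball_vol (real n) = pi powr (k - 1) * sqrt pi / Gamma (k + 1/2)"
  proof -
    have "pi powr (real n / 2) = pi powr (k - 1) * pi powr (1/2)" unfolding powr_add[symmetric] by (simp add: k_def field_simps)
    thus ?thesis by (simp add: unit_ball_vol_def powr_half_sqrt k_def add_divide_distrib add.commute)
  qed
  have k: "k > 0" by (simp add: k_def add_nonneg_pos)
  \<comment> \<open>Duplication at k = (N + 1) / 2, where 2k = N + 1 yields N!; the complex identity
    is specialized to real arguments.\<close>
  have "Gamma k * Gamma (k + 1/2) = exp ((1 - 2 * k) * ln 2) * sqrt pi * Gamma (2 * k)"
  proof -
    have "complex_of_real t \<notin> \<int>\<^sub>\<le>\<^sub>0" if "t > 0" for t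
      using that by (auto elim!: nonpos_Ints_cases simp: complex_eq_iff)
    from this[OF k] this[of "k + 1/2"] k
    have "Gamma (complex_of_real k) * Gamma (complex_of_real k + 1/2) =
       exp ((1 - 2 * complex_of_real k) * complex_of_real (ln 2)) * complex_of_real (sqrt pi) * Gamma (2 * complex_of_real k)"
      by (intro Gamma_legendre_duplication) auto
    also have "complex_of_real k + 1/2 = complex_of_real (k + 1/2)" by simp
    also have "2 * complex_of_real k = complex_of_real (2 * k)" by simp
    also have "(1 - complex_of_real (2 * k)) * complex_of_real (ln 2) = complex_of_real ((1 - 2 * k) * ln 2)" by simp
    finally show ?thesis unfolding Gamma_complex_of_real exp_of_real of_real_mult[symmetric] of_real_eq_iff .
  qed
  also have "exp ((1 - 2 * k) * ln 2) = 2 powr (1 - 2 * k)" by (simp add: powr_def)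
  also have "Gamma (2 * k) = fact n"   proof -
    have "2 * k = 1 + real n" by (simp add: k_def)
    thus ?thesis using Gamma_fact[of n, where 'a=real] by simp
  qed
  finally have dup: "Gamma (k + 1/2) = 2 powr (1 - 2 * k) * sqrt pi * fact n / Gamma k"
    using Gamma_real_pos[OF k] by (simp add: field_simps)
  have two: "2 powr (k - 1) * 2 powr (1 - 2 * k) = 2 powr (- k)" unfolding powr_add[symmetric] by simp
  have "2 powr (k - 1) * pi powr (k - 1) / (c powr k * sqrt P * unit_ball_vol (real n)) =
     (2 powr (k - 1) * 2 powr (1 - 2 * k)) * fact n / (Gamma k * (c powr k * sqrt P))"
    unfolding vol dup using pos Gamma_real_pos[OF k] by (simp add: field_simps)
  also have "\<dots> = 2 powr (- k) * fact n / (r powr k * Gamma k) / (d powr k * sqrt P)"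
    unfolding two c_def using pos by (simp add: powr_mult)
  also have "d powr k * sqrt P = sqrt ((d\<^sup>2) powr k * P)"
  proof -
    have "(d\<^sup>2) powr k = (d powr k)\<^sup>2" using pos by (simp add: power2_eq_square powr_mult)
    thus ?thesis using pos by (simp add: real_sqrt_mult)
  qed
  also have "2 powr (- k) = 2 powr (- (real n + 1) / 2)" by (simp only: k_def minus_divide_left)
  finally show ?thesis using lhs unfolding k_def[symmetric] c_def P_def by simp
qed

section \<open>Asymptotics of the q-means\<close>

lemma exp_over_power_tendsto:
  fixes a m \<tau> R :: real
  assumes "a > 0" "\<tau> > 0" "R > 0"
  shows "((\<lambda>\<epsilon>. exp (- (a / \<epsilon>)) / (\<tau> * (\<epsilon> / R) powr m)) \<longlongrightarrow> 0) (at_right 0)"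
  using assms by real_asymp

context decaying_family
begin

text \<open>Links the completed measure on the ball, over which the q-mean is defined, with the
  Borel integrals to which the change of variables applies.\<close>

lemma integral_lebesgue_on_ball:
  assumes "\<epsilon> > 0" and F[measurable]: "F \<in> borel_measurable borel" and B: "\<forall>t\<in>{0..1}. \<bar>F t\<bar> \<le> B"
  shows "integrable lborel (\<lambda>z. indicator (ball x R) z * (F (u \<epsilon> z) :: real))"
    and "integrable (lebesgue_on (ball x R)) (\<lambda>z. F (u \<epsilon> z))"
    and "(\<integral>z. F (u \<epsilon> z) \<partial>lebesgue_on (ball x R)) = (\<integral>z. indicator (ball x R) z * F (u \<epsilon> z) \<partial>lborel)"
proof -
  have meas: "(\<lambda>z. indicator (ball x R) z * F (u \<epsilon> z)) \<in> borel_measurable borel"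
    by (rule comp_u_measurable[OF assms(1) F])
  show int: "integrable lborel (\<lambda>z. indicator (ball x R) z * F (u \<epsilon> z))"
  proof (rule Bochner_Integration.integrable_bound)
    show "integrable lborel (\<lambda>z. B * indicator (ball x R) z :: real)"
      using emeasure_bounded_finite[OF bounded_ball, of x R]
      by (intro integrable_mult_right integrable_real_indicator) auto
    show "AE z in lborel. norm (indicator (ball x R) z * F (u \<epsilon> z)) \<le> norm (B * indicator (ball x R) z)"
    proof (rule AE_I2)
      fix z
      show "norm (indicator (ball x R) z * F (u \<epsilon> z)) \<le> norm (B * indicator (ball x R) z)"
      proof (cases "z \<in> ball x R")
        case True
        hence "\<bar>F (u \<epsilon> z)\<bar> \<le> B" using u01[OF assms(1)] ball by (intro B[rule_format]) auto
        thus ?thesis using True by simp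
      qed simp
    qed
  qed (use meas in auto)
  have comp: "integrable lebesgue (\<lambda>z. indicator (ball x R) z *\<^sub>R F (u \<epsilon> z))"
    using int meas by (simp add: integrable_completion)
  thus "integrable (lebesgue_on (ball x R)) (\<lambda>z. F (u \<epsilon> z))"
    by (subst integrable_restrict_space) auto
  have "(\<integral>z. F (u \<epsilon> z) \<partial>lebesgue_on (ball x R)) = (\<integral>z. indicator (ball x R) z *\<^sub>R F (u \<epsilon> z) \<partial>lebesgue)"
    by (rule integral_restrict_space) simp
  also have "\<dots> = (\<integral>z. indicator (ball x R) z * F (u \<epsilon> z) \<partial>lborel)"
    using meas by (simp add: integral_completion)
  finally show "(\<integral>z. F (u \<epsilon> z) \<partial>lebesgue_on (ball x R)) = (\<integral>z. indicator (ball x R) z * F (u \<epsilon> z) \<partial>lborel)" .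
qed

lemma ball_measure_space:
  assumes "\<epsilon> > 0"
  shows "finite_measure (lebesgue_on (ball x R))"
    and "emeasure (lebesgue_on (ball x R)) (space (lebesgue_on (ball x R))) \<noteq> 0"
    and "u \<epsilon> \<in> borel_measurable (lebesgue_on (ball x R))"
    and "\<And>z. z \<in> space (lebesgue_on (ball x R)) \<Longrightarrow> 0 \<le> u \<epsilon> z \<and> u \<epsilon> z \<le> 1"
proof -
  show "finite_measure (lebesgue_on (ball x R))" by (rule finite_measure_lebesgue_on) simp
  have "\<not> negligible (ball x R)" by (rule open_not_negligible) (use R in auto)
  hence "emeasure lebesgue (ball x R) \<noteq> 0" by (simp add: negligible_iff_emeasure0)
  thus "emeasure (lebesgue_on (ball x R)) (space (lebesgue_on (ball x R))) \<noteq> 0"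
    by (simp add: emeasure_restrict_space)
  show "u \<epsilon> \<in> borel_measurable (lebesgue_on (ball x R))"
    by (rule continuous_imp_measurable_on_sets_lebesgue[OF u_cont[OF assms]]) simp
  show "0 \<le> u \<epsilon> z \<and> u \<epsilon> z \<le> 1" if "z \<in> space (lebesgue_on (ball x R))" for z
    using that u01[OF assms] ball by auto
qed

abbreviation ball_moment :: "real \<Rightarrow> real \<Rightarrow> real \<Rightarrow> real" where
  "ball_moment q \<epsilon> \<equiv> moment (lebesgue_on (ball x R)) (u \<epsilon>) q"

lemma moment_eq:
  assumes \<epsilon>: "\<epsilon> > 0" and l: "l > 0" and q: "q > 1"
  shows "ball_moment q \<epsilon> l =
    upper_part (q - 1) \<epsilon> l -
    l powr (q - 1) * lower_part (q - 1) \<epsilon> l"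
proof -
  let ?M = "lebesgue_on (ball x R)"
  have b1: "\<forall>t\<in>{0..1}. \<bar>(max 0 (t - l)) powr (q - 1)\<bar> \<le> 1 powr (q - 1)"
    using l q by (auto simp only: abs_of_nonneg powr_ge_zero intro!: powr_mono2) auto
  have b2: "\<forall>t\<in>{0..1}. \<bar>(max 0 (1 - t / l)) powr (q - 1)\<bar> \<le> 1 powr (q - 1)"
    using l q by (auto simp only: abs_of_nonneg powr_ge_zero intro!: powr_mono2) auto
  have m1: "(\<lambda>t. (max 0 (t - l)) powr (q - 1)) \<in> borel_measurable borel" by measurable
  have m2: "(\<lambda>t. (max 0 (1 - t / l)) powr (q - 1)) \<in> borel_measurable borel" by measurable
  note I1 = integral_lebesgue_on_ball[OF \<epsilon> m1 b1]
  note I2 = integral_lebesgue_on_ball[OF \<epsilon> m2 b2]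
  have split: "signed_power (q - 1) (t - l) = (max 0 (t - l)) powr (q - 1) - l powr (q - 1) * (max 0 (1 - t / l)) powr (q - 1)" for t
  proof -
    have "max 0 (- (t - l)) = l * max 0 (1 - t / l)" using l by (auto simp: max_def field_simps)
    thus ?thesis unfolding signed_power_def using l by (simp add: powr_mult)
  qed
  have "ball_moment q \<epsilon> l = (\<integral>z. (max 0 (u \<epsilon> z - l)) powr (q - 1) - l powr (q - 1) * (max 0 (1 - u \<epsilon> z / l)) powr (q - 1) \<partial>?M)"
    by (subst moment_def[OF ball_measure_space[OF \<epsilon>] q]) (simp_all add: split)
  also have "\<dots> = (\<integral>z. (max 0 (u \<epsilon> z - l)) powr (q - 1) \<partial>?M) - l powr (q - 1) * (\<integral>z. (max 0 (1 - u \<epsilon> z / l)) powr (q - 1) \<partial>?M)"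
    using I1(2) I2(2) by simp
  finally show ?thesis using I1(3) I2(3) by simp
qed

definition blowup_integral :: "real \<Rightarrow> real" where
  "blowup_integral r = (\<integral>w. blowup_weight r w \<partial>lborel)"

lemma blowup_integral_eq:
  assumes "r > 0"
  shows "blowup_integral r = (1 / (r * d)) * (\<Prod>b\<in>Basis - {i0}. sqrt (2 * pi / (r * d * (1 / R - \<kappa> (\<beta> b)))))"
  unfolding blowup_integral_def
  by (rule paraboloid_weight_integral[OF i0 R]) (use assms d curv[OF \<beta>_in] in auto)

text \<open>The scale of \<open>l\<close> is forced: its (q - 1)-th power is a constant times
  \<epsilon>^s, the order of the Gaussian part, so both parts survive in the limit.\<close>

lemma scaled_moment_tendsto:
  assumes \<epsilon>: "\<And>k. \<epsilon> k > 0" "\<epsilon> \<longlonglongrightarrow> 0" and \<tau>: "\<tau> > 0" and q: "q > 1"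
  defines "s \<equiv> (real CARD('n) + 1) / 2"
  shows "(\<lambda>k. \<epsilon> k powr (- s) * ball_moment q (\<epsilon> k) (\<tau> * (\<epsilon> k / R) powr (s / (q - 1))))
    \<longlonglongrightarrow> blowup_integral (q - 1) - \<tau> powr (q - 1) * R powr (- s) * measure lborel (ball x R)"
proof -
  define l where "l k = \<tau> * (\<epsilon> k / R) powr (s / (q - 1))" for k
  have s: "s > 0" by (simp add: s_def add_nonneg_pos)
  have l: "l k > 0" for k using \<tau> \<epsilon>(1)[of k] R by (simp add: l_def)
  have "(\<lambda>k. \<tau> * (\<epsilon> k / R) powr (s / (q - 1))) \<longlonglongrightarrow> \<tau> * (0 / R) powr (s / (q - 1))"
  proof (intro tendsto_mult tendsto_const tendsto_powr' tendsto_divide \<epsilon>(2) disjI2 conjI always_eventually allI)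
    show "0 \<le> \<epsilon> k / R" for k using \<epsilon>(1)[of k] R by simp
  qed (use R s q in auto)
  hence l0: "l \<longlonglongrightarrow> 0" by (simp add: l_def[abs_def])
  have at0: "filterlim \<epsilon> (at_right 0) sequentially"
    using \<epsilon> by (intro tendsto_imp_filterlim_at_right) auto
  have fast: "(\<lambda>k. exp (- (a / \<epsilon> k)) / l k) \<longlonglongrightarrow> 0" if "a > 0" for a
    unfolding l_def by (rule filterlim_compose[OF exp_over_power_tendsto[OF that \<tau> R] at0])
  have lr: "\<epsilon> k powr (- s) * l k powr (q - 1) = \<tau> powr (q - 1) * R powr (- s)" for k
  proof -
    have "l k powr (q - 1) = \<tau> powr (q - 1) * (\<epsilon> k / R) powr s"
      unfolding l_def using \<tau> q R \<epsilon>(1)[of k] by (simp add: powr_mult powr_powr)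
    also have "(\<epsilon> k / R) powr s = \<epsilon> k powr s * R powr (- s)"
      using R \<epsilon>(1)[of k] by (simp add: powr_divide powr_minus field_simps)
    finally show ?thesis using \<epsilon>(1)[of k] by (simp add: powr_minus)
  qed
  have "(\<lambda>k. \<epsilon> k powr (- s) * upper_part (q - 1) (\<epsilon> k) (l k)
     - \<tau> powr (q - 1) * R powr (- s) * lower_part (q - 1) (\<epsilon> k) (l k))
    \<longlonglongrightarrow> blowup_integral (q - 1) - \<tau> powr (q - 1) * R powr (- s) * measure lborel (ball x R)"
    unfolding blowup_integral_def s_def
    by (intro tendsto_diff tendsto_mult tendsto_const positive_part_tendsto[OF \<epsilon> less_imp_le[OF l] l0]
        negative_part_tendsto[OF \<epsilon> l _ fast]) (use q in auto)
  moreover have "\<epsilon> k powr (- s) * ball_moment q (\<epsilon> k) (l k) =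
     \<epsilon> k powr (- s) * upper_part (q - 1) (\<epsilon> k) (l k)
     - \<tau> powr (q - 1) * R powr (- s) * lower_part (q - 1) (\<epsilon> k) (l k)" for k
    unfolding moment_eq[OF \<epsilon>(1) l q] lr[of k, symmetric] by (simp add: right_diff_distrib mult.assoc)
  ultimately show ?thesis by (simp add: l_def[symmetric])
qed

lemma q_mean_moment:
  assumes "\<epsilon> > 0" "q > 1"
  shows "ball_moment q \<epsilon> (q_mean (ereal q) (ball x R) (u \<epsilon>)) = 0"
  unfolding q_mean_def by (rule Lq_minimizer_moment[OF ball_measure_space[OF assms(1)] assms(2)])

text \<open>As a function of \<tau> the limit moment vanishes exactly at \<open>T\<close> and
  changes sign there. For \<tau> on either side of \<open>T\<close> the sign persists for small
  \<epsilon>, and monotonicity of the moment places the q-mean on the corresponding side of \<tau>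
  times the scale.\<close>

lemma q_mean_tendsto:
  assumes q: "q > 1"
  defines "s \<equiv> (real CARD('n) + 1) / 2"
  defines "T \<equiv> (blowup_integral (q - 1) * R powr s / measure lborel (ball x R)) powr (1 / (q - 1))"
  assumes T: "blowup_integral (q - 1) > 0"
  shows "((\<lambda>\<epsilon>. (\<epsilon> / R) powr (- (s / (q - 1))) * q_mean (ereal q) (ball x R) (u \<epsilon>)) \<longlongrightarrow> T) (at_right 0)"
  unfolding tendsto_at_iff_sequentially
proof (intro allI impI)
  fix \<epsilon> :: "nat \<Rightarrow> real"
  assume "\<forall>k. \<epsilon> k \<in> {0<..} - {0}" and lim: "\<epsilon> \<longlonglongrightarrow> 0"
  hence \<epsilon>: "\<And>k. \<epsilon> k > 0" by auto
  let ?up = "\<lambda>k. (\<epsilon> k / R) powr (s / (q - 1))" and ?dn = "\<lambda>k. (\<epsilon> k / R) powr (- (s / (q - 1)))"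
  let ?V = "measure lborel (ball x R)"
  define \<mu> where "\<mu> k = q_mean (ereal q) (ball x R) (u (\<epsilon> k))" for k
  have \<mu>0: "ball_moment q (\<epsilon> k) (\<mu> k) = 0" for k unfolding \<mu>_def by (rule q_mean_moment[OF \<epsilon> q])
  have anti: "ball_moment q (\<epsilon> k) l' \<le> ball_moment q (\<epsilon> k) l" if "l \<le> l'" for k l l'
    by (rule moment_antimono[OF ball_measure_space[OF \<epsilon>] q that])
  have V: "?V > 0"
    using content_ball_pos[OF R, of x] by simp
  define X where "X = blowup_integral (q - 1) * R powr s / ?V"
  have X: "X > 0" unfolding X_def using T V R by simp
  have T_pos: "T > 0" using X unfolding T_def X_def[symmetric] by simp
  have TX: "T powr (q - 1) = X" unfolding T_def X_def[symmetric] using X q by (simp add: powr_powr)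
  have lim_eq: "blowup_integral (q - 1) - \<tau> powr (q - 1) * R powr (- s) * ?V = (T powr (q - 1) - \<tau> powr (q - 1)) * (R powr (- s) * ?V)" for \<tau>
    unfolding TX X_def using V R by (simp add: field_simps powr_minus)
  have RV: "R powr (- s) * ?V > 0" using R V by simp
  have sc: "?dn k * ?up k = 1" for k
    using \<epsilon>[of k] R by (simp add: powr_minus)
  have pos: "?dn k > 0" for k using \<epsilon>[of k] R by simp
  have "(\<lambda>k. ?dn k * \<mu> k) \<longlonglongrightarrow> T"
  proof (rule order_tendstoI)
    fix a assume a: "a < T"
    \<comment> \<open>The maximum with 0 keeps \<tau> positive, as the scaled moment limit
      requires.\<close>
    obtain \<tau> where \<tau>: "max a 0 < \<tau>" "\<tau> < T" using dense[of "max a 0" T] a T_pos by auto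
    have "\<tau> powr (q - 1) < T powr (q - 1)" using \<tau> q by (intro powr_less_mono2) auto
    hence "0 < blowup_integral (q - 1) - \<tau> powr (q - 1) * R powr (- s) * ?V"
      unfolding lim_eq by (intro mult_pos_pos[OF _ RV]) simp
    from order_tendstoD(1)[OF scaled_moment_tendsto[OF \<epsilon> lim _ q, of \<tau>, folded s_def] this] \<tau>
    have "\<forall>\<^sub>F k in sequentially. 0 < \<epsilon> k powr (- s) * ball_moment q (\<epsilon> k) (\<tau> * ?up k)" by simp
    thus "\<forall>\<^sub>F k in sequentially. a < ?dn k * \<mu> k"
    proof eventually_elim
      case (elim k)
      hence "0 < ball_moment q (\<epsilon> k) (\<tau> * ?up k)"
        using \<epsilon>[of k] by (simp add: zero_less_mult_iff)
      hence "\<tau> * ?up k < \<mu> k" using anti[of "\<mu> k" _ k] \<mu>0[of k] by (metis leI not_less)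
      hence "?dn k * (\<tau> * ?up k) < ?dn k * \<mu> k"
        using pos by (rule mult_strict_left_mono)
      moreover have "?dn k * (\<tau> * ?up k) = \<tau>"
        using sc[of k] by (metis mult.assoc mult.commute mult_1)
      ultimately show ?case using \<tau>(1) by simp
    qed
  next
    fix a assume a: "T < a"
    obtain \<tau> where \<tau>: "T < \<tau>" "\<tau> < a" using dense[OF a] by auto
    have "T powr (q - 1) < \<tau> powr (q - 1)" using \<tau> q T_pos by (intro powr_less_mono2) auto
    hence "blowup_integral (q - 1) - \<tau> powr (q - 1) * R powr (- s) * ?V < 0"
      unfolding lim_eq by (intro mult_neg_pos[OF _ RV]) simp
    from order_tendstoD(2)[OF scaled_moment_tendsto[OF \<epsilon> lim _ q, of \<tau>, folded s_def] this] \<tau> T_pos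
    have "\<forall>\<^sub>F k in sequentially. \<epsilon> k powr (- s) * ball_moment q (\<epsilon> k) (\<tau> * ?up k) < 0" by simp
    thus "\<forall>\<^sub>F k in sequentially. ?dn k * \<mu> k < a"
    proof eventually_elim
      case (elim k)
      hence "ball_moment q (\<epsilon> k) (\<tau> * ?up k) < 0"
        using \<epsilon>[of k] by (simp add: mult_less_0_iff)
      hence "\<mu> k < \<tau> * ?up k" using anti[of _ "\<mu> k" k] \<mu>0[of k] by (metis leI not_less)
      hence "?dn k * \<mu> k < ?dn k * (\<tau> * ?up k)"
        using pos by (rule mult_strict_left_mono)
      moreover have "?dn k * (\<tau> * ?up k) = \<tau>"
        using sc[of k] by (metis mult.assoc mult.commute mult_1)
      ultimately show ?case using \<tau>(2) by simp
    qed
  qed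
  thus "((\<lambda>\<epsilon>. (\<epsilon> / R) powr (- (s / (q - 1))) * q_mean (ereal q) (ball x R) (u \<epsilon>)) \<circ> \<epsilon>) \<longlonglongrightarrow> T"
    by (simp add: comp_def \<mu>_def)
qed

lemma limit_constant:
  assumes q: "q > 1"
  shows "blowup_integral (q - 1) > 0"
    and "(blowup_integral (q - 1) * R powr ((real CARD('n) + 1) / 2) / measure lborel (ball x R)) powr (1 / (q - 1)) =
      c_const CARD('n) q / ((d\<^sup>2) powr ((real CARD('n) + 1) / 2) * (\<Prod>j\<in>{1..<CARD('n)}. 1 - R * \<kappa> j)) powr (1 / (2 * (q - 1)))"
proof -
  let ?s = "(real CARD('n) + 1) / 2"
  define r where "r = q - 1"
  have r: "r > 0" using q by (simp add: r_def)
  have \<kappa>: "\<kappa> (\<beta> b) < 1 / R" if "b \<in> Basis - {i0}" for b using curv[OF \<beta>_in[OF that]] .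
  show "blowup_integral (q - 1) > 0"
    unfolding r_def[symmetric] blowup_integral_eq[OF r] using r d \<kappa> by (intro mult_pos_pos prod_pos) auto
  define P where "P = (\<Prod>j\<in>{1..<CARD('n)}. 1 - R * \<kappa> j)"
  have P: "P = (\<Prod>b\<in>Basis - {i0}. 1 - R * \<kappa> (\<beta> b))"
    unfolding P_def by (rule prod.reindex_bij_betw[OF \<beta>, symmetric])
  have P_pos: "P > 0" unfolding P_def
  proof (intro prod_pos)
    fix j assume "j \<in> {1..<CARD('n)}"
    from curv[OF this] show "0 < 1 - R * \<kappa> j" using R by (simp add: field_simps)
  qed
  define Y where "Y = (d\<^sup>2) powr ?s * P"
  have Y: "Y > 0" using d P_pos by (simp add: Y_def)
  define C where "C = 2 powr (- (real CARD('n) + 1) / 2) * fact CARD('n) / (r powr ?s * Gamma ?s)"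
  have s: "?s > 0" by (simp add: add_nonneg_pos)
  have C: "C > 0" unfolding C_def using r Gamma_real_pos[OF s] by simp
  have card: "card (Basis - {i0}) = CARD('n) - 1" using i0 by simp
  have "measure lborel (ball x R) = unit_ball_vol (real CARD('n)) * R ^ CARD('n)"
    using content_ball[of R x] R by simp
  hence "blowup_integral (q - 1) * R powr ?s / measure lborel (ball x R) = C / sqrt Y"
    unfolding r_def[symmetric] blowup_integral_eq[OF r] C_def Y_def P
    using powr_limit_constant[OF finite_Basis' card _ r d R, of "\<lambda>b. \<kappa> (\<beta> b)"] \<kappa> by simp
  also have "\<dots> powr (1 / r) = C powr (1 / r) / sqrt Y powr (1 / r)"
    using C Y by (simp add: powr_divide)
  \<comment> \<open>The square root from the Gaussian factors is what doubles the denominator to 2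
    (q - 1).\<close>
  also have "sqrt Y powr (1 / r) = Y powr (1 / (2 * r))"
    using Y by (simp add: powr_half_sqrt[symmetric] powr_powr)
  also have "C powr (1 / r) = c_const CARD('n) q" by (simp add: c_const_def C_def r_def)
  finally show "(blowup_integral (q - 1) * R powr ?s / measure lborel (ball x R)) powr (1 / (q - 1)) =
      c_const CARD('n) q / ((d\<^sup>2) powr ?s * (\<Prod>j\<in>{1..<CARD('n)}. 1 - R * \<kappa> j)) powr (1 / (2 * (q - 1)))"
    by (simp add: Y_def P_def r_def)
qed

end

section \<open>The case q = \<infinity>: the midpoint between infimum and supremum\<close>

lemma abs_le_esssup_lebesgue_on:
  fixes g :: "'a::euclidean_space \<Rightarrow> real"
  assumes S: "open S" and g: "continuous_on S g" and z: "z \<in> S"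
  shows "ereal \<bar>g z\<bar> \<le> esssup (lebesgue_on S) (\<lambda>w. ereal \<bar>g w\<bar>)"
proof (rule ccontr)
  define E where "E = esssup (lebesgue_on S) (\<lambda>w. ereal \<bar>g w\<bar>)"
  assume "\<not> ?thesis"
  hence lt: "E < ereal \<bar>g z\<bar>" by (simp add: E_def)
  \<comment> \<open>By continuity a value above the essential supremum at one point would persist on
    a nonempty open set, which is not negligible.\<close>
  define U where "U = S \<inter> (\<lambda>w. ereal \<bar>g w\<bar>) -` {E<..}"
  have "continuous_on S (\<lambda>w. ereal \<bar>g w\<bar>)" by (intro continuous_intros g)
  hence "open U" unfolding U_def by (rule continuous_open_preimage[OF _ S]) simp
  moreover have "z \<in> U" using z lt by (simp add: U_def)
  ultimately have "\<not> negligible U" using open_not_negligible by blast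
  moreover have "negligible U"
  proof -
    have "AE w in lebesgue_on S. ereal \<bar>g w\<bar> \<le> E" unfolding E_def by (rule esssup_AE)
    hence "AE w in lebesgue. w \<in> S \<longrightarrow> ereal \<bar>g w\<bar> \<le> E" using S by (subst (asm) AE_restrict_space_iff) auto
    then obtain K where K: "K \<in> null_sets lebesgue" "{w \<in> space lebesgue. \<not> (w \<in> S \<longrightarrow> ereal \<bar>g w\<bar> \<le> E)} \<subseteq> K"
      unfolding eventually_ae_filter by blast
    have "U \<subseteq> K" using K(2) by (auto simp: U_def not_le)
    thus ?thesis using K(1) negligible_iff_null_sets negligible_subset by blast
  qed
  ultimately show False by blast
qed

text \<open>If \<open>a\<close> and \<open>b\<close> are the exact infimum and supremum, the sup
  norm of v - m is max (b - m) (m - a), that is (b - a)/2 plus the distance from m to the midpoint;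
  this has a unique minimum.\<close>

lemma q_mean_infinity:
  fixes v :: "real^'n \<Rightarrow> real"
  assumes S: "open S" "S \<noteq> {}" and v: "continuous_on S v"
    and bd: "\<And>z. z \<in> S \<Longrightarrow> a \<le> v z \<and> v z \<le> b"
    and inf: "\<And>t. t > a \<Longrightarrow> \<exists>z\<in>S. v z < t" and sup: "\<And>t. t < b \<Longrightarrow> \<exists>z\<in>S. v z > t"
  shows "q_mean \<infinity> S v = (a + b) / 2"
proof -
  let ?N = "\<lambda>m. Lq_norm \<infinity> (lebesgue_on S) (\<lambda>z. v z - m)"
  let ?m = "(a + b) / 2"
  have Sl: "S \<in> sets lebesgue" using S(1) by simp
  have meas: "v \<in> borel_measurable (lebesgue_on S)" by (rule continuous_imp_measurable_on_sets_lebesgue[OF v Sl])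
  have up: "?N ?m \<le> ereal ((b - a) / 2)"
  proof -
    have "AE z in lebesgue_on S. ereal \<bar>v z - ?m\<bar> \<le> ereal ((b - a) / 2)"
    proof (rule AE_I2)
      fix z assume "z \<in> space (lebesgue_on S)"
      hence "a \<le> v z" "v z \<le> b" using bd by auto
      thus "ereal \<bar>v z - ?m\<bar> \<le> ereal ((b - a) / 2)" by (simp add: abs_le_iff field_simps)
    qed
    moreover have "(\<lambda>z. ereal \<bar>v z - ?m\<bar>) \<in> borel_measurable (lebesgue_on S)" using meas by measurable
    ultimately show ?thesis unfolding Lq_norm_def by (simp add: esssup_I)
  qed
  have low: "ereal ((b - a) / 2 + \<bar>m - ?m\<bar>) \<le> ?N m" for m
  proof -
    have pt: "ereal \<bar>v z - m\<bar> \<le> ?N m" if "z \<in> S" for z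
      unfolding Lq_norm_def using abs_le_esssup_lebesgue_on[OF S(1) _ that, of "\<lambda>z. v z - m"] v
      by (simp add: continuous_on_diff)
    have 1: "ereal (b - m) \<le> ?N m"
    proof (rule ereal_le_epsilon2)
      fix e :: real assume e: "0 < e"
      obtain z where z: "z \<in> S" "v z > b - e" using sup[of "b - e"] e by auto
      have "ereal (b - m) \<le> ereal \<bar>v z - m\<bar> + ereal e" using z by simp
      also have "\<dots> \<le> ?N m + ereal e" using pt[OF z(1)] by (rule add_right_mono)
      finally show "ereal (b - m) \<le> ?N m + ereal e" .
    qed
    have 2: "ereal (m - a) \<le> ?N m"
    proof (rule ereal_le_epsilon2)
      fix e :: real assume e: "0 < e"
      obtain z where z: "z \<in> S" "v z < a + e" using inf[of "a + e"] e by auto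
      have "ereal (m - a) \<le> ereal \<bar>v z - m\<bar> + ereal e" using z by simp
      also have "\<dots> \<le> ?N m + ereal e" using pt[OF z(1)] by (rule add_right_mono)
      finally show "ereal (m - a) \<le> ?N m + ereal e" .
    qed
    have "(b - a) / 2 + \<bar>m - ?m\<bar> = max (b - m) (m - a)" by (simp add: max_def abs_if field_simps)
    thus ?thesis using 1 2 by (simp add: max_def)
  qed
  show ?thesis unfolding q_mean_def
  proof (rule the_equality)
    show "\<forall>\<xi>. ?N ?m \<le> ?N \<xi>"
    proof
      fix \<xi>
      have "?N ?m \<le> ereal ((b - a) / 2)" by (rule up)
      also have "\<dots> \<le> ereal ((b - a) / 2 + \<bar>\<xi> - ?m\<bar>)" by simp
      also have "\<dots> \<le> ?N \<xi>" by (rule low)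
      finally show "?N ?m \<le> ?N \<xi>" .
    qed
    fix \<mu> :: real assume *: "\<forall>\<xi>. ?N \<mu> \<le> ?N \<xi>"
    have "ereal ((b - a) / 2 + \<bar>\<mu> - ?m\<bar>) \<le> ereal ((b - a) / 2)"
      using low[of \<mu>] *[rule_format, of ?m] up by (meson order_trans)
    hence "(b - a) / 2 + \<bar>\<mu> - ?m\<bar> \<le> (b - a) / 2" by (simp only: ereal_less_eq)
    hence "\<bar>\<mu> - ?m\<bar> \<le> 0" by linarith
    thus "\<mu> = ?m" by simp
  qed
qed

theorem theorem3p5:
  fixes p :: ereal and p' R :: real
    and \<Omega> :: "(real^'n) set" and x y :: "real^'n"
    and \<kappa> :: "nat \<Rightarrow> real" and u :: "real \<Rightarrow> real^'n \<Rightarrow> real"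
  assumes "CARD('n) \<ge> 2"
    and "1 < p" and "1 / p + 1 / ereal p' = 1"
    and "C2_domain \<Omega>" and "uniform_ball_conditions \<Omega>"
    and "x \<in> \<Omega>" and "R > 0" and "ball x R \<subseteq> \<Omega>"
    and "y \<in> frontier \<Omega>" and "cball x R \<inter> (- \<Omega>) = {y}"
    and "principal_curvatures \<Omega> y \<kappa>"
    and "\<And>j. j \<in> {1..<CARD('n)} \<Longrightarrow> \<kappa> j < 1 / R"
    and "\<And>\<epsilon>. \<epsilon> > 0 \<Longrightarrow> bounded_viscosity_solution p \<epsilon> \<Omega> (u \<epsilon>)"
  shows "(\<forall>q::real. 1 < q \<longrightarrow>
           ((\<lambda>\<epsilon>. (\<epsilon> / R) powr (- ((real CARD('n) + 1) / (2 * (q - 1)))) *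
                  q_mean (ereal q) (ball x R) (u \<epsilon>))
             \<longlongrightarrow> c_const CARD('n) q /
                  (p' powr ((real CARD('n) + 1) / 2) * (\<Prod>j\<in>{1..<CARD('n)}. 1 - R * \<kappa> j))
                    powr (1 / (2 * (q - 1)))) (at_right 0)) \<and>
         ((\<lambda>\<epsilon>. q_mean \<infinity> (ball x R) (u \<epsilon>)) \<longlongrightarrow> 1 / 2) (at_right 0)"
proof -
  have dom: "open \<Omega>" using assms(4) by (simp add: C2_domain_def)
  have P: "0 \<le> recip p" "recip p < 1" "p' > 0" "(1 - recip p) * p' = 1"
  proof -
    \<comment> \<open>In \<open>ereal\<close>, division of 1 by 0 gives \<infinity>, so p' = 0 has
      to be excluded before passing to real reciprocals.\<close>
    have p'0: "p' \<noteq> 0"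
    proof
      assume "p' = 0"
      hence "1 / ereal p' = \<infinity>" by (simp add: divide_ereal_def)
      with assms(3) have "1 / p + \<infinity> = 1" by metis
      thus False by (cases "1 / p") (auto simp: one_ereal_def)
    qed
    have "0 \<le> recip p \<and> recip p < 1 \<and> recip p + 1 / p' = 1"
    proof (cases p)
      case (real r)
      hence r: "r > 1" using assms(2) by (simp add: one_ereal_def)
      have "1 / p = ereal (1 / r)" using real r by (simp add: one_ereal_def)
      moreover have "1 / ereal p' = ereal (1 / p')" using p'0 by (simp add: one_ereal_def)
      ultimately show ?thesis using assms(3) r by (simp add: one_ereal_def)
    next
      case PInf
      moreover have "1 / ereal p' = ereal (1 / p')" using p'0 by (simp add: one_ereal_def)
      ultimately show ?thesis using assms(3) by (simp add: one_ereal_def)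
    qed (use assms(2) in auto)
    moreover from this have "1 / p' > 0" by linarith
    hence "p' > 0" by simp
    ultimately show "0 \<le> recip p" "recip p < 1" "p' > 0" "(1 - recip p) * p' = 1"
      by (auto simp: field_simps)
  qed
  define d where "d = sqrt p'"
  have d_props: "d > 0" "(1 - recip p) * d\<^sup>2 = 1" "d\<^sup>2 = p'" using P by (simp_all add: d_def)
  obtain \<nu> \<gamma> e where graph: "C2_graph_at \<Omega> y \<nu> \<gamma>" "grad \<gamma> y = 0"
    and e: "\<And>i. i \<in> {1..<CARD('n)} \<Longrightarrow> e i \<bullet> \<nu> = 0"
      "\<And>i j. i \<in> {1..<CARD('n)} \<Longrightarrow> j \<in> {1..<CARD('n)} \<Longrightarrow> e i \<bullet> e j = (if i = j then 1 else 0)"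
      "\<And>i. i \<in> {1..<CARD('n)} \<Longrightarrow> hessian \<gamma> y *v e i = \<kappa> i *\<^sub>R e i"
    using assms(11) unfolding principal_curvatures_def by blast
  interpret touching_ball \<Omega> x y \<nu> R \<gamma> \<kappa> e
    by unfold_locales (fact dom assms(7,8,10) graph e assms(12))+
  obtain ri re where r: "ri > 0" "re > 0"
    and balls: "\<And>y. y \<in> frontier \<Omega> \<Longrightarrow> \<exists>zi\<in>\<Omega>. \<exists>ze\<in>- closure \<Omega>.
        ball zi ri \<subseteq> \<Omega> \<and> \<Omega> \<subseteq> - cball ze re \<and> cball zi ri \<inter> cball ze re = {y}"
    using assms(5) unfolding uniform_ball_conditions_def by blast
  have cont: "continuous_on (closure \<Omega>) (u \<epsilon>)" if "\<epsilon> > 0" for \<epsilon>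
    by (rule solution_continuous[OF dom assms(13)[OF that]])
  have u01: "0 \<le> u \<epsilon> z \<and> u \<epsilon> z \<le> 1" if "\<epsilon> > 0" "z \<in> \<Omega>" for \<epsilon> z
    using solution_nonneg[OF dom assms(13)[OF that(1)]] solution_le_1[OF dom assms(13)[OF that(1)]]
      that(2) closure_subset by blast
  interpret decaying_family \<Omega> x y \<nu> R \<gamma> \<kappa> e u d ri
  proof
    show "continuous_on (ball x R) (u \<epsilon>)" if "\<epsilon> > 0" for \<epsilon>
      using continuous_on_subset[OF cont[OF that]] ball closure_subset by blast
    show "\<exists>\<epsilon>0>0. \<forall>\<epsilon> z. 0 < \<epsilon> \<longrightarrow> \<epsilon> < \<epsilon>0 \<longrightarrow> z \<in> \<Omega> \<longrightarrow>
        decay_bounds \<Omega> u d ri \<eta> \<epsilon> z" if "0 < \<eta>" "\<eta> < 1" for \<eta>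
      by (rule solution_decay[OF P(1,2) d_props(1,2) assms(1) dom complement_nonempty r _ _ that])
        (fact balls assms(13))+
  qed (fact d_props(1) r(1) u01)+
  have main: "((\<lambda>\<epsilon>. (\<epsilon> / R) powr (- ((real CARD('n) + 1) / (2 * (q - 1)))) * q_mean (ereal q) (ball x R) (u \<epsilon>))
     \<longlongrightarrow> c_const CARD('n) q / (p' powr ((real CARD('n) + 1) / 2) * (\<Prod>j\<in>{1..<CARD('n)}. 1 - R * \<kappa> j))
          powr (1 / (2 * (q - 1)))) (at_right 0)" if q: "1 < q" for q
    using q_mean_tendsto[OF q limit_constant(1)[OF q]] unfolding limit_constant(2)[OF q] d_props(3) by simp
  \<comment> \<open>The supremum over the ball is 1 for every \<epsilon>: the contact point lies in
    the closure of the ball and \<open>u\<close> equals 1 there.\<close>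
  have sup: "\<exists>z\<in>ball x R. u \<epsilon> z > t" if "\<epsilon> > 0" "t < 1" for \<epsilon> t
  proof -
    have y_cl: "y \<in> closure (ball x R)" using y(2) R by simp
    have c: "continuous_on (closure (ball x R)) (u \<epsilon>)"
      by (rule continuous_on_subset[OF cont[OF that(1)] closure_mono[OF ball]])
    have u_y: "u \<epsilon> y = 1" by (rule solution_boundary[OF dom assms(13)[OF that(1)] assms(9)])
    show ?thesis
    proof (rule ccontr)
      assume "\<not> ?thesis"
      hence "u \<epsilon> y \<le> t" by (intro continuous_le_on_closure[OF c y_cl]) (auto simp: not_less)
      thus False using u_y that(2) by simp
    qed
  qed
  define a where "a \<epsilon> = (INF z\<in>ball x R. u \<epsilon> z)" for \<epsilon>
  have bdd: "bdd_below (u \<epsilon> ` ball x R)" if "\<epsilon> > 0" for \<epsilon>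
    using u01[OF that] ball by (intro bdd_belowI[of _ 0]) auto
  have ne: "ball x R \<noteq> {}" using R by simp
  have mean_inf: "q_mean \<infinity> (ball x R) (u \<epsilon>) = (a \<epsilon> + 1) / 2" if "\<epsilon> > 0" for \<epsilon>
  proof (rule q_mean_infinity[OF open_ball ne u_cont[OF that]])
    show "a \<epsilon> \<le> u \<epsilon> z \<and> u \<epsilon> z \<le> 1" if "z \<in> ball x R" for z
      using cINF_lower[OF bdd[OF \<open>\<epsilon> > 0\<close>] that] u01[OF \<open>\<epsilon> > 0\<close>] that ball by (auto simp: a_def)
    show "\<exists>z\<in>ball x R. u \<epsilon> z < t" if "t > a \<epsilon>" for t
      using that cINF_less_iff[OF ne bdd[OF \<open>\<epsilon> > 0\<close>]] by (simp add: a_def)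
    show "\<exists>z\<in>ball x R. u \<epsilon> z > t" if "t < 1" for t using sup[OF \<open>\<epsilon> > 0\<close> that] .
  qed
  have "(a \<longlongrightarrow> 0) (at_right 0)"
  proof (rule tendsto_sandwich[OF _ _ tendsto_const])
    show "\<forall>\<^sub>F \<epsilon> in at_right 0. 0 \<le> a \<epsilon>"
      using eventually_at_right_less[of 0]
      by eventually_elim (use u01 ball ne in \<open>auto simp: a_def intro!: cINF_greatest\<close>)
    \<comment> \<open>The value at the centre \<open>x\<close> already bounds the infimum, and
      \<open>x\<close> has positive distance to \<Gamma>.\<close>
    define k where "k = d / 2 * min (bdist \<Omega> x) ri"
    have k: "k > 0" using d_props(1) r bdist_pos[OF assms(6)] by (simp add: k_def)
    obtain \<epsilon>0 where \<epsilon>0: "\<epsilon>0 > 0" "\<And>\<epsilon>. 0 < \<epsilon> \<Longrightarrow> \<epsilon> < \<epsilon>0 \<Longrightarrow> u \<epsilon> x \<le> exp (- (k / \<epsilon>))"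
      using decay[of "1/2"] assms(6) unfolding k_def by auto
    have "\<forall>\<^sub>F \<epsilon> in at_right 0. \<epsilon> \<in> {0<..<\<epsilon>0}" using \<epsilon>0(1) by (rule eventually_at_right_real)
    thus "\<forall>\<^sub>F \<epsilon> in at_right 0. a \<epsilon> \<le> exp (- (k / \<epsilon>))"
    proof eventually_elim
      case (elim \<epsilon>)
      have "a \<epsilon> \<le> u \<epsilon> x" unfolding a_def using elim R by (intro cINF_lower bdd) auto
      thus ?case using \<epsilon>0(2)[of \<epsilon>] elim by auto
    qed
    show "((\<lambda>\<epsilon>. exp (- (k / \<epsilon>))) \<longlongrightarrow> 0) (at_right 0)" using k by real_asymp
  qed
  hence "((\<lambda>\<epsilon>. (a \<epsilon> + 1) / 2) \<longlongrightarrow> (0 + 1) / 2) (at_right 0)" by (intro tendsto_intros) auto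
  moreover have "\<forall>\<^sub>F \<epsilon> in at_right 0. (a \<epsilon> + 1) / 2 = q_mean \<infinity> (ball x R) (u \<epsilon>)"
    using eventually_at_right_less[of 0] by eventually_elim (simp add: mean_inf)
  ultimately have "((\<lambda>\<epsilon>. q_mean \<infinity> (ball x R) (u \<epsilon>)) \<longlongrightarrow> 1 / 2) (at_right 0)"
    using Lim_transform_eventually by fastforce
  thus ?thesis using main by blast
qed

end
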